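(* Let $n$ be a positive integer and $\check G=\mathrm{GL}_n\times\mathrm{GL}_n$. Let $\mathrm{Wh}_{\check G}=\mathrm{GL}_n\times\mathrm{GL}_n\times\mathcal S_n\times\mathcal S_n$, let $\tau_\rho:\mathrm{Wh}_{\check G}\dashrightarrow\mathrm{Wh}_{\check G}$ be the rational involution $$\tau_\rho(g,h,C_p,C_q)=\bigl(J(g^T)^{-1}q(C_p^T)^{-1}S_p^{-1},\ (-1)^nJ(h^T)^{-1}p(C_q^T)S_q^{-1},\ C_p,\ C_q\bigr),$$ and let $\mathcal A_\tau=\{f\in\mathcal O(\mathrm{Wh}_{\check G}):\tau_\rho^*(f)\in\mathcal O(\mathrm{Wh}_{\check G})\}$. Then there is an isomorphism of affine schemes $$\mathrm{Spec}(\mathcal A_\tau)\cong T^*(\mathrm{GL}_n\times\mathbb C^n)=\mathrm{GL}_n\times\mathfrak{gl}_n\times\mathbb C^n\times(\mathbb C^n)^*$$ which intertwines the $\check G$-action on $\mathrm{Spec}(\mathcal A_\tau)$ with the action $$(g,h)\cdot(a,y,v,u)=\bigl(J(g^T)^{-1}JaJh^{-1}J,\ JhJyJh^{-1}J,\ J(g^T)^{-1}Jv,\ uJg^TJ\bigr).$$ Moreover, the involution $\tau_\rho$ on $\mathrm{Spec}(\mathcal A_\tau)$ is intertwined by this isomorphism with the involution on $T^*(\mathrm{GL}_n\times\mathbb C^n)$ given by $$(a,y,v,u)\mapsto\bigl((-1)^{n-1}J(a^T)^{-1}J,\ Jy^TJ,\ -Ju^T,\ -v^TJ\bigr).$$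
   Context: All varieties are over $\mathbb C$; $(-)^T$ is matrix transposition; elements of $\mathbb C^n$ are column vectors and elements of $(\mathbb C^n)^*$ are row vectors. $J$ is the $n\times n$ antidiagonal matrix with all antidiagonal entries equal to $1$. For a monic polynomial $p=t^n+p_{n-1}t^{n-1}+\dots+p_0$, $C_p$ is its companion matrix, i.e. the matrix of multiplication by $t$ on $\mathbb C[t]/(p(t))$ in the basis $1,t,\dots,t^{n-1}$ (ones on the subdiagonal, last column $(-p_0,\dots,-p_{n-1})^T$), and $S_p$ is the invertible symmetric $n\times n$ matrix with $(i,j)$ entry $p_{i+j-1}$, where $p_n=1$ and $p_k=0$ for $k>n$. $\mathcal S_n\subseteq\mathfrak{gl}_n$ is the affine space of all companion matrices of monic polynomials of degree $n$. Points of $\mathrm{Wh}_{\check G}$ are written $(g,h,C_p,C_q)$ with $p,q$ monic of degree $n$. The group $\check G$ acts on $\mathrm{Wh}_{\check G}$ by $(g,h)\cdot(g',h',a,b)=(gg',hh',a,b)$, and this induces the $\check G$-action on $\mathcal A_\tau\subseteq\mathcal O(\mathrm{Wh}_{\check G})$ and on $\mathrm{Spec}(\mathcal A_\tau)$. Since $\tau_\rho$ is an involution, $f\mapsto\tau_\rho^*(f)$ is an involution of the algebra $\mathcal A_\tau$, and the induced involution of $\mathrm{Spec}(\mathcal A_\tau)$ is also denoted $\tau_\rho$. (Here $\tau_\rho=\theta\circ\sigma_\rho$, where $\sigma_\rho(g,h,C_p,C_q)=(g\,q(C_p),(-1)^nh\,p(C_q)^{-1},C_p,C_q)$ and $\theta(g,h,C_p,C_q)=(J(g^T)^{-1}S_p^{-1},J(h^T)^{-1}S_q^{-1},C_p,C_q)$.)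 The identification of $T^*(\mathrm{GL}_n\times\mathbb C^n)$ uses the left-invariant trivialization of $T^*\mathrm{GL}_n$ and the trace pairing $\mathfrak{gl}_n^*\cong\mathfrak{gl}_n$. *)

theory Defs
  imports
    "HOL-Algebra.QuotRing"
    "HOL-Algebra.Module"
    "HOL-Analysis.Abstract_Topology"
    "HOL-Computational_Algebra.Polynomial"
    "Jordan_Normal_Form.Determinant"
    "Jordan_Normal_Form.Gauss_Jordan_Elimination"
begin

section \<open>Affine schemes over the complex numbers\<close>

text \<open>
  A commutative \<open>\<complex>\<close>-algebra is given by a record of type \<open>(complex, 'a) module\<close>, whose ring
  part is the underlying ring.  \<open>loc_frac A P a s\<close> is the fraction \<open>a/s\<close> in the localization of
  \<open>A\<close> at the prime \<open>P\<close>, that is, the class of the pair \<open>(a, s)\<close>.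
\<close>

definition alg_iso :: "(complex, 'a) module \<Rightarrow> (complex, 'b) module \<Rightarrow> ('a \<Rightarrow> 'b) set" where
  "alg_iso A B = {h \<in> ring_iso A B.
     \<forall>c. \<forall>x\<in>carrier A. h (c \<odot>\<^bsub>A\<^esub> x) = c \<odot>\<^bsub>B\<^esub> h x}"

definition loc_frac :: "(complex, 'a) module \<Rightarrow> 'a set \<Rightarrow> 'a \<Rightarrow> 'a \<Rightarrow> ('a \<times> 'a) set" where
  "loc_frac A P a s = {(b, t). b \<in> carrier A \<and> t \<in> carrier A - P \<and>
     (\<exists>u\<in>carrier A - P. u \<otimes>\<^bsub>A\<^esub> (t \<otimes>\<^bsub>A\<^esub> a) = u \<otimes>\<^bsub>A\<^esub> (s \<otimes>\<^bsub>A\<^esub> b))}"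

text \<open>
  The operations on fractions are computed on representatives; each union below is a union of
  equal classes.
\<close>

definition localization :: "(complex, 'a) module \<Rightarrow> 'a set \<Rightarrow> (complex, ('a \<times> 'a) set) module" where
  "localization A P =
    \<lparr>carrier = {loc_frac A P a s | a s. a \<in> carrier A \<and> s \<in> carrier A - P},
     monoid.mult = (\<lambda>x y. \<Union>(a, s)\<in>x. \<Union>(b, t)\<in>y. loc_frac A P (a \<otimes>\<^bsub>A\<^esub> b) (s \<otimes>\<^bsub>A\<^esub> t)),
     one = loc_frac A P \<one>\<^bsub>A\<^esub> \<one>\<^bsub>A\<^esub>,
     zero = loc_frac A P \<zero>\<^bsub>A\<^esub> \<one>\<^bsub>A\<^esub>,
     add = (\<lambda>x y. \<Union>(a, s)\<in>x. \<Union>(b, t)\<in>y.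
              loc_frac A P (t \<otimes>\<^bsub>A\<^esub> a \<oplus>\<^bsub>A\<^esub> s \<otimes>\<^bsub>A\<^esub> b) (s \<otimes>\<^bsub>A\<^esub> t)),
     module.smult = (\<lambda>c x. \<Union>(a, s)\<in>x. loc_frac A P (c \<odot>\<^bsub>A\<^esub> a) s)\<rparr>"

definition Spec :: "(complex, 'a) module \<Rightarrow> 'a set set" where
  "Spec A = {P. primeideal P A}"

definition zariski :: "(complex, 'a) module \<Rightarrow> 'a set topology" where
  "zariski A = topology (\<lambda>U. \<exists>E\<subseteq>carrier A. U = {P \<in> Spec A. \<not> E \<subseteq> P})"

text \<open>
  Sections of the structure sheaf over \<open>U\<close> are families of elements of the local rings that are
  locally given by a fraction; the restriction maps of the sheaf are \<open>\<lambda>s. restrict s V\<close>.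
\<close>

definition str_sheaf ::
    "(complex, 'a) module \<Rightarrow> 'a set set \<Rightarrow> (complex, 'a set \<Rightarrow> ('a \<times> 'a) set) module" where
  "str_sheaf A U =
    \<lparr>carrier = {s \<in> (\<Pi>\<^sub>E P\<in>U. carrier (localization A P)).
       \<forall>P\<in>U. \<exists>V. openin (zariski A) V \<and> P \<in> V \<and> V \<subseteq> U \<and>
         (\<exists>a\<in>carrier A. \<exists>f\<in>carrier A. \<forall>Q\<in>V. f \<notin> Q \<and> s Q = loc_frac A Q a f)},
     monoid.mult = (\<lambda>s t. \<lambda>P\<in>U. s P \<otimes>\<^bsub>localization A P\<^esub> t P),
     one = (\<lambda>P\<in>U. \<one>\<^bsub>localization A P\<^esub>),
     zero = (\<lambda>P\<in>U. \<zero>\<^bsub>localization A P\<^esub>),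
     add = (\<lambda>s t. \<lambda>P\<in>U. s P \<oplus>\<^bsub>localization A P\<^esub> t P),
     module.smult = (\<lambda>c s. \<lambda>P\<in>U. c \<odot>\<^bsub>localization A P\<^esub> s P)\<rparr>"

text \<open>
  A morphism from \<open>Spec A\<close> to \<open>Spec B\<close> consists of a map on points and, for each open subset \<open>U\<close>
  of \<open>Spec B\<close>, a map from the sections over \<open>U\<close> to the sections over the preimage of \<open>U\<close>.
\<close>

record ('a, 'b) aff_mor =
  on_pts :: "'a set \<Rightarrow> 'b set"
  on_sect :: "'b set set \<Rightarrow> ('b set \<Rightarrow> ('b \<times> 'b) set) \<Rightarrow> ('a set \<Rightarrow> ('a \<times> 'a) set)"

definition pts_vimage ::
    "(complex, 'a) module \<Rightarrow> ('a, 'b) aff_mor \<Rightarrow> 'b set set \<Rightarrow> 'a set set" where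
  "pts_vimage A \<Phi> U = {P \<in> Spec A. on_pts \<Phi> P \<in> U}"

text \<open>
  An isomorphism of schemes over \<open>\<complex>\<close> is a homeomorphism together with an isomorphism of sheaves of
  \<open>\<complex>\<close>-algebras; such an isomorphism induces isomorphisms on stalks, so that the usual locality
  condition on morphisms of locally ringed spaces is automatic.
\<close>

definition aff_iso ::
    "(complex, 'a) module \<Rightarrow> (complex, 'b) module \<Rightarrow> ('a, 'b) aff_mor \<Rightarrow> bool" where
  "aff_iso A B \<Phi> \<longleftrightarrow>
     homeomorphic_map (zariski A) (zariski B) (on_pts \<Phi>) \<and>
     (\<forall>U. openin (zariski B) U \<longrightarrow>
        on_sect \<Phi> U \<in> alg_iso (str_sheaf B U) (str_sheaf A (pts_vimage A \<Phi> U))) \<and>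
     (\<forall>U V. openin (zariski B) U \<longrightarrow> openin (zariski B) V \<longrightarrow> V \<subseteq> U \<longrightarrow>
        (\<forall>s\<in>carrier (str_sheaf B U).
           on_sect \<Phi> V (restrict s V) = restrict (on_sect \<Phi> U s) (pts_vimage A \<Phi> V)))"

definition Spec_mor ::
    "(complex, 'a) module \<Rightarrow> (complex, 'b) module \<Rightarrow> ('a \<Rightarrow> 'b) \<Rightarrow> ('b, 'a) aff_mor" where
  "Spec_mor A B \<psi> =
    \<lparr>on_pts = (\<lambda>Q. {a \<in> carrier A. \<psi> a \<in> Q}),
     on_sect = (\<lambda>U s. \<lambda>Q\<in>{Q \<in> Spec B. {a \<in> carrier A. \<psi> a \<in> Q} \<in> U}.
        \<Union>(a, t)\<in>s {a \<in> carrier A. \<psi> a \<in> Q}. loc_frac B Q (\<psi> a) (\<psi> t))\<rparr>"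

text \<open>
  \<open>\<Phi> \<circ> \<alpha> = \<beta> \<circ> \<Phi>\<close> as morphisms of schemes, for \<open>\<Phi> : Spec A \<rightarrow> Spec B\<close> and endomorphisms \<open>\<alpha>\<close> of
  \<open>Spec A\<close> and \<open>\<beta>\<close> of \<open>Spec B\<close>.
\<close>

definition intertwines ::
    "(complex, 'a) module \<Rightarrow> (complex, 'b) module \<Rightarrow> ('a, 'b) aff_mor \<Rightarrow>
     ('a, 'a) aff_mor \<Rightarrow> ('b, 'b) aff_mor \<Rightarrow> bool" where
  "intertwines A B \<Phi> \<alpha> \<beta> \<longleftrightarrow>
     (\<forall>P\<in>Spec A. on_pts \<Phi> (on_pts \<alpha> P) = on_pts \<beta> (on_pts \<Phi> P)) \<and>
     (\<forall>U. openin (zariski B) U \<longrightarrow> (\<forall>s\<in>carrier (str_sheaf B U).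
        on_sect \<alpha> (pts_vimage A \<Phi> U) (on_sect \<Phi> U s) =
        on_sect \<Phi> (pts_vimage B \<beta> U) (on_sect \<beta> U s)))"


section \<open>Algebras of regular functions\<close>

text \<open>
  \<open>gen_funs X G\<close> is the algebra of functions on \<open>X\<close> generated by \<open>G\<close>.  Functions on \<open>X\<close> are made
  extensional, so that equality in the algebra is equality on \<open>X\<close>.
\<close>

inductive_set gen_funs :: "'p set \<Rightarrow> ('p \<Rightarrow> complex) set \<Rightarrow> ('p \<Rightarrow> complex) set"
  for X :: "'p set" and G :: "('p \<Rightarrow> complex) set" where
  const: "(\<lambda>x\<in>X. c) \<in> gen_funs X G"
| gen: "f \<in> G \<Longrightarrow> restrict f X \<in> gen_funs X G"
| add: "f \<in> gen_funs X G \<Longrightarrow> g \<in> gen_funs X G \<Longrightarrow> (\<lambda>x\<in>X. f x + g x) \<in> gen_funs X G"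
| mult: "f \<in> gen_funs X G \<Longrightarrow> g \<in> gen_funs X G \<Longrightarrow> (\<lambda>x\<in>X. f x * g x) \<in> gen_funs X G"

definition fun_alg :: "'p set \<Rightarrow> ('p \<Rightarrow> complex) set \<Rightarrow> (complex, 'p \<Rightarrow> complex) module" where
  "fun_alg X F =
    \<lparr>carrier = F,
     monoid.mult = (\<lambda>f g. \<lambda>x\<in>X. f x * g x),
     one = (\<lambda>x\<in>X. 1),
     zero = (\<lambda>x\<in>X. 0),
     add = (\<lambda>f g. \<lambda>x\<in>X. f x + g x),
     module.smult = (\<lambda>c f. \<lambda>x\<in>X. c * f x)\<rparr>"

definition pullback :: "'p set \<Rightarrow> ('p \<Rightarrow> 'p) \<Rightarrow> ('p \<Rightarrow> complex) \<Rightarrow> ('p \<Rightarrow> complex)" where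
  "pullback X \<phi> f = (\<lambda>x\<in>X. f (\<phi> x))"


section \<open>Matrices\<close>

text \<open>
  Matrix indices start at 0.  Column vectors are \<open>n \<times> 1\<close> matrices and row vectors are \<open>1 \<times> n\<close>
  matrices.
\<close>

definition GL :: "nat \<Rightarrow> complex mat set" where
  "GL n = {A \<in> carrier_mat n n. invertible_mat A}"

definition minv :: "complex mat \<Rightarrow> complex mat" where
  "minv A = the (mat_inverse A)"

definition Jmat :: "nat \<Rightarrow> complex mat" where
  "Jmat n = mat n n (\<lambda>(i, j). if i + j + 1 = n then 1 else 0)"

definition companion :: "nat \<Rightarrow> complex poly \<Rightarrow> complex mat" where
  "companion n p = mat n n (\<lambda>(i, j).
     if j + 1 = n then - coeff p i else if i = j + 1 then 1 else 0)"

definition Smat :: "nat \<Rightarrow> complex poly \<Rightarrow> complex mat" where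
  "Smat n p = mat n n (\<lambda>(i, j). coeff p (i + j + 1))"

definition poly_mat :: "complex poly \<Rightarrow> complex mat \<Rightarrow> complex mat" where
  "poly_mat p A = mat (dim_row A) (dim_row A)
     (\<lambda>(i, j). \<Sum>k\<le>degree p. coeff p k * (A ^\<^sub>m k) $$ (i, j))"

definition monic_polys :: "nat \<Rightarrow> complex poly set" where
  "monic_polys n = {p. degree p = n \<and> lead_coeff p = 1}"

definition companions :: "nat \<Rightarrow> complex mat set" where
  "companions n = companion n ` monic_polys n"

text \<open>The polynomial \<open>p\<close> of a companion matrix \<open>C\<^sub>p\<close>.\<close>

definition cpoly :: "nat \<Rightarrow> complex mat \<Rightarrow> complex poly" where
  "cpoly n C = (THE p. p \<in> monic_polys n \<and> companion n p = C)"

type_synonym mat4 = "complex mat \<times> complex mat \<times> complex mat \<times> complex mat"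


section \<open>The variety \<open>Wh\<close>, its rational involution and the algebra \<open>\<A>\<^sub>\<tau>\<close>\<close>

definition Wh :: "nat \<Rightarrow> mat4 set" where
  "Wh n = GL n \<times> GL n \<times> companions n \<times> companions n"

definition O_Wh :: "nat \<Rightarrow> (mat4 \<Rightarrow> complex) set" where
  "O_Wh n = gen_funs (Wh n)
     ((\<Union>i<n. \<Union>j<n. {\<lambda>(g, h, a, b). g $$ (i, j), \<lambda>(g, h, a, b). h $$ (i, j),
                      \<lambda>(g, h, a, b). a $$ (i, j), \<lambda>(g, h, a, b). b $$ (i, j)}) \<union>
      {\<lambda>(g, h, a, b). inverse (det g), \<lambda>(g, h, a, b). inverse (det h)})"

definition tau_rho :: "nat \<Rightarrow> mat4 \<Rightarrow> mat4" where
  "tau_rho n = (\<lambda>(g, h, a, b).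
     let p = cpoly n a; q = cpoly n b in
     (Jmat n * minv (transpose_mat g) * minv (poly_mat q (transpose_mat a)) * minv (Smat n p),
      (- 1) ^ n \<cdot>\<^sub>m (Jmat n * minv (transpose_mat h) * poly_mat p (transpose_mat b) * minv (Smat n q)),
      a, b))"

text \<open>
  The locus where the formula for \<open>\<tau>\<^sub>\<rho>\<close> makes sense and has values in \<open>Wh\<close>: a dense open subset of
  the irreducible variety \<open>Wh\<close>.  So \<open>\<tau>\<^sub>\<rho>\<^sup>*(f)\<close> is regular iff \<open>f \<circ> \<tau>\<^sub>\<rho>\<close> agrees on this locus with a
  (necessarily unique) regular function.
\<close>

definition tau_dom :: "nat \<Rightarrow> mat4 set" where
  "tau_dom n = {(g, h, a, b) \<in> Wh n.
     invertible_mat (poly_mat (cpoly n b) (transpose_mat a)) \<and>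
     invertible_mat (poly_mat (cpoly n a) (transpose_mat b))}"

definition is_tau_pullback :: "nat \<Rightarrow> (mat4 \<Rightarrow> complex) \<Rightarrow> (mat4 \<Rightarrow> complex) \<Rightarrow> bool" where
  "is_tau_pullback n f f' \<longleftrightarrow> f' \<in> O_Wh n \<and> (\<forall>x\<in>tau_dom n. f' x = f (tau_rho n x))"

definition tau_pullback :: "nat \<Rightarrow> (mat4 \<Rightarrow> complex) \<Rightarrow> (mat4 \<Rightarrow> complex)" where
  "tau_pullback n f = (THE f'. is_tau_pullback n f f')"

definition A_tau :: "nat \<Rightarrow> (complex, mat4 \<Rightarrow> complex) module" where
  "A_tau n = fun_alg (Wh n) {f \<in> O_Wh n. \<exists>f'. is_tau_pullback n f f'}"

definition Wh_act :: "complex mat \<times> complex mat \<Rightarrow> mat4 \<Rightarrow> mat4" where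
  "Wh_act = (\<lambda>(g, h) (g', h', a, b). (g * g', h * h', a, b))"


section \<open>The cotangent bundle of \<open>GL\<^sub>n \<times> \<complex>\<^sup>n\<close>\<close>

text \<open>
  The left-invariant trivialization of the cotangent bundle of \<open>GL\<^sub>n\<close> and the trace pairing identify
  the cotangent bundle with \<open>GL\<^sub>n \<times> \<gg>\<ll>\<^sub>n \<times> \<complex>\<^sup>n \<times> (\<complex>\<^sup>n)\<^sup>*\<close>; points are \<open>(a, y, v, u)\<close>.
\<close>

definition Cot :: "nat \<Rightarrow> mat4 set" where
  "Cot n = GL n \<times> carrier_mat n n \<times> carrier_mat n 1 \<times> carrier_mat 1 n"

definition O_Cot :: "nat \<Rightarrow> (complex, mat4 \<Rightarrow> complex) module" where
  "O_Cot n = fun_alg (Cot n) (gen_funs (Cot n)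
     ((\<Union>i<n. \<Union>j<n. {\<lambda>(a, y, v, u). a $$ (i, j), \<lambda>(a, y, v, u). y $$ (i, j)}) \<union>
      (\<Union>i<n. {\<lambda>(a, y, v, u). v $$ (i, 0), \<lambda>(a, y, v, u). u $$ (0, i)}) \<union>
      {\<lambda>(a, y, v, u). inverse (det a)}))"

definition Cot_act :: "nat \<Rightarrow> complex mat \<times> complex mat \<Rightarrow> mat4 \<Rightarrow> mat4" where
  "Cot_act n = (\<lambda>(g, h) (a, y, v, u).
     let J = Jmat n; gti = minv (transpose_mat g); hi = minv h in
     (J * gti * J * a * J * hi * J,
      J * h * J * y * J * hi * J,
      J * gti * J * v,
      u * J * transpose_mat g * J))"

definition Cot_inv :: "nat \<Rightarrow> mat4 \<Rightarrow> mat4" where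
  "Cot_inv n = (\<lambda>(a, y, v, u).
     let J = Jmat n in
     ((- 1) ^ (n - 1) \<cdot>\<^sub>m (J * minv (transpose_mat a) * J),
      J * transpose_mat y * J,
      - (J * transpose_mat u),
      - (transpose_mat v * J)))"

end

theory Submission
  imports Defs
begin

text \<open>
  The isomorphism comes from a morphism \<open>phi\<close> from \<open>Wh\<close> to the cotangent bundle.  With \<open>G = J g\<^sup>-\<^sup>T\<close> and \<open>e\<^sub>n\<close> the last basis
  vector, it sends \<open>(g, h, C\<^sub>p, C\<^sub>q)\<close> to
  \<open>a = G S\<^sub>q\<^sup>-\<^sup>1 h\<^sup>-\<^sup>1 J\<close>, \<open>y = J h C\<^sub>q h\<^sup>-\<^sup>1 J\<close>, \<open>v = G e\<^sub>n\<close>, \<open>u = (p - q)\<^sup>T G\<^sup>-\<^sup>1\<close>,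
  where \<open>p - q\<close> stands for its vector of coefficients.  It is visibly equivariant (\<open>phi_act\<close>), and it intertwines \<open>\<tau>\<^sub>\<rho>\<close> with the
  involution \<open>Cot_inv\<close> (\<open>phi_tau\<close>).  The latter rests on the identity \<open>q(C\<^sub>p) S\<^sub>p = - p(C\<^sub>q) S\<^sub>q\<close>, the antisymmetry of the
  Bezoutian (\<open>bezoutian_antisym\<close>).  Since \<open>Cot_inv\<close> is regular, pulling back along \<open>phi\<close> maps the coordinate ring of the cotangent
  bundle to \<open>\<A>\<^sub>\<tau>\<close>: if \<open>f = F \<circ> phi\<close> then \<open>\<tau>\<^sub>\<rho>\<^sup>* f = F \<circ> Cot_inv \<circ> phi\<close>.

  This pullback is bijective.  The map \<open>phi\<close> is an open immersion, whose image is the locus where \<open>v\<close> is a cyclic vector for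
  \<open>a y a\<^sup>-\<^sup>1\<close>, in other words where the determinant \<open>cyc\<close> of the matrix with columns \<open>(a y a\<^sup>-\<^sup>1)\<^sup>k v\<close> does not vanish: in the basis of
  these columns \<open>a y a\<^sup>-\<^sup>1\<close> is a companion matrix, and the preimage can be read off (\<open>phi_surj\<close>).  As the image is dense, the pullback
  is injective, and every regular function on \<open>Wh\<close> has the form \<open>F/cyc\<^sup>k\<close> (\<open>reg_Wh_is_fraction\<close>).

  If \<open>f = F/cyc\<^sup>k\<close> belongs to \<open>\<A>\<^sub>\<tau>\<close>, then \<open>\<tau>\<^sub>\<rho>\<^sup>* f\<close> is a fraction \<open>F'/cyc\<^sup>l\<close> too, which says that \<open>f\<close> is also regular where
  \<open>cyc \<circ> Cot_inv\<close> does not vanish.  The two loci together have a complement of codimension two, so \<open>f\<close> is regular everywhere.  The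
  algebraic form of this extension argument is that \<open>cyc\<close> and \<open>cyc \<circ> Cot_inv\<close> are coprime (\<open>cyc_Cot_inv_dvd\<close>).  It is proved without
  factorization of polynomials in several variables.  There is a family of lines on which \<open>cyc \<circ> Cot_inv\<close> is a monic
  polynomial in one variable \<open>t\<close>, so that one can divide by it with remainder, and on at least one of these lines \<open>cyc\<close> is a nonzero
  constant.  Deforming a given line to this special one shows that the remainder vanishes to infinite order in the
  deformation parameter (\<open>monic_dvd_family\<close>), hence is zero.

  It remains to pass from algebras to schemes: an isomorphism of algebras induces an isomorphism of spectra, and
  commuting squares of algebra maps give intertwining relations (\<open>aff_iso_Spec_mor\<close>, \<open>intertwines_Spec_mor\<close>).
\<close>

section \<open>Morphisms of affine schemes\<close>

lemma primeideal_vimage: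
  assumes "cring A" "h \<in> Ring.ring_hom A B" "primeideal Q B"
  shows "primeideal {a \<in> carrier A. h a \<in> Q} A"
proof -
  interpret A: cring A by fact
  interpret Q: primeideal Q B by fact
  interpret h: ring_hom_ring A B h
    by (rule ring_hom_ringI2) (use assms A.ring_axioms Q.ring_axioms in auto)
  have "ideal {a \<in> carrier A. h a \<in> Q} A"
    by (rule h.ideal_vimage) (rule Q.ideal_axioms)
  moreover have "carrier A \<noteq> {a \<in> carrier A. h a \<in> Q}"
  proof
    assume "carrier A = {a \<in> carrier A. h a \<in> Q}"
    hence "\<one>\<^bsub>B\<^esub> \<in> Q" using A.one_closed h.hom_one by force
    thus False using Q.one_imp_carrier Q.I_notcarr by auto
  qed
  moreover have "a \<in> {a \<in> carrier A. h a \<in> Q} \<or> b \<in> {a \<in> carrier A. h a \<in> Q}"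
    if "a \<in> carrier A" "b \<in> carrier A" "a \<otimes>\<^bsub>A\<^esub> b \<in> {a \<in> carrier A. h a \<in> Q}" for a b
    using that Q.I_prime[of "h a" "h b"] by auto
  ultimately show ?thesis
    unfolding primeideal_def primeideal_axioms_def using assms(1) by blast
qed

lemma loc_frac_self:
  assumes "cring A" "primeideal P A" "a \<in> carrier A" "s \<in> carrier A - P"
  shows "(a, s) \<in> loc_frac A P a s"
  using assms by (auto simp: loc_frac_def)

lemma loc_frac_related_sub:
  assumes "cring A" "primeideal P A"
    and "a \<in> carrier A" "s \<in> carrier A - P" "b \<in> carrier A" "t \<in> carrier A - P"
    and "u \<in> carrier A - P" "u \<otimes>\<^bsub>A\<^esub> (t \<otimes>\<^bsub>A\<^esub> a) = u \<otimes>\<^bsub>A\<^esub> (s \<otimes>\<^bsub>A\<^esub> b)"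
  shows "loc_frac A P b t \<subseteq> loc_frac A P a s"
proof
  interpret A: cring A by fact
  interpret P: primeideal P A by fact
  fix x assume "x \<in> loc_frac A P b t"
  then obtain c r w where x: "x = (c, r)" and c: "c \<in> carrier A" and r: "r \<in> carrier A - P"
    and w: "w \<in> carrier A - P" and e: "w \<otimes>\<^bsub>A\<^esub> (r \<otimes>\<^bsub>A\<^esub> b) = w \<otimes>\<^bsub>A\<^esub> (t \<otimes>\<^bsub>A\<^esub> c)"
    by (auto simp: loc_frac_def)
  have prime: "p \<otimes>\<^bsub>A\<^esub> q \<in> carrier A - P" if "p \<in> carrier A - P" "q \<in> carrier A - P" for p q
    using that P.I_prime[of p q] by auto
  note cl = assms(3-7) c r w
  let ?v = "u \<otimes>\<^bsub>A\<^esub> (w \<otimes>\<^bsub>A\<^esub> t)"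
  have "?v \<otimes>\<^bsub>A\<^esub> (r \<otimes>\<^bsub>A\<^esub> a) = (w \<otimes>\<^bsub>A\<^esub> r) \<otimes>\<^bsub>A\<^esub> (u \<otimes>\<^bsub>A\<^esub> (t \<otimes>\<^bsub>A\<^esub> a))"
    using cl by (simp add: A.m_ac)
  also have "\<dots> = (u \<otimes>\<^bsub>A\<^esub> s) \<otimes>\<^bsub>A\<^esub> (w \<otimes>\<^bsub>A\<^esub> (r \<otimes>\<^bsub>A\<^esub> b))"
    using cl unfolding assms(8) by (simp add: A.m_ac)
  also have "\<dots> = ?v \<otimes>\<^bsub>A\<^esub> (s \<otimes>\<^bsub>A\<^esub> c)"
    using cl unfolding e by (simp add: A.m_ac)
  finally show "x \<in> loc_frac A P a s"
    using prime cl x unfolding loc_frac_def by auto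
qed

lemma loc_frac_eqI:
  assumes "cring A" "primeideal P A"
    and "a \<in> carrier A" "s \<in> carrier A - P" "b \<in> carrier A" "t \<in> carrier A - P"
    and "u \<in> carrier A - P" "u \<otimes>\<^bsub>A\<^esub> (t \<otimes>\<^bsub>A\<^esub> a) = u \<otimes>\<^bsub>A\<^esub> (s \<otimes>\<^bsub>A\<^esub> b)"
  shows "loc_frac A P b t = loc_frac A P a s"
  using loc_frac_related_sub[OF assms(1,2,3,4,5,6,7,8)]
    loc_frac_related_sub[OF assms(1,2,5,6,3,4,7) assms(8)[symmetric]] by blast

lemma loc_frac_memD:
  assumes "cring A" "primeideal P A" "a \<in> carrier A" "s \<in> carrier A - P" "(b, t) \<in> loc_frac A P a s"
  shows "loc_frac A P b t = loc_frac A P a s"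
proof -
  from assms(5) obtain u where "b \<in> carrier A" "t \<in> carrier A - P" "u \<in> carrier A - P"
    "u \<otimes>\<^bsub>A\<^esub> (t \<otimes>\<^bsub>A\<^esub> a) = u \<otimes>\<^bsub>A\<^esub> (s \<otimes>\<^bsub>A\<^esub> b)" unfolding loc_frac_def by blast
  thus ?thesis by (rule loc_frac_eqI[OF assms(1-4)])
qed

text \<open>
  Equivalent fractions have equivalent images, so the union in the definition of \<open>Spec_mor\<close> is a union of equal
  classes.  This evaluates it at any representative.
\<close>

lemma loc_frac_map:
  assumes "cring A" "cring B" "h \<in> Ring.ring_hom A B" "primeideal Q B"
    and P: "P = {a \<in> carrier A. h a \<in> Q}" and a: "a \<in> carrier A" "s \<in> carrier A - P"
  shows "(\<Union>(b, t)\<in>loc_frac A P a s. loc_frac B Q (h b) (h t)) = loc_frac B Q (h a) (h s)"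
proof -
  interpret A: cring A by fact
  interpret B: cring B by fact
  have prime: "primeideal P A" unfolding P using primeideal_vimage assms(1,3,4) .
  have cl: "h b \<in> carrier B" if "b \<in> carrier A" for b using assms(3) that by (auto simp: Ring.ring_hom_def)
  have nin: "h b \<in> carrier B - Q" if "b \<in> carrier A - P" for b using cl that P by auto
  have "loc_frac B Q (h b) (h t) = loc_frac B Q (h a) (h s)"
    if "(b, t) \<in> loc_frac A P a s" for b t
  proof -
    from that obtain u where b: "b \<in> carrier A" "t \<in> carrier A - P" "u \<in> carrier A - P"
      and e: "u \<otimes>\<^bsub>A\<^esub> (t \<otimes>\<^bsub>A\<^esub> a) = u \<otimes>\<^bsub>A\<^esub> (s \<otimes>\<^bsub>A\<^esub> b)" by (auto simp: loc_frac_def)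
    have "h (u \<otimes>\<^bsub>A\<^esub> (t \<otimes>\<^bsub>A\<^esub> a)) = h (u \<otimes>\<^bsub>A\<^esub> (s \<otimes>\<^bsub>A\<^esub> b))" using e by simp
    hence "h u \<otimes>\<^bsub>B\<^esub> (h t \<otimes>\<^bsub>B\<^esub> h a) = h u \<otimes>\<^bsub>B\<^esub> (h s \<otimes>\<^bsub>B\<^esub> h b)"
      using a b assms(3) by (simp add: ring_hom_mult)
    from loc_frac_eqI[OF assms(2,4) cl[OF a(1)] nin[OF a(2)] cl[OF b(1)] nin[OF b(2)] nin[OF b(3)] this]
    show ?thesis .
  qed
  thus ?thesis using loc_frac_self[OF assms(1) prime a] by fast
qed

lemma on_pts_Spec_mor: "on_pts (Spec_mor A B h) Q = {a \<in> carrier A. h a \<in> Q}"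
  by (simp add: Spec_mor_def)

lemma on_pts_Spec_mor_Spec:
  "cring A \<Longrightarrow> h \<in> Ring.ring_hom A B \<Longrightarrow> Q \<in> Spec B \<Longrightarrow> on_pts (Spec_mor A B h) Q \<in> Spec A"
  using primeideal_vimage by (auto simp: on_pts_Spec_mor Spec_def)

lemma on_sect_Spec_mor:
  "on_sect (Spec_mor A B h) U s = (\<lambda>Q\<in>pts_vimage B (Spec_mor A B h) U.
     \<Union>(a, t)\<in>s (on_pts (Spec_mor A B h) Q). loc_frac B Q (h a) (h t))"
  by (simp add: Spec_mor_def pts_vimage_def)

lemma istopology_zariski:
  assumes "cring A"
  shows "istopology (\<lambda>U. \<exists>E\<subseteq>carrier A. U = {P \<in> Spec A. \<not> E \<subseteq> P})"
  unfolding istopology_def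
proof (intro conjI allI impI)
  interpret A: cring A by fact
  fix S T assume "\<exists>E\<subseteq>carrier A. S = {P \<in> Spec A. \<not> E \<subseteq> P}" "\<exists>E\<subseteq>carrier A. T = {P \<in> Spec A. \<not> E \<subseteq> P}"
  then obtain E F where E: "E \<subseteq> carrier A" "S = {P \<in> Spec A. \<not> E \<subseteq> P}"
    and F: "F \<subseteq> carrier A" "T = {P \<in> Spec A. \<not> F \<subseteq> P}" by blast
  let ?EF = "{e \<otimes>\<^bsub>A\<^esub> f | e f. e \<in> E \<and> f \<in> F}"
  have "(\<not> E \<subseteq> P \<and> \<not> F \<subseteq> P) \<longleftrightarrow> \<not> ?EF \<subseteq> P" if "P \<in> Spec A" for P
  proof -
    interpret P: primeideal P A using that by (simp add: Spec_def)
    have "e \<otimes>\<^bsub>A\<^esub> f \<in> P \<longleftrightarrow> e \<in> P \<or> f \<in> P" if "e \<in> E" "f \<in> F" for e f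
      using that E(1) F(1) P.I_prime[of e f] P.I_l_closed[of f e] P.I_r_closed[of e f] by blast
    thus ?thesis by blast
  qed
  hence "S \<inter> T = {P \<in> Spec A. \<not> ?EF \<subseteq> P}" unfolding E(2) F(2) by blast
  moreover have "?EF \<subseteq> carrier A" using E(1) F(1) by auto
  ultimately show "\<exists>E\<subseteq>carrier A. S \<inter> T = {P \<in> Spec A. \<not> E \<subseteq> P}" by blast
next
  fix \<K> assume "\<forall>K\<in>\<K>. \<exists>E\<subseteq>carrier A. K = {P \<in> Spec A. \<not> E \<subseteq> P}"
  then obtain E where E: "\<And>K. K \<in> \<K> \<Longrightarrow> E K \<subseteq> carrier A \<and> K = {P \<in> Spec A. \<not> E K \<subseteq> P}" by metis
  have "\<Union> \<K> = {P \<in> Spec A. \<not> \<Union> (E ` \<K>) \<subseteq> P}" using E by blast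
  thus "\<exists>E\<subseteq>carrier A. \<Union> \<K> = {P \<in> Spec A. \<not> E \<subseteq> P}" using E by (intro exI[of _ "\<Union> (E ` \<K>)"]) blast
qed

lemma openin_zariski:
  "cring A \<Longrightarrow> openin (zariski A) U \<longleftrightarrow> (\<exists>E\<subseteq>carrier A. U = {P \<in> Spec A. \<not> E \<subseteq> P})"
  unfolding zariski_def using istopology_zariski by (subst topology_inverse') auto

lemma topspace_zariski:
  assumes "cring A" shows "topspace (zariski A) = Spec A"
proof
  interpret A: cring A by fact
  show "topspace (zariski A) \<subseteq> Spec A" using openin_zariski[OF assms] by (force simp: topspace_def)
  have "P \<noteq> carrier A \<and> P \<subseteq> carrier A" if "P \<in> Spec A" for P
  proof -
    interpret P: primeideal P A using that by (simp add: Spec_def)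
    show ?thesis using P.I_notcarr P.Icarr by blast
  qed
  hence "Spec A = {P \<in> Spec A. \<not> carrier A \<subseteq> P}" by blast
  hence "openin (zariski A) (Spec A)" unfolding openin_zariski[OF assms] by blast
  thus "Spec A \<subseteq> topspace (zariski A)" by (rule openin_subset)
qed

lemma openin_pts_vimage:
  assumes "cring A" "cring B" "h \<in> Ring.ring_hom A B" "openin (zariski A) U"
  shows "openin (zariski B) (pts_vimage B (Spec_mor A B h) U)"
proof -
  obtain E where E: "E \<subseteq> carrier A" "U = {P \<in> Spec A. \<not> E \<subseteq> P}"
    using assms(4) openin_zariski[OF assms(1)] by blast
  have "pts_vimage B (Spec_mor A B h) U = {Q \<in> Spec B. \<not> h ` E \<subseteq> Q}"
  proof (rule Collect_cong[of "\<lambda>Q. Q \<in> Spec B \<and> on_pts (Spec_mor A B h) Q \<in> U", folded pts_vimage_def])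
    fix Q
    show "(Q \<in> Spec B \<and> on_pts (Spec_mor A B h) Q \<in> U) = (Q \<in> Spec B \<and> \<not> h ` E \<subseteq> Q)"
      using E(1) on_pts_Spec_mor_Spec[OF assms(1,3), of Q] unfolding E(2) on_pts_Spec_mor by blast
  qed
  moreover have "h ` E \<subseteq> carrier B" using E(1) assms(3) by (auto simp: Ring.ring_hom_def)
  ultimately show ?thesis unfolding openin_zariski[OF assms(2)] by (intro exI[of _ "h ` E"] conjI)
qed

lemma continuous_Spec_mor:
  assumes "cring A" "cring B" "h \<in> Ring.ring_hom A B"
  shows "continuous_map (zariski B) (zariski A) (on_pts (Spec_mor A B h))"
  unfolding continuous_map_def topspace_zariski[OF assms(1)] topspace_zariski[OF assms(2)]
  using openin_pts_vimage[OF assms] on_pts_Spec_mor_Spec[OF assms(1,3)]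
  by (auto simp: pts_vimage_def)

lemma sect_pointE:
  assumes "s \<in> carrier (str_sheaf A U)" "P \<in> U"
  obtains a t where "a \<in> carrier A" "t \<in> carrier A - P" "s P = loc_frac A P a t"
proof -
  have "s P \<in> carrier (localization A P)" using assms by (auto simp: str_sheaf_def)
  thus ?thesis using that unfolding localization_def by auto
qed

lemma on_pts_comp:
  assumes "h \<in> Ring.ring_hom A B"
  shows "on_pts (Spec_mor A B h) (on_pts (Spec_mor B C k) R) = on_pts (Spec_mor A C (k \<circ> h)) R"
  using assms by (auto simp: on_pts_Spec_mor Ring.ring_hom_def)

lemma pts_vimage_comp:
  assumes "cring B" "h \<in> Ring.ring_hom A B" "k \<in> Ring.ring_hom B C"
  shows "pts_vimage C (Spec_mor B C k) (pts_vimage B (Spec_mor A B h) U) =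
    pts_vimage C (Spec_mor A C (k \<circ> h)) U"
  using on_pts_Spec_mor_Spec[OF assms(1,3)]
  unfolding pts_vimage_def on_pts_comp[OF assms(2), symmetric] by blast

lemma on_sect_apply:
  assumes "cring A" "cring B" "h \<in> Ring.ring_hom A B" "s \<in> carrier (str_sheaf A U)"
    and "Q \<in> pts_vimage B (Spec_mor A B h) U" "P = on_pts (Spec_mor A B h) Q"
    and "a \<in> carrier A" "t \<in> carrier A - P" "s P = loc_frac A P a t"
  shows "on_sect (Spec_mor A B h) U s Q = loc_frac B Q (h a) (h t)"
proof -
  have "primeideal Q B" using assms(5) by (simp add: pts_vimage_def Spec_def)
  note map = loc_frac_map[OF assms(1-3) this assms(6)[unfolded on_pts_Spec_mor] assms(7,8)]
  have "on_sect (Spec_mor A B h) U s Q = (\<Union>(a, t)\<in>s P. loc_frac B Q (h a) (h t))"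
    unfolding on_sect_Spec_mor assms(6) by (rule restrict_apply') (rule assms(5))
  thus ?thesis unfolding assms(9) map .
qed

lemma on_sect_closed:
  assumes "cring A" "cring B" "h \<in> Ring.ring_hom A B" "s \<in> carrier (str_sheaf A U)"
  shows "on_sect (Spec_mor A B h) U s \<in> carrier (str_sheaf B (pts_vimage B (Spec_mor A B h) U))"
proof -
  let ?V = "pts_vimage B (Spec_mor A B h) U" and ?f = "on_pts (Spec_mor A B h)"
  let ?t = "on_sect (Spec_mor A B h) U s"
  have cl: "h b \<in> carrier B" if "b \<in> carrier A" for b using assms(3) that by (auto simp: Ring.ring_hom_def)
  have "?t Q \<in> carrier (localization B Q)" if Q: "Q \<in> ?V" for Q
  proof -
    have "?f Q \<in> U" using Q by (simp add: pts_vimage_def)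
    then obtain a t where a: "a \<in> carrier A" "t \<in> carrier A - ?f Q" "s (?f Q) = loc_frac A (?f Q) a t"
      by (rule sect_pointE[OF assms(4)])
    have e: "?t Q = loc_frac B Q (h a) (h t)" by (rule on_sect_apply[OF assms Q refl a])
    have "h t \<in> carrier B - Q" using a(2) cl[of t] by (simp add: on_pts_Spec_mor)
    thus ?thesis using cl[OF a(1)] unfolding e localization_def by auto
  qed
  moreover have "?t \<in> extensional ?V" by (simp add: on_sect_Spec_mor)
  moreover have "\<exists>W. openin (zariski B) W \<and> Q \<in> W \<and> W \<subseteq> ?V \<and>
      (\<exists>a\<in>carrier B. \<exists>f\<in>carrier B. \<forall>R\<in>W. f \<notin> R \<and> ?t R = loc_frac B R a f)" if Q: "Q \<in> ?V" for Q
  proof -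
    have "?f Q \<in> U" using Q by (simp add: pts_vimage_def)
    moreover have "\<forall>P\<in>U. \<exists>V. openin (zariski A) V \<and> P \<in> V \<and> V \<subseteq> U \<and>
        (\<exists>a\<in>carrier A. \<exists>f\<in>carrier A. \<forall>Q\<in>V. f \<notin> Q \<and> s Q = loc_frac A Q a f)"
      using assms(4) unfolding str_sheaf_def by simp
    ultimately obtain V a g where V: "openin (zariski A) V" "?f Q \<in> V" "V \<subseteq> U" "a \<in> carrier A" "g \<in> carrier A"
      and g: "\<And>P. P \<in> V \<Longrightarrow> g \<notin> P \<and> s P = loc_frac A P a g"
      by meson
    let ?W = "pts_vimage B (Spec_mor A B h) V"
    have "h g \<notin> R \<and> ?t R = loc_frac B R (h a) (h g)" if R: "R \<in> ?W" for R
    proof -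
      have "?f R \<in> V" using R by (simp add: pts_vimage_def)
      moreover have "R \<in> ?V" using R V(3) by (auto simp: pts_vimage_def)
      ultimately show ?thesis using on_sect_apply[OF assms _ refl, of R a g] g[of "?f R"] V(4,5)
        by (auto simp: on_pts_Spec_mor)
    qed
    moreover have "openin (zariski B) ?W" by (rule openin_pts_vimage[OF assms(1-3) V(1)])
    moreover have "Q \<in> ?W" "?W \<subseteq> ?V" using Q V(2,3) by (auto simp: pts_vimage_def)
    ultimately show ?thesis using cl[OF V(4)] cl[OF V(5)]
      by (intro exI[of _ ?W] conjI bexI[of _ "h a"] bexI[of _ "h g"] ballI) auto
  qed
  ultimately show ?thesis by (simp add: str_sheaf_def PiE_def)
qed

text \<open>
  Functoriality on sections: both sides evaluate at a point to the image of the same fraction.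
\<close>

lemma on_sect_comp:
  assumes "cring A" "cring B" "cring C" "h \<in> Ring.ring_hom A B" "k \<in> Ring.ring_hom B C"
    and s: "s \<in> carrier (str_sheaf A U)"
  shows "on_sect (Spec_mor B C k) (pts_vimage B (Spec_mor A B h) U) (on_sect (Spec_mor A B h) U s) =
    on_sect (Spec_mor A C (k \<circ> h)) U s"
proof
  fix R
  have kh: "k \<circ> h \<in> Ring.ring_hom A C" by (rule ring_hom_trans[OF assms(4,5)])
  let ?V = "pts_vimage B (Spec_mor A B h) U"
  let ?t = "on_sect (Spec_mor A B h) U s"
  note V = pts_vimage_comp[OF assms(2,4,5), of U]
  show "on_sect (Spec_mor B C k) ?V ?t R = on_sect (Spec_mor A C (k \<circ> h)) U s R"
  proof (cases "R \<in> pts_vimage C (Spec_mor A C (k \<circ> h)) U")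
    case True
    let ?Q = "on_pts (Spec_mor B C k) R"
    let ?P = "on_pts (Spec_mor A C (k \<circ> h)) R"
    have Q: "?Q \<in> ?V" using True V by (auto simp: pts_vimage_def)
    have P: "?P = on_pts (Spec_mor A B h) ?Q" using assms(4) by (auto simp: on_pts_Spec_mor Ring.ring_hom_def)
    have "?P \<in> U" using True by (simp add: pts_vimage_def)
    then obtain a t where a: "a \<in> carrier A" "t \<in> carrier A - ?P" "s ?P = loc_frac A ?P a t"
      by (rule sect_pointE[OF s])
    have "?t ?Q = loc_frac B ?Q (h a) (h t)"
      using on_sect_apply[OF assms(1,2,4) s Q P a] .
    moreover have "h a \<in> carrier B" "h t \<in> carrier B - ?Q" using a(1,2) assms(4) P
      by (auto simp: Ring.ring_hom_def on_pts_Spec_mor)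
    ultimately have "on_sect (Spec_mor B C k) ?V ?t R = loc_frac C R (k (h a)) (k (h t))"
      using on_sect_apply[OF assms(2,3,5) on_sect_closed[OF assms(1,2,4) s] _ refl] True V by auto
    also have "\<dots> = on_sect (Spec_mor A C (k \<circ> h)) U s R"
      using on_sect_apply[OF assms(1,3) kh s True refl a] by simp
    finally show ?thesis .
  next
    case False
    thus ?thesis unfolding on_sect_Spec_mor V by simp
  qed
qed

lemma on_sect_cong:
  assumes "\<And>a. a \<in> carrier A \<Longrightarrow> h a = k a" and "s \<in> carrier (str_sheaf A U)"
  shows "on_sect (Spec_mor A B h) U s = on_sect (Spec_mor A B k) U s"
proof -
  have pts: "on_pts (Spec_mor A B h) = on_pts (Spec_mor A B k)"
    using assms(1) by (auto simp: on_pts_Spec_mor fun_eq_iff)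
  hence V: "pts_vimage B (Spec_mor A B h) U = pts_vimage B (Spec_mor A B k) U"
    by (simp add: pts_vimage_def)
  show ?thesis unfolding on_sect_Spec_mor V pts
  proof (rule restrict_ext)
    fix Q assume "Q \<in> pts_vimage B (Spec_mor A B k) U"
    hence "on_pts (Spec_mor A B k) Q \<in> U" (is "?P \<in> U") by (simp add: pts_vimage_def)
    then obtain b r where "s ?P = loc_frac A ?P b r" by (rule sect_pointE[OF assms(2)])
    hence "\<forall>x\<in>s ?P. fst x \<in> carrier A \<and> snd x \<in> carrier A" by (auto simp: loc_frac_def)
    thus "(\<Union>(a, t)\<in>s ?P. loc_frac B Q (h a) (h t)) = (\<Union>(a, t)\<in>s ?P. loc_frac B Q (k a) (k t))"
      by (intro SUP_cong refl) (simp add: assms(1) split_beta)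
  qed
qed

text \<open>
  Both composites are induced by the same map of algebras.
\<close>

lemma intertwines_Spec_mor:
  assumes "cring A" "cring B" "h \<in> Ring.ring_hom A B" "\<alpha> \<in> Ring.ring_hom B B" "\<beta> \<in> Ring.ring_hom A A"
    and eq: "\<And>a. a \<in> carrier A \<Longrightarrow> \<alpha> (h a) = h (\<beta> a)"
  shows "intertwines B A (Spec_mor A B h) (Spec_mor B B \<alpha>) (Spec_mor A A \<beta>)"
  unfolding intertwines_def
proof (intro conjI ballI allI impI)
  fix Q
  show "on_pts (Spec_mor A B h) (on_pts (Spec_mor B B \<alpha>) Q) =
      on_pts (Spec_mor A A \<beta>) (on_pts (Spec_mor A B h) Q)"
    using eq assms(3,5) by (auto simp: on_pts_Spec_mor Ring.ring_hom_def)
next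
  fix U s assume s: "s \<in> carrier (str_sheaf A U)"
  show "on_sect (Spec_mor B B \<alpha>) (pts_vimage B (Spec_mor A B h) U) (on_sect (Spec_mor A B h) U s) =
      on_sect (Spec_mor A B h) (pts_vimage A (Spec_mor A A \<beta>) U) (on_sect (Spec_mor A A \<beta>) U s)"
    unfolding on_sect_comp[OF assms(1,2,2,3,4) s] on_sect_comp[OF assms(1,1,2,5,3) s]
    by (rule on_sect_cong[OF _ s]) (simp add: eq)
qed

text \<open>
  The operations on a local ring are unions over representatives of unions of classes.  Once an isomorphism of algebras
  is known to carry the class of \<open>a/s\<close> onto the class of \<open>h a/h s\<close>, it therefore commutes with them because images commute with
  unions.
\<close>

lemma loc_frac_transport:
  assumes "cring A" "cring B" "h \<in> ring_iso A B" "P = {a \<in> carrier A. h a \<in> Q}"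
    and "a \<in> carrier A" "s \<in> carrier A"
  shows "map_prod h h ` loc_frac A P a s = loc_frac B Q (h a) (h s)"
proof -
  interpret A: cring A by fact
  interpret B: cring B by fact
  have hom: "h \<in> Ring.ring_hom A B" and bij: "bij_betw h (carrier A) (carrier B)"
    using assms(3) by (auto simp: ring_iso_def)
  have cl: "h b \<in> carrier B" if "b \<in> carrier A" for b using hom that by (rule ring_hom_closed)
  have eq: "h u \<otimes>\<^bsub>B\<^esub> (h t \<otimes>\<^bsub>B\<^esub> h a) = h u \<otimes>\<^bsub>B\<^esub> (h s \<otimes>\<^bsub>B\<^esub> h b) \<longleftrightarrow>
      u \<otimes>\<^bsub>A\<^esub> (t \<otimes>\<^bsub>A\<^esub> a) = u \<otimes>\<^bsub>A\<^esub> (s \<otimes>\<^bsub>A\<^esub> b)" if "u \<in> carrier A" "t \<in> carrier A" "b \<in> carrier A" for u t b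
  proof -
    have "h u \<otimes>\<^bsub>B\<^esub> (h t \<otimes>\<^bsub>B\<^esub> h a) = h (u \<otimes>\<^bsub>A\<^esub> (t \<otimes>\<^bsub>A\<^esub> a))"
      "h u \<otimes>\<^bsub>B\<^esub> (h s \<otimes>\<^bsub>B\<^esub> h b) = h (u \<otimes>\<^bsub>A\<^esub> (s \<otimes>\<^bsub>A\<^esub> b))"
      using that assms(5,6) by (simp_all add: ring_hom_mult[OF hom])
    moreover have "inj_on h (carrier A)" using bij by (simp add: bij_betw_def)
    ultimately show ?thesis using that assms(5,6) by (simp add: inj_on_eq_iff[of h "carrier A"])
  qed
  have im: "carrier B - Q = h ` (carrier A - P)"
  proof -
    have "carrier B = h ` carrier A" using bij by (simp add: bij_betw_def)
    thus ?thesis unfolding assms(4) by auto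
  qed
  show ?thesis
  proof (intro equalityI subsetI)
    fix x assume "x \<in> map_prod h h ` loc_frac A P a s"
    then obtain b t u where x: "x = (h b, h t)" and b: "b \<in> carrier A" "t \<in> carrier A - P" "u \<in> carrier A - P"
      "u \<otimes>\<^bsub>A\<^esub> (t \<otimes>\<^bsub>A\<^esub> a) = u \<otimes>\<^bsub>A\<^esub> (s \<otimes>\<^bsub>A\<^esub> b)" unfolding loc_frac_def by force
    have "h u \<in> carrier B - Q" "h t \<in> carrier B - Q" using b(2,3) unfolding im by blast+
    moreover have "h u \<otimes>\<^bsub>B\<^esub> (h t \<otimes>\<^bsub>B\<^esub> h a) = h u \<otimes>\<^bsub>B\<^esub> (h s \<otimes>\<^bsub>B\<^esub> h b)"
      using eq[of u t b] b by simp
    ultimately show "x \<in> loc_frac B Q (h a) (h s)" unfolding x loc_frac_def using cl[OF b(1)] by blast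
  next
    fix x assume "x \<in> loc_frac B Q (h a) (h s)"
    then obtain b' t' u' where x: "x = (b', t')" and b': "b' \<in> carrier B" "t' \<in> carrier B - Q" "u' \<in> carrier B - Q"
      and e: "u' \<otimes>\<^bsub>B\<^esub> (t' \<otimes>\<^bsub>B\<^esub> h a) = u' \<otimes>\<^bsub>B\<^esub> (h s \<otimes>\<^bsub>B\<^esub> b')" unfolding loc_frac_def by force
    obtain b where b: "b \<in> carrier A" "b' = h b" using b'(1) bij by (auto simp: bij_betw_def)
    obtain t u where t: "t \<in> carrier A - P" "t' = h t" and u: "u \<in> carrier A - P" "u' = h u"
      using b'(2,3) unfolding im by blast
    have "u \<otimes>\<^bsub>A\<^esub> (t \<otimes>\<^bsub>A\<^esub> a) = u \<otimes>\<^bsub>A\<^esub> (s \<otimes>\<^bsub>A\<^esub> b)"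
      using eq[of u t b] e b t u by simp
    hence "(b, t) \<in> loc_frac A P a s" unfolding loc_frac_def using b t u by blast
    thus "x \<in> map_prod h h ` loc_frac A P a s" unfolding x b(2) t(2) by force
  qed
qed

lemma localization_sub:
  "x \<in> carrier (localization A P) \<Longrightarrow> x \<subseteq> carrier A \<times> carrier A"
  by (auto simp: localization_def loc_frac_def)

lemma localization_transport:
  assumes "cring A" "cring B" "h \<in> alg_iso A B" "P = {a \<in> carrier A. h a \<in> Q}"
    and smult: "\<forall>c. \<forall>a\<in>carrier A. c \<odot>\<^bsub>A\<^esub> a \<in> carrier A"
    and x: "x \<in> carrier (localization A P)" and y: "y \<in> carrier (localization A P)"
  defines "T \<equiv> \<lambda>x. map_prod h h ` x"
  shows "T (x \<otimes>\<^bsub>localization A P\<^esub> y) = T x \<otimes>\<^bsub>localization B Q\<^esub> T y"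
    and "T (x \<oplus>\<^bsub>localization A P\<^esub> y) = T x \<oplus>\<^bsub>localization B Q\<^esub> T y"
    and "T (c \<odot>\<^bsub>localization A P\<^esub> x) = c \<odot>\<^bsub>localization B Q\<^esub> T x"
    and "T \<one>\<^bsub>localization A P\<^esub> = \<one>\<^bsub>localization B Q\<^esub>"
proof -
  interpret A: cring A by fact
  interpret B: cring B by fact
  have iso: "h \<in> ring_iso A B" and hom: "h \<in> Ring.ring_hom A B"
    and sm: "\<And>c a. a \<in> carrier A \<Longrightarrow> h (c \<odot>\<^bsub>A\<^esub> a) = c \<odot>\<^bsub>B\<^esub> h a"
    using assms(3) by (auto simp: alg_iso_def ring_iso_def)
  note tr = loc_frac_transport[OF assms(1,2) iso assms(4), folded T_def]
  have xs: "fst p \<in> carrier A \<and> snd p \<in> carrier A" if "p \<in> x" for p using that localization_sub[OF x] by auto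
  have ys: "fst p \<in> carrier A \<and> snd p \<in> carrier A" if "p \<in> y" for p using that localization_sub[OF y] by auto
  have UN: "T (\<Union>p\<in>z. f p) = (\<Union>p\<in>z. T (f p))" for z and f :: "'a \<times> 'a \<Rightarrow> ('a \<times> 'a) set"
    unfolding T_def by (rule image_UN)
  have UN2: "(\<Union>q\<in>T z. g q) = (\<Union>p\<in>z. g (h (fst p), h (snd p)))" for z and g :: "'b \<times> 'b \<Rightarrow> ('b \<times> 'b) set"
    unfolding T_def by (auto simp: map_prod_def split_beta)
  show "T (x \<otimes>\<^bsub>localization A P\<^esub> y) = T x \<otimes>\<^bsub>localization B Q\<^esub> T y"
    unfolding localization_def monoid.simps UN UN2 split_beta fst_conv snd_conv
    using xs ys by (intro SUP_cong refl) (simp add: tr ring_hom_mult[OF hom])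
  show "T (x \<oplus>\<^bsub>localization A P\<^esub> y) = T x \<oplus>\<^bsub>localization B Q\<^esub> T y"
    unfolding localization_def ring_record_simps UN UN2 split_beta fst_conv snd_conv
    using xs ys by (intro SUP_cong refl) (simp add: tr ring_hom_mult[OF hom] ring_hom_add[OF hom])
  show "T (c \<odot>\<^bsub>localization A P\<^esub> x) = c \<odot>\<^bsub>localization B Q\<^esub> T x"
    unfolding localization_def module.simps UN UN2 split_beta fst_conv snd_conv
    using xs by (intro SUP_cong refl) (simp add: tr sm smult)
  show "T \<one>\<^bsub>localization A P\<^esub> = \<one>\<^bsub>localization B Q\<^esub>"
    unfolding localization_def monoid.simps by (simp add: tr ring_hom_one[OF hom])
qed

text \<open>The results of the operations on fractions are unions of classes of fractions.  This is all
  that is needed to apply the induced map to them.\<close>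

definition saturated :: "(complex, 'a) module \<Rightarrow> 'a set \<Rightarrow> ('a \<times> 'a) set \<Rightarrow> bool" where
  "saturated A P x \<longleftrightarrow> x \<subseteq> carrier A \<times> carrier A \<and> (\<Union>(a, t)\<in>x. loc_frac A P a t) = x"

lemma saturated_loc_frac:
  assumes "cring A" "primeideal P A" "a \<in> carrier A" "s \<in> carrier A - P"
  shows "saturated A P (loc_frac A P a s)"
proof -
  have "(\<Union>p\<in>loc_frac A P a s. loc_frac A P (fst p) (snd p)) = (\<Union>p\<in>loc_frac A P a s. loc_frac A P a s)"
    using loc_frac_memD[OF assms] by (intro SUP_cong refl) auto
  also have "\<dots> = loc_frac A P a s" using loc_frac_self[OF assms] by blast
  finally show ?thesis by (auto simp: saturated_def split_beta loc_frac_def)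
qed

lemma saturated_UN:
  assumes "\<And>i. i \<in> I \<Longrightarrow> saturated A P (f i)" shows "saturated A P (\<Union>i\<in>I. f i)"
proof -
  have "(\<Union>p\<in>(\<Union>i\<in>I. f i). loc_frac A P (fst p) (snd p)) = (\<Union>i\<in>I. \<Union>p\<in>f i. loc_frac A P (fst p) (snd p))"
    by blast
  also have "\<dots> = (\<Union>i\<in>I. f i)" using assms by (intro SUP_cong refl) (simp add: saturated_def split_beta)
  finally show ?thesis using assms by (auto simp: saturated_def split_beta)
qed

lemma saturated_localization:
  assumes "cring A" "primeideal P A" "x \<in> carrier (localization A P)"
  shows "saturated A P x"
  using assms(3) saturated_loc_frac[OF assms(1,2)] unfolding localization_def by auto

lemma saturated_ops:
  assumes "cring A" "primeideal P A"
    and smult: "\<forall>c. \<forall>a\<in>carrier A. c \<odot>\<^bsub>A\<^esub> a \<in> carrier A"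
    and x: "x \<in> carrier (localization A P)" and y: "y \<in> carrier (localization A P)"
  shows "saturated A P (x \<otimes>\<^bsub>localization A P\<^esub> y)" "saturated A P (x \<oplus>\<^bsub>localization A P\<^esub> y)"
    "saturated A P (c \<odot>\<^bsub>localization A P\<^esub> x)" "saturated A P \<one>\<^bsub>localization A P\<^esub>"
proof -
  interpret A: cring A by fact
  interpret P: primeideal P A by fact
  have xs: "fst p \<in> carrier A \<and> snd p \<in> carrier A - P" if "p \<in> x" for p
    using x that by (auto simp: localization_def loc_frac_def)
  have ys: "fst p \<in> carrier A \<and> snd p \<in> carrier A - P" if "p \<in> y" for p
    using y that by (auto simp: localization_def loc_frac_def)
  have prime: "p \<otimes>\<^bsub>A\<^esub> q \<in> carrier A - P" if "p \<in> carrier A - P" "q \<in> carrier A - P" for p q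
    using that P.I_prime[of p q] by auto
  note sat = saturated_loc_frac[OF assms(1,2)]
  show "saturated A P (x \<otimes>\<^bsub>localization A P\<^esub> y)"
    unfolding localization_def monoid.simps split_beta
    using xs ys prime by (intro saturated_UN sat A.m_closed) auto
  show "saturated A P (x \<oplus>\<^bsub>localization A P\<^esub> y)"
    unfolding localization_def ring_record_simps split_beta
    using xs ys prime by (intro saturated_UN sat A.m_closed A.a_closed) auto
  show "saturated A P (c \<odot>\<^bsub>localization A P\<^esub> x)"
    unfolding localization_def module.simps split_beta
    using xs smult by (intro saturated_UN sat) auto
  have "\<one>\<^bsub>A\<^esub> \<notin> P" using P.one_imp_carrier P.I_notcarr by auto
  thus "saturated A P \<one>\<^bsub>localization A P\<^esub>"
    unfolding localization_def monoid.simps by (intro sat) auto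
qed

lemma on_sect_iso_apply:
  assumes "cring A" "cring B" "h \<in> alg_iso A B"
    and Q: "Q \<in> pts_vimage B (Spec_mor A B h) U"
    and sat: "saturated A (on_pts (Spec_mor A B h) Q) (s (on_pts (Spec_mor A B h) Q))"
  shows "on_sect (Spec_mor A B h) U s Q = map_prod h h ` s (on_pts (Spec_mor A B h) Q)"
proof -
  have iso: "h \<in> ring_iso A B" using assms(3) by (auto simp: alg_iso_def)
  let ?P = "on_pts (Spec_mor A B h) Q"
  have "map_prod h h ` s ?P = map_prod h h ` (\<Union>p\<in>s ?P. loc_frac A ?P (fst p) (snd p))"
    using sat by (simp add: saturated_def split_beta)
  also have "\<dots> = (\<Union>p\<in>s ?P. map_prod h h ` loc_frac A ?P (fst p) (snd p))" by (rule image_UN)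
  also have "\<dots> = (\<Union>p\<in>s ?P. loc_frac B Q (h (fst p)) (h (snd p)))"
    using sat by (intro SUP_cong refl loc_frac_transport[OF assms(1,2) iso on_pts_Spec_mor])
      (auto simp: saturated_def)
  also have "\<dots> = on_sect (Spec_mor A B h) U s Q"
    unfolding on_sect_Spec_mor split_beta using Q by simp
  finally show ?thesis by simp
qed

lemma alg_iso_inv:
  assumes "cring A" "cring B" "h \<in> alg_iso A B"
    and smult: "\<forall>c. \<forall>a\<in>carrier A. c \<odot>\<^bsub>A\<^esub> a \<in> carrier A"
  shows "inv_into (carrier A) h \<in> alg_iso B A"
proof -
  interpret A: cring A by fact
  interpret B: cring B by fact
  let ?k = "inv_into (carrier A) h"
  have iso: "h \<in> ring_iso A B" and bij: "bij_betw h (carrier A) (carrier B)"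
    and sm: "\<And>c a. a \<in> carrier A \<Longrightarrow> h (c \<odot>\<^bsub>A\<^esub> a) = c \<odot>\<^bsub>B\<^esub> h a"
    using assms(3) by (auto simp: alg_iso_def ring_iso_def)
  have "?k \<in> ring_iso B A" using A.ring_axioms iso by (rule ring_iso_set_sym)
  moreover have "?k (c \<odot>\<^bsub>B\<^esub> x) = c \<odot>\<^bsub>A\<^esub> ?k x" if x: "x \<in> carrier B" for c x
  proof -
    have k: "?k x \<in> carrier A" "h (?k x) = x"
      using bij x by (auto simp: bij_betw_def inv_into_into f_inv_into_f)
    have "?k (c \<odot>\<^bsub>B\<^esub> x) = ?k (h (c \<odot>\<^bsub>A\<^esub> ?k x))" using sm[OF k(1)] k(2) by simp
    thus ?thesis using bij smult k(1) by (simp add: bij_betw_def inv_into_f_f)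
  qed
  ultimately show ?thesis by (simp add: alg_iso_def)
qed

lemma on_sect_id:
  assumes "cring A" "\<And>a. a \<in> carrier A \<Longrightarrow> h a = a" "s \<in> carrier (str_sheaf A U)" "U \<subseteq> Spec A"
  shows "on_sect (Spec_mor A A h) U s = s"
proof -
  have hom: "(\<lambda>a. a) \<in> Ring.ring_hom A A" by (simp add: Ring.ring_hom_def)
  have pts: "on_pts (Spec_mor A A (\<lambda>a. a)) Q = Q" if "Q \<in> Spec A" for Q
  proof -
    interpret primeideal Q A using that by (simp add: Spec_def)
    show ?thesis using Icarr by (auto simp: on_pts_Spec_mor)
  qed
  have V: "pts_vimage A (Spec_mor A A (\<lambda>a. a)) U = U"
    using pts assms(4) by (auto simp: pts_vimage_def)
  have "on_sect (Spec_mor A A (\<lambda>a. a)) U s = s"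
  proof
    fix Q
    show "on_sect (Spec_mor A A (\<lambda>a. a)) U s Q = s Q"
    proof (cases "Q \<in> U")
      case True
      then obtain a t where a: "a \<in> carrier A" "t \<in> carrier A - Q" "s Q = loc_frac A Q a t"
        by (rule sect_pointE[OF assms(3)])
      have "Q = on_pts (Spec_mor A A (\<lambda>a. a)) Q" using pts True assms(4) by auto
      from on_sect_apply[OF assms(1,1) hom assms(3) _ this a] show ?thesis using True V a(3) by simp
    next
      case False
      have "s \<in> extensional U" using assms(3) by (simp add: str_sheaf_def PiE_def)
      thus ?thesis using False unfolding on_sect_Spec_mor V by (simp add: extensional_def)
    qed
  qed
  thus ?thesis using on_sect_cong[OF assms(2,3)] by simp
qed

lemma on_sect_inverse:
  assumes "cring A" "cring B" "h \<in> Ring.ring_hom A B" "k \<in> Ring.ring_hom B A"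
    and "\<And>a. a \<in> carrier A \<Longrightarrow> k (h a) = a" "s \<in> carrier (str_sheaf A U)" "U \<subseteq> Spec A"
  shows "on_sect (Spec_mor B A k) (pts_vimage B (Spec_mor A B h) U) (on_sect (Spec_mor A B h) U s) = s"
  unfolding on_sect_comp[OF assms(1,2,1,3,4,6)]
  by (rule on_sect_id[OF assms(1) _ assms(6,7)]) (simp add: assms(5))

text \<open>
  The inverse of the algebra isomorphism induces inverse maps both on points and on sections, by functoriality.
\<close>

lemma aff_iso_Spec_mor:
  assumes "cring A" "cring B" "h \<in> alg_iso A B"
    and smult: "\<forall>c. \<forall>a\<in>carrier A. c \<odot>\<^bsub>A\<^esub> a \<in> carrier A"
  shows "aff_iso B A (Spec_mor A B h)"
proof -
  interpret A: cring A by fact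
  interpret B: cring B by fact
  let ?\<Phi> = "Spec_mor A B h" and ?k = "inv_into (carrier A) h"
  have hom: "h \<in> Ring.ring_hom A B" and bij: "bij_betw h (carrier A) (carrier B)"
    using assms(3) by (auto simp: alg_iso_def ring_iso_def)
  have k: "?k \<in> Ring.ring_hom B A"
    using alg_iso_inv[OF assms] by (auto simp: alg_iso_def ring_iso_def)
  have kh: "?k (h a) = a" if "a \<in> carrier A" for a
    using bij that by (simp add: bij_betw_def inv_into_f_f)
  have hk: "h (?k b) = b" if "b \<in> carrier B" for b
    using bij that by (simp add: bij_betw_def f_inv_into_f)
  have pid: "on_pts (Spec_mor B A ?k) (on_pts ?\<Phi> Q) = Q" if "Q \<in> Spec B" for Q
  proof -
    interpret Q: primeideal Q B using that by (simp add: Spec_def)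
    show ?thesis using Q.Icarr hk k by (auto simp: on_pts_Spec_mor ring_hom_closed)
  qed
  have pid': "on_pts ?\<Phi> (on_pts (Spec_mor B A ?k) P) = P" if "P \<in> Spec A" for P
  proof -
    interpret P: primeideal P A using that by (simp add: Spec_def)
    show ?thesis using P.Icarr kh hom by (auto simp: on_pts_Spec_mor ring_hom_closed)
  qed
  have homeo: "homeomorphic_map (zariski B) (zariski A) (on_pts ?\<Phi>)"
    unfolding homeomorphic_map_maps homeomorphic_maps_def
    using continuous_Spec_mor[OF assms(1,2) hom] continuous_Spec_mor[OF assms(2,1) k] pid pid'
    by (auto simp: topspace_zariski[OF assms(1)] topspace_zariski[OF assms(2)])
  have sect: "on_sect ?\<Phi> U \<in> alg_iso (str_sheaf A U) (str_sheaf B (pts_vimage B ?\<Phi> U))"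
    if U: "openin (zariski A) U" for U
  proof -
    let ?V = "pts_vimage B ?\<Phi> U"
    let ?R = "str_sheaf A U" and ?S = "str_sheaf B ?V"
    have sub: "U \<subseteq> Spec A" using openin_subset[OF U] topspace_zariski[OF assms(1)] by simp
    have VU: "pts_vimage A (Spec_mor B A ?k) ?V = U"
      using pid' sub on_pts_Spec_mor_Spec[OF assms(2) k] by (auto simp: pts_vimage_def)
    have b: "bij_betw (on_sect ?\<Phi> U) (carrier ?R) (carrier ?S)"
    proof (rule bij_betw_byWitness[where f' = "on_sect (Spec_mor B A ?k) ?V"])
      show "\<forall>s\<in>carrier ?R. on_sect (Spec_mor B A ?k) ?V (on_sect ?\<Phi> U s) = s"
        using on_sect_inverse[OF assms(1,2) hom k kh _ sub] by blast
      show "\<forall>s\<in>carrier ?S. on_sect ?\<Phi> U (on_sect (Spec_mor B A ?k) ?V s) = s"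
        using on_sect_inverse[OF assms(2,1) k hom hk, of _ ?V] unfolding VU by (auto simp: pts_vimage_def)
      show "on_sect ?\<Phi> U ` carrier ?R \<subseteq> carrier ?S" using on_sect_closed[OF assms(1,2) hom] by blast
      show "on_sect (Spec_mor B A ?k) ?V ` carrier ?S \<subseteq> carrier ?R"
        using on_sect_closed[OF assms(2,1) k, of _ ?V] unfolding VU by blast
    qed
    have VD: "on_pts ?\<Phi> Q \<in> U" if "Q \<in> ?V" for Q using that by (simp add: pts_vimage_def)
    have val: "s (on_pts ?\<Phi> Q) \<in> carrier (localization A (on_pts ?\<Phi> Q))" if "s \<in> carrier ?R" "Q \<in> ?V" for s Q
      using that(1) VD[OF that(2)] by (auto simp: str_sheaf_def PiE_def Pi_def)
    have prime: "primeideal (on_pts ?\<Phi> Q) A" if "Q \<in> ?V" for Q using VD[OF that] sub by (auto simp: Spec_def)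
    note tr = localization_transport[OF assms(1-3) on_pts_Spec_mor smult]
    note ops = saturated_ops[OF assms(1) prime smult]
    have eqI: "on_sect ?\<Phi> U s = (\<lambda>Q\<in>?V. f Q)"
      if "\<And>Q. Q \<in> ?V \<Longrightarrow> on_sect ?\<Phi> U s Q = f Q" for s f
      unfolding on_sect_Spec_mor using that by (intro restrict_ext) (simp add: on_sect_Spec_mor)
    have ap: "on_sect ?\<Phi> U s Q = map_prod h h ` s (on_pts ?\<Phi> Q)" if "s \<in> carrier ?R" "Q \<in> ?V" for s Q
      by (rule on_sect_iso_apply[OF assms(1-3) that(2)],
          rule saturated_localization[OF assms(1) prime[OF that(2)] val[OF that]])
    have mult: "on_sect ?\<Phi> U (s \<otimes>\<^bsub>?R\<^esub> t) = on_sect ?\<Phi> U s \<otimes>\<^bsub>?S\<^esub> on_sect ?\<Phi> U t"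
      if s: "s \<in> carrier ?R" and t: "t \<in> carrier ?R" for s t
    proof -
      have "on_sect ?\<Phi> U (s \<otimes>\<^bsub>?R\<^esub> t) Q = on_sect ?\<Phi> U s Q \<otimes>\<^bsub>localization B Q\<^esub> on_sect ?\<Phi> U t Q"
        if Q: "Q \<in> ?V" for Q
      proof -
        let ?P = "on_pts ?\<Phi> Q"
        have e: "(s \<otimes>\<^bsub>?R\<^esub> t) ?P = s ?P \<otimes>\<^bsub>localization A ?P\<^esub> t ?P" using VD[OF Q] by (simp add: str_sheaf_def)
        have "on_sect ?\<Phi> U (s \<otimes>\<^bsub>?R\<^esub> t) Q = map_prod h h ` ((s \<otimes>\<^bsub>?R\<^esub> t) ?P)"
          by (rule on_sect_iso_apply[OF assms(1-3) Q]) (simp only: e ops(1)[OF Q val[OF s Q] val[OF t Q]])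
        thus ?thesis unfolding e ap[OF s Q] ap[OF t Q] tr(1)[OF val[OF s Q] val[OF t Q]] .
      qed
      from eqI[OF this] show ?thesis by (simp add: str_sheaf_def)
    qed
    have add: "on_sect ?\<Phi> U (s \<oplus>\<^bsub>?R\<^esub> t) = on_sect ?\<Phi> U s \<oplus>\<^bsub>?S\<^esub> on_sect ?\<Phi> U t"
      if s: "s \<in> carrier ?R" and t: "t \<in> carrier ?R" for s t
    proof -
      have "on_sect ?\<Phi> U (s \<oplus>\<^bsub>?R\<^esub> t) Q = on_sect ?\<Phi> U s Q \<oplus>\<^bsub>localization B Q\<^esub> on_sect ?\<Phi> U t Q"
        if Q: "Q \<in> ?V" for Q
      proof -
        let ?P = "on_pts ?\<Phi> Q"
        have e: "(s \<oplus>\<^bsub>?R\<^esub> t) ?P = s ?P \<oplus>\<^bsub>localization A ?P\<^esub> t ?P" using VD[OF Q] by (simp add: str_sheaf_def)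
        have "on_sect ?\<Phi> U (s \<oplus>\<^bsub>?R\<^esub> t) Q = map_prod h h ` ((s \<oplus>\<^bsub>?R\<^esub> t) ?P)"
          by (rule on_sect_iso_apply[OF assms(1-3) Q]) (simp only: e ops(2)[OF Q val[OF s Q] val[OF t Q]])
        thus ?thesis unfolding e ap[OF s Q] ap[OF t Q] tr(2)[OF val[OF s Q] val[OF t Q]] .
      qed
      from eqI[OF this] show ?thesis by (simp add: str_sheaf_def)
    qed
    have sm: "on_sect ?\<Phi> U (c \<odot>\<^bsub>?R\<^esub> s) = c \<odot>\<^bsub>?S\<^esub> on_sect ?\<Phi> U s" if s: "s \<in> carrier ?R" for s c
    proof -
      have "on_sect ?\<Phi> U (c \<odot>\<^bsub>?R\<^esub> s) Q = c \<odot>\<^bsub>localization B Q\<^esub> on_sect ?\<Phi> U s Q"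
        if Q: "Q \<in> ?V" for Q
      proof -
        let ?P = "on_pts ?\<Phi> Q"
        have e: "(c \<odot>\<^bsub>?R\<^esub> s) ?P = c \<odot>\<^bsub>localization A ?P\<^esub> s ?P" using VD[OF Q] by (simp add: str_sheaf_def)
        have "on_sect ?\<Phi> U (c \<odot>\<^bsub>?R\<^esub> s) Q = map_prod h h ` ((c \<odot>\<^bsub>?R\<^esub> s) ?P)"
          by (rule on_sect_iso_apply[OF assms(1-3) Q]) (simp only: e ops(3)[OF Q val[OF s Q] val[OF s Q]])
        thus ?thesis unfolding e ap[OF s Q] tr(3)[OF val[OF s Q] val[OF s Q]] .
      qed
      from eqI[OF this] show ?thesis by (simp add: str_sheaf_def)
    qed
    have one: "on_sect ?\<Phi> U \<one>\<^bsub>?R\<^esub> = \<one>\<^bsub>?S\<^esub>"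
    proof -
      have "on_sect ?\<Phi> U \<one>\<^bsub>?R\<^esub> Q = \<one>\<^bsub>localization B Q\<^esub>" if Q: "Q \<in> ?V" for Q
      proof -
        let ?P = "on_pts ?\<Phi> Q"
        have P1: "\<one>\<^bsub>localization A ?P\<^esub> \<in> carrier (localization A ?P)"
        proof -
          interpret P: primeideal ?P A using prime[OF Q] .
          have "\<one>\<^bsub>A\<^esub> \<notin> ?P" using P.one_imp_carrier P.I_notcarr by auto
          thus ?thesis by (auto simp: localization_def)
        qed
        have e: "\<one>\<^bsub>?R\<^esub> ?P = \<one>\<^bsub>localization A ?P\<^esub>" using VD[OF Q] by (simp add: str_sheaf_def)
        have "on_sect ?\<Phi> U \<one>\<^bsub>?R\<^esub> Q = map_prod h h ` (\<one>\<^bsub>?R\<^esub> ?P)"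
          by (rule on_sect_iso_apply[OF assms(1-3) Q]) (simp only: e ops(4)[OF Q P1 P1])
        thus ?thesis unfolding e tr(4)[OF P1 P1] .
      qed
      from eqI[OF this] show ?thesis by (simp add: str_sheaf_def)
    qed
    have "on_sect ?\<Phi> U \<in> Ring.ring_hom ?R ?S"
      by (rule ring_hom_memI) (simp_all add: on_sect_closed[OF assms(1,2) hom] mult add one)
    thus ?thesis using b sm by (simp add: alg_iso_def ring_iso_def)
  qed
  have "on_sect ?\<Phi> V (restrict s V) = restrict (on_sect ?\<Phi> U s) (pts_vimage B ?\<Phi> V)"
    if "V \<subseteq> U" for U V s
    unfolding on_sect_Spec_mor using that by (auto simp: pts_vimage_def fun_eq_iff restrict_def)
  thus ?thesis unfolding aff_iso_def using homeo sect by blast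
qed

section \<open>Matrices\<close>

lemma mat_assoc:
  fixes A B C :: "'a :: comm_ring_1 mat"
  shows "dim_col A = dim_row B \<Longrightarrow> dim_col B = dim_row C \<Longrightarrow> A * B * C = A * (B * C)"
  by (rule assoc_mult_mat[of _ "dim_row A" "dim_row B" _ "dim_row C" _ "dim_col C"]) auto

lemma mat_transpose_mult:
  fixes A B :: "'a :: comm_ring_1 mat"
  shows "dim_col A = dim_row B \<Longrightarrow> transpose_mat (A * B) = transpose_mat B * transpose_mat A"
  by (rule transpose_mult[of _ "dim_row A" "dim_row B" _ "dim_col B"]) auto

lemma mat_mult_smult:
  fixes A B :: "'a :: comm_ring_1 mat"
  shows "dim_col A = dim_row B \<Longrightarrow> (c \<cdot>\<^sub>m A) * B = c \<cdot>\<^sub>m (A * B)"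
    and "dim_col A = dim_row B \<Longrightarrow> A * (c \<cdot>\<^sub>m B) = c \<cdot>\<^sub>m (A * B)"
   by (rule mult_smult_assoc_mat[of _ "dim_row A" "dim_row B" _ "dim_col B"]; auto)
     (rule mult_smult_distrib[of _ "dim_row A" "dim_row B" _ "dim_col B"]; auto)

lemma smult_smult_mat: "a \<cdot>\<^sub>m (b \<cdot>\<^sub>m A) = (a * b) \<cdot>\<^sub>m (A :: 'a :: comm_ring_1 mat)"
  by (rule eq_matI) (auto simp: mult.assoc)

lemma mat_mult_uminus:
  fixes A B :: "'a :: comm_ring_1 mat"
  shows "dim_col A = dim_row B \<Longrightarrow> (- A) * B = - (A * B)"
    and "dim_col A = dim_row B \<Longrightarrow> A * (- B) = - (A * B)"
  by (rule uminus_mult_left_mat; simp) (rule uminus_mult_right_mat; simp)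

lemma mat_mult_entry:
  assumes "i < dim_row A" "j < dim_col B" "dim_col A = dim_row B"
  shows "(A * B) $$ (i, j) = (\<Sum>k<dim_row B. A $$ (i, k) * B $$ (k, j))"
  using assms by (simp add: scalar_prod_def lessThan_atLeast0)

lemma GL_iff: "A \<in> GL n \<longleftrightarrow> A \<in> carrier_mat n n \<and> det A \<noteq> 0"
proof
  assume A: "A \<in> GL n"
  then obtain B where B: "inverts_mat A B" "inverts_mat B A" and c: "A \<in> carrier_mat n n"
    by (auto simp: GL_def invertible_mat_def)
  have AB: "A * B = 1\<^sub>m n" "B * A = 1\<^sub>m (dim_row B)" using B c by (auto simp: inverts_mat_def)
  have "dim_col (B * A) = dim_row B" "dim_col (A * B) = n" using AB by simp_all
  hence Bc: "B \<in> carrier_mat n n" using c by auto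
  have "det A * det B = 1" using det_mult[OF c Bc] AB(1) by simp
  hence "det A \<noteq> 0" by (metis mult_zero_left zero_neq_one)
  thus "A \<in> carrier_mat n n \<and> det A \<noteq> 0" using c by blast
next
  assume A: "A \<in> carrier_mat n n \<and> det A \<noteq> 0"
  hence "A \<in> Units (ring_mat TYPE(complex) n ())" by (intro det_non_zero_imp_unit) auto
  then obtain B where "B \<in> carrier_mat n n" "B * A = 1\<^sub>m n" "A * B = 1\<^sub>m n"
    by (auto simp: Units_def ring_mat_def)
  thus "A \<in> GL n" using A by (auto simp: GL_def invertible_mat_def inverts_mat_def)
qed

lemma minv:
  assumes "A \<in> GL n"
  shows "minv A \<in> carrier_mat n n" "A * minv A = 1\<^sub>m n" "minv A * A = 1\<^sub>m n"
proof -
  have A: "A \<in> carrier_mat n n" "det A \<noteq> 0" using assms by (auto simp: GL_iff)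
  have "A \<in> Units (ring_mat TYPE(complex) n ())" using A by (intro det_non_zero_imp_unit) auto
  then obtain B where "mat_inverse A = Some B"
    using mat_inverse(1)[OF A(1), of "()"] by (cases "mat_inverse A") auto
  with mat_inverse(2)[OF A(1) this]
  show "minv A \<in> carrier_mat n n" "A * minv A = 1\<^sub>m n" "minv A * A = 1\<^sub>m n" by (auto simp: minv_def)
qed

lemma GL_carrier: "A \<in> GL n \<Longrightarrow> A \<in> carrier_mat n n"
  by (simp add: GL_iff)

lemma GL_dim: "A \<in> GL n \<Longrightarrow> dim_row A = n" "A \<in> GL n \<Longrightarrow> dim_col A = n"
    "A \<in> GL n \<Longrightarrow> dim_row (minv A) = n" "A \<in> GL n \<Longrightarrow> dim_col (minv A) = n"
  using minv(1)[of A n] by (auto simp: GL_iff)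

lemma GL_I:
  assumes "A \<in> carrier_mat n n" "B \<in> carrier_mat n n" "A * B = 1\<^sub>m n"
  shows "A \<in> GL n" "minv A = B"
proof -
  have "det A * det B = 1" using det_mult[OF assms(1,2)] assms(3) by simp
  hence "det A \<noteq> 0" by (metis mult_zero_left zero_neq_one)
  thus A: "A \<in> GL n" using assms(1) unfolding GL_iff by blast
  have "minv A = minv A * (A * B)" using minv(1)[OF A] assms(3) by simp
  also have "\<dots> = B" using minv[OF A] assms(1,2) by (simp add: mat_assoc[symmetric] GL_dim)
  finally show "minv A = B" .
qed

lemma GL_mult: "A \<in> GL n \<Longrightarrow> B \<in> GL n \<Longrightarrow> A * B \<in> GL n"
  by (auto simp: GL_iff det_mult)

lemma GL_minv: "A \<in> GL n \<Longrightarrow> minv A \<in> GL n"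
  using GL_I(1)[of "minv A" n A] minv[of A n] by (simp add: GL_iff)

lemma GL_transpose: "A \<in> GL n \<Longrightarrow> transpose_mat A \<in> GL n"
  by (auto simp: GL_iff det_transpose)

lemma GL_smult: "A \<in> GL n \<Longrightarrow> c \<noteq> 0 \<Longrightarrow> c \<cdot>\<^sub>m A \<in> GL n"
  by (auto simp: GL_iff)

lemma GL_cancel:
  assumes "A \<in> GL n" "dim_row C = n"
  shows "A * (minv A * C) = C" "minv A * (A * C) = C"
proof -
  have C: "C \<in> carrier_mat n (dim_col C)" using assms(2) by auto
  show "A * (minv A * C) = C" "minv A * (A * C) = C"
    using minv[OF assms(1)] C assms by (simp_all add: mat_assoc[symmetric] GL_dim)
qed

lemma minv_minv: "A \<in> GL n \<Longrightarrow> minv (minv A) = A"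
  using GL_I(2)[of "minv A" n A] minv[of A n] by (simp add: GL_iff)

lemma minv_mult:
  assumes "A \<in> GL n" "B \<in> GL n" shows "minv (A * B) = minv B * minv A"
proof (rule GL_I(2))
  show "A * B \<in> carrier_mat n n" "minv B * minv A \<in> carrier_mat n n"
    using assms minv(1)[of A n] minv(1)[of B n] by (auto simp: GL_iff)
  show "A * B * (minv B * minv A) = 1\<^sub>m n"
    using assms minv(2) by (simp add: mat_assoc GL_dim GL_cancel)
qed

lemma minv_transpose:
  assumes "A \<in> GL n" shows "minv (transpose_mat A) = transpose_mat (minv A)"
proof (rule GL_I(2))
  show "transpose_mat A \<in> carrier_mat n n" "transpose_mat (minv A) \<in> carrier_mat n n"
    using assms minv(1)[of A n] by (auto simp: GL_iff)
  have "transpose_mat A * transpose_mat (minv A) = transpose_mat (minv A * A)"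
    using assms by (simp add: mat_transpose_mult GL_dim)
  thus "transpose_mat A * transpose_mat (minv A) = 1\<^sub>m n" using minv(3)[OF assms] by simp
qed

lemma minv_smult:
  assumes "A \<in> GL n" "c \<noteq> 0" shows "minv (c \<cdot>\<^sub>m A) = inverse c \<cdot>\<^sub>m minv A"
proof (rule GL_I(2))
  show "c \<cdot>\<^sub>m A \<in> carrier_mat n n" "inverse c \<cdot>\<^sub>m minv A \<in> carrier_mat n n"
    using assms minv(1)[of A n] by (auto simp: GL_iff)
  have "1 \<cdot>\<^sub>m 1\<^sub>m n = (1\<^sub>m n :: complex mat)" by (rule eq_matI) auto
  thus "c \<cdot>\<^sub>m A * (inverse c \<cdot>\<^sub>m minv A) = 1\<^sub>m n"
    using assms minv(2)[of A n] by (simp add: mat_mult_smult GL_dim smult_smult_mat)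
qed

lemma det_minv:
  assumes "A \<in> GL n" shows "det (minv A) = inverse (det A)"
proof -
  have "det A * det (minv A) = 1" using det_mult[OF GL_carrier[OF assms] minv(1)[OF assms]] minv(2)[OF assms] by simp
  thus ?thesis by (metis inverse_unique)
qed

lemma Jmat_simps: "Jmat n \<in> carrier_mat n n" "transpose_mat (Jmat n) = Jmat n" "Jmat n * Jmat n = 1\<^sub>m n"
    "dim_row (Jmat n) = n" "dim_col (Jmat n) = n"
proof -
  show "Jmat n \<in> carrier_mat n n" "dim_row (Jmat n) = n" "dim_col (Jmat n) = n" by (simp_all add: Jmat_def)
  show "transpose_mat (Jmat n) = Jmat n" by (rule eq_matI) (auto simp: Jmat_def add.commute)
  show "Jmat n * Jmat n = 1\<^sub>m n"
  proof (rule eq_matI)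
    fix i j assume "i < dim_row (1\<^sub>m n :: complex mat)" "j < dim_col (1\<^sub>m n :: complex mat)"
    hence i: "i < n" "j < n" by simp_all
    have "(Jmat n * Jmat n) $$ (i, j) = (\<Sum>k<n. if k = n - 1 - i then (if k = n - 1 - j then 1 else 0) else 0)"
      using i by (subst mat_mult_entry; (intro sum.cong)?; auto simp: Jmat_def)
    also have "\<dots> = 1\<^sub>m n $$ (i, j)" using i by (auto simp: sum.delta)
    finally show "(Jmat n * Jmat n) $$ (i, j) = 1\<^sub>m n $$ (i, j)" .
  qed (simp_all add: Jmat_def)
qed

lemma Jmat_GL: "Jmat n \<in> GL n" "minv (Jmat n) = Jmat n"
  using GL_I[of "Jmat n" n "Jmat n"] by (simp_all add: Jmat_simps)

lemma Jmat_cancel: "dim_row C = n \<Longrightarrow> Jmat n * (Jmat n * C) = C"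
  using GL_cancel(1)[OF Jmat_GL(1)[of n]] by (simp add: Jmat_GL(2))

lemma Jmat_mult_entry: "dim_row C = n \<Longrightarrow> i < n \<Longrightarrow> j < dim_col C \<Longrightarrow> (Jmat n * C) $$ (i, j) = C $$ (n - 1 - i, j)"
proof -
  assume a: "dim_row C = n" "i < n" "j < dim_col C"
  have "(Jmat n * C) $$ (i, j) = (\<Sum>k<n. if k = n - 1 - i then C $$ (k, j) else 0)"
    using a by (subst mat_mult_entry; (intro sum.cong)?; auto simp: Jmat_def)
  thus ?thesis using a by (simp add: sum.delta)
qed


section \<open>Companion matrices\<close>

lemma companion_carrier: "companion n p \<in> carrier_mat n n" "dim_row (companion n p) = n" "dim_col (companion n p) = n"
  by (simp_all add: companion_def)

lemma Smat_carrier: "Smat n p \<in> carrier_mat n n" "dim_row (Smat n p) = n" "dim_col (Smat n p) = n"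
  by (simp_all add: Smat_def)

lemma Smat_sym: "transpose_mat (Smat n p) = Smat n p"
  by (rule eq_matI) (auto simp: Smat_def add.commute)

lemma monic_coeff: "p \<in> monic_polys n \<Longrightarrow> coeff p n = 1" "p \<in> monic_polys n \<Longrightarrow> n < i \<Longrightarrow> coeff p i = 0"
  by (auto simp: monic_polys_def coeff_eq_0)

lemma cpoly_companion:
  assumes "p \<in> monic_polys n" shows "cpoly n (companion n p) = p"
  unfolding cpoly_def
proof (rule the_equality)
  fix q assume q: "q \<in> monic_polys n \<and> companion n q = companion n p"
  show "q = p"
  proof (rule poly_eqI)
    fix i
    show "coeff q i = coeff p i"
    proof (cases "i < n")
      case True
      hence "companion n q $$ (i, n - 1) = companion n p $$ (i, n - 1)" using q by simp
      thus ?thesis using True by (simp add: companion_def)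
    next
      case False
      thus ?thesis using q assms by (cases "i = n") (auto simp: monic_coeff)
    qed
  qed
qed (use assms in auto)

text \<open>Reversing the order of the rows makes \<open>S\<^sub>p\<close> unitriangular.\<close>

lemma det_Smat:
  assumes "p \<in> monic_polys n" shows "det (Smat n p) * det (Jmat n) = 1"
proof -
  let ?M = "Jmat n * Smat n p"
  have M: "?M \<in> carrier_mat n n" by (simp add: Jmat_simps Smat_carrier mult_carrier_mat[of _ n n])
  have e: "?M $$ (i, j) = coeff p (n - 1 - i + j + 1)" if "i < n" "j < n" for i j
    using that by (subst Jmat_mult_entry) (auto simp: Smat_def)
  have "det ?M = prod_list (diag_mat ?M)"
    by (rule det_lower_triangular[OF _ M]) (use e in \<open>auto intro!: monic_coeff(2)[OF assms]\<close>)
  also have "diag_mat ?M = map (\<lambda>i. 1) [0..<n]"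
    using M e by (auto simp: diag_mat_def monic_coeff(1)[OF assms])
  also have "prod_list \<dots> = 1" by (induction n) auto
  finally have "det ?M = 1" .
  thus ?thesis using det_mult[OF Jmat_simps(1) Smat_carrier(1), of n p] by (simp add: mult.commute)
qed

lemma Smat_GL: "p \<in> monic_polys n \<Longrightarrow> Smat n p \<in> GL n"
  using det_Smat[of p n] by (auto simp: GL_iff Smat_carrier)

text \<open>
  The matrix \<open>C\<^sub>p S\<^sub>p\<close> has entries depending only on \<open>i + j\<close>, except that its border vanishes off the corner; so it is symmetric, as is \<open>S\<^sub>p\<close>.  The two products are
  transposes of each other.
\<close>

lemma companion_Smat:
  assumes p: "p \<in> monic_polys n"
  shows "companion n p * Smat n p = Smat n p * transpose_mat (companion n p)"
proof -
  have e: "(companion n p * Smat n p) $$ (i, j) =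
      (if i = 0 then 0 else if j = 0 then 0 else coeff p (i + j)) - (if i = 0 \<and> j = 0 then coeff p 0 else 0)"
    if i: "i < n" "j < n" for i j
  proof -
    have "(companion n p * Smat n p) $$ (i, j) =
        (\<Sum>k<n. (if i = k + 1 \<and> k + 1 \<noteq> n then coeff p (k + j + 1) else 0) -
          (if k = n - 1 then coeff p i * coeff p (k + j + 1) else 0))"
      using i by (subst mat_mult_entry; (intro sum.cong)?; auto simp: companion_def Smat_def)
    also have "\<dots> = (\<Sum>k<n. if k = i - 1 \<and> i \<noteq> 0 then coeff p (k + j + 1) else 0) -
        coeff p i * coeff p (n + j)"
      unfolding sum_subtractf using i by (intro arg_cong2[of _ _ _ _ "(-)"] sum.cong) (auto simp: sum.delta)
    also have "(\<Sum>k<n. if k = i - 1 \<and> i \<noteq> 0 then coeff p (k + j + 1) else 0) = (if i = 0 then 0 else coeff p (i + j))"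
      using i by (cases "i = 0") (auto simp: sum.delta)
    finally show ?thesis using monic_coeff[OF p] i by auto
  qed
  have "transpose_mat (companion n p * Smat n p) = companion n p * Smat n p"
    by (rule eq_matI) (use e in \<open>auto simp: companion_carrier Smat_carrier add.commute\<close>)
  thus ?thesis by (simp add: mat_transpose_mult companion_carrier Smat_carrier Smat_sym)
qed

text \<open>
  Indices start at 0, so the basis vectors \<open>e\<^sub>1\<close> and \<open>e\<^sub>n\<close> are \<open>evec n 0\<close> and \<open>evec n (n - 1)\<close>.
\<close>

definition evec :: "nat \<Rightarrow> nat \<Rightarrow> complex mat" where
  "evec n k = mat n 1 (\<lambda>(i, _). if i = k then 1 else 0)"

definition pvec :: "nat \<Rightarrow> complex poly \<Rightarrow> complex mat" where
  "pvec n p = mat n 1 (\<lambda>(i, _). coeff p i)"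

lemma vec_dims: "dim_row (evec n k) = n" "dim_col (evec n k) = 1" "dim_row (pvec n p) = n" "dim_col (pvec n p) = 1"
  "evec n k \<in> carrier_mat n 1" "pvec n p \<in> carrier_mat n 1"
  by (simp_all add: evec_def pvec_def)

lemma mult_evec_entry:
  assumes "dim_col A = n" "k < n" "i < dim_row A" shows "(A * evec n k) $$ (i, 0) = A $$ (i, k)"
proof -
  have "(A * evec n k) $$ (i, 0) = (\<Sum>l<n. if l = k then A $$ (i, l) else 0)"
    using assms by (subst mat_mult_entry; (intro sum.cong)?; auto simp: evec_def)
  thus ?thesis using assms by (simp add: sum.delta)
qed

lemma mat_eq_columns:
  assumes "A \<in> carrier_mat m n" "B \<in> carrier_mat m n" "\<And>k. k < n \<Longrightarrow> A * evec n k = B * evec n k"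
  shows "A = B"
proof (rule eq_matI)
  fix i j assume "i < dim_row B" "j < dim_col B"
  thus "A $$ (i, j) = B $$ (i, j)"
    using mult_evec_entry[of A n j i] mult_evec_entry[of B n j i] assms by auto
qed (use assms in auto)

lemma col_eqI:
  "dim_row A = n \<Longrightarrow> dim_row B = n \<Longrightarrow> dim_col A = 1 \<Longrightarrow> dim_col B = 1 \<Longrightarrow>
    (\<And>i. i < n \<Longrightarrow> A $$ (i, 0) = B $$ (i, 0)) \<Longrightarrow> A = B"
  by (rule eq_matI) auto

lemma companion_evec: "k + 1 < n \<Longrightarrow> companion n p * evec n k = evec n (k + 1)"
  by (rule col_eqI[of _ n])
    (simp_all add: companion_carrier vec_dims mult_evec_entry[of _ n] del: index_mult_mat(1), auto simp: companion_def evec_def)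

lemma companion_transpose_evec:
  "0 < k \<Longrightarrow> k < n \<Longrightarrow> transpose_mat (companion n p) * evec n k = evec n (k - 1) - coeff p k \<cdot>\<^sub>m evec n (n - 1)"
  by (rule col_eqI[of _ n])
    (simp_all add: companion_carrier vec_dims mult_evec_entry[of _ n] del: index_mult_mat(1), auto simp: companion_def evec_def)

lemma pow_mat_intertwine:
  fixes A B S :: "'a :: comm_ring_1 mat"
  assumes A: "A \<in> carrier_mat n n" and B: "B \<in> carrier_mat n n" and S: "S \<in> carrier_mat n n"
    and e: "A * S = S * B"
  shows "A ^\<^sub>m k * S = S * B ^\<^sub>m k"
proof (induction k)
  case 0
  thus ?case using A B S by simp
next
  case (Suc k)
  have d: "dim_row (A ^\<^sub>m k) = n" "dim_col (A ^\<^sub>m k) = n" "dim_row (B ^\<^sub>m k) = n" "dim_col (B ^\<^sub>m k) = n"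
    using pow_carrier_mat[OF A, of k] pow_carrier_mat[OF B, of k] by auto
  have "A ^\<^sub>m Suc k * S = A ^\<^sub>m k * (S * B)" using A B S d by (simp add: mat_assoc e)
  also have "\<dots> = S * B ^\<^sub>m Suc k" using A B S d Suc by (simp add: mat_assoc[symmetric])
  finally show ?case .
qed

lemma pow_mat_transpose:
  assumes A: "A \<in> carrier_mat n n"
  shows "transpose_mat A ^\<^sub>m k = transpose_mat ((A :: 'a :: comm_ring_1 mat) ^\<^sub>m k)"
proof (induction k)
  case 0
  thus ?case using A by simp
next
  case (Suc k)
  have d: "dim_row (A ^\<^sub>m k) = n" "dim_col (A ^\<^sub>m k) = n" using pow_carrier_mat[OF A, of k] by auto
  have "transpose_mat A ^\<^sub>m Suc k = transpose_mat (A * A ^\<^sub>m k)" using A d Suc by (simp add: mat_transpose_mult)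
  also have "A * A ^\<^sub>m k = A ^\<^sub>m Suc k" using pow_mat_intertwine[OF A A A refl, of k] by simp
  finally show ?case .
qed

lemma companion_pow_evec: "k < n \<Longrightarrow> companion n p ^\<^sub>m k * evec n 0 = evec n k"
proof (induction k)
  case 0
  thus ?case using left_mult_one_mat[OF vec_dims(5)] by (simp add: companion_carrier)
next
  case (Suc k)
  note C = companion_carrier(1)[of n p]
  have "companion n p ^\<^sub>m Suc k = companion n p * companion n p ^\<^sub>m k"
    using pow_mat_intertwine[OF C C C refl, of k] by simp
  moreover have "dim_row (companion n p ^\<^sub>m k) = n" "dim_col (companion n p ^\<^sub>m k) = n"
    using pow_carrier_mat[OF C, of k] by auto
  ultimately show ?case using Suc companion_evec[of k n p]
    by (simp add: mat_assoc companion_carrier vec_dims del: pow_mat.simps)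
qed

lemma companion_last_evec:
  assumes "n > 0" shows "companion n p * evec n (n - 1) = - pvec n p"
  by (rule col_eqI[of _ n])
    (use assms in \<open>simp_all add: companion_carrier vec_dims mult_evec_entry[of _ n] del: index_mult_mat(1)\<close>,
      use assms in \<open>auto simp: companion_def pvec_def\<close>)

lemma poly_mat_carrier: "A \<in> carrier_mat n n \<Longrightarrow> poly_mat q A \<in> carrier_mat n n"
  by (auto simp: poly_mat_def)

lemma poly_mat_entry:
  "A \<in> carrier_mat n n \<Longrightarrow> i < n \<Longrightarrow> j < n \<Longrightarrow>
    poly_mat q A $$ (i, j) = (\<Sum>k\<le>degree q. coeff q k * (A ^\<^sub>m k) $$ (i, j))"
  by (auto simp: poly_mat_def)

lemma poly_mat_mult_entry:
  assumes A: "A \<in> carrier_mat n n" and S: "S \<in> carrier_mat n m" and i: "i < n" "j < m"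
  shows "(poly_mat q A * S) $$ (i, j) = (\<Sum>k\<le>degree q. coeff q k * (A ^\<^sub>m k * S) $$ (i, j))"
proof -
  have d: "dim_row (A ^\<^sub>m k) = n" "dim_col (A ^\<^sub>m k) = n" for k using pow_carrier_mat[OF A, of k] by auto
  have "(poly_mat q A * S) $$ (i, j) = (\<Sum>l<n. \<Sum>k\<le>degree q. coeff q k * (A ^\<^sub>m k) $$ (i, l) * S $$ (l, j))"
    using poly_mat_carrier[OF A, of q] S i A
    by (subst mat_mult_entry; (intro sum.cong)?; auto simp: poly_mat_entry sum_distrib_right)
  also have "\<dots> = (\<Sum>k\<le>degree q. \<Sum>l<n. coeff q k * (A ^\<^sub>m k) $$ (i, l) * S $$ (l, j))" by (rule sum.swap)
  also have "\<dots> = (\<Sum>k\<le>degree q. coeff q k * (A ^\<^sub>m k * S) $$ (i, j))"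
    using S i d by (intro sum.cong refl, subst mat_mult_entry) (auto simp: sum_distrib_left mult.assoc)
  finally show ?thesis .
qed

lemma mat_mult_poly_entry:
  assumes A: "A \<in> carrier_mat n n" and S: "S \<in> carrier_mat m n" and i: "i < m" "j < n"
  shows "(S * poly_mat q A) $$ (i, j) = (\<Sum>k\<le>degree q. coeff q k * (S * A ^\<^sub>m k) $$ (i, j))"
proof -
  have d: "dim_row (A ^\<^sub>m k) = n" "dim_col (A ^\<^sub>m k) = n" for k using pow_carrier_mat[OF A, of k] by auto
  have "(S * poly_mat q A) $$ (i, j) = (\<Sum>l<n. \<Sum>k\<le>degree q. coeff q k * S $$ (i, l) * (A ^\<^sub>m k) $$ (l, j))"
    using poly_mat_carrier[OF A, of q] S i A
    by (subst mat_mult_entry; (intro sum.cong)?; auto simp: poly_mat_entry sum_distrib_left ac_simps)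
  also have "\<dots> = (\<Sum>k\<le>degree q. \<Sum>l<n. coeff q k * S $$ (i, l) * (A ^\<^sub>m k) $$ (l, j))" by (rule sum.swap)
  also have "\<dots> = (\<Sum>k\<le>degree q. coeff q k * (S * A ^\<^sub>m k) $$ (i, j))"
    using S i d by (intro sum.cong refl, subst mat_mult_entry) (auto simp: sum_distrib_left mult.assoc)
  finally show ?thesis .
qed

lemma poly_mat_intertwine:
  assumes A: "A \<in> carrier_mat n n" and B: "B \<in> carrier_mat n n" and S: "S \<in> carrier_mat n n"
    and e: "A * S = S * B"
  shows "poly_mat q A * S = S * poly_mat q B"
proof (rule eq_matI)
  fix i j assume "i < dim_row (S * poly_mat q B)" "j < dim_col (S * poly_mat q B)"
  hence i: "i < n" "j < n" using S poly_mat_carrier[OF B, of q] by auto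
  show "(poly_mat q A * S) $$ (i, j) = (S * poly_mat q B) $$ (i, j)"
    unfolding poly_mat_mult_entry[OF A S i] mat_mult_poly_entry[OF B S i] pow_mat_intertwine[OF A B S e] ..
qed (use S poly_mat_carrier[OF A, of q] poly_mat_carrier[OF B, of q] in auto)

lemma poly_mat_transpose:
  assumes A: "A \<in> carrier_mat n n" shows "poly_mat q (transpose_mat A) = transpose_mat (poly_mat q A)"
proof (rule eq_matI)
  have d: "dim_row (A ^\<^sub>m k) = n" "dim_col (A ^\<^sub>m k) = n" for k using pow_carrier_mat[OF A, of k] by auto
  fix i j assume "i < dim_row (transpose_mat (poly_mat q A))" "j < dim_col (transpose_mat (poly_mat q A))"
  hence "i < n" "j < n" using poly_mat_carrier[OF A, of q] by auto
  thus "poly_mat q (transpose_mat A) $$ (i, j) = transpose_mat (poly_mat q A) $$ (i, j)"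
    using A poly_mat_carrier[OF A, of q] d
    by (simp add: poly_mat_entry[of _ n] pow_mat_transpose[OF A])
qed (use A poly_mat_carrier[OF A, of q] in \<open>auto simp: poly_mat_def\<close>)

text \<open>
  The first basis vector is the class of \<open>1\<close> in \<open>\<complex>[t]/(p)\<close>, so \<open>q(C\<^sub>p)\<close> sends it to the class of \<open>q\<close>, which is represented by the
  polynomial \<open>q - p\<close> of degree less than \<open>n\<close>.
\<close>

lemma poly_mat_companion_evec:
  assumes "n > 0" and p: "p \<in> monic_polys n" and q: "q \<in> monic_polys n"
  shows "poly_mat q (companion n p) * evec n 0 = pvec n q - pvec n p"
proof (rule col_eqI[of _ n])
  note C = companion_carrier(1)[of n p]
  obtain m where m: "n = Suc m" using assms(1) by (cases n) auto
  have "companion n p ^\<^sub>m n = companion n p * companion n p ^\<^sub>m m"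
    using pow_mat_intertwine[OF C C C refl, of m] m by simp
  moreover have "dim_row (companion n p ^\<^sub>m m) = n" "dim_col (companion n p ^\<^sub>m m) = n"
    using pow_carrier_mat[OF C, of m] by auto
  ultimately have top: "companion n p ^\<^sub>m n * evec n 0 = - pvec n p"
    using companion_pow_evec[of m n p] companion_last_evec[of n p] m
    by (simp add: mat_assoc companion_carrier vec_dims del: pow_mat.simps)
  fix i assume i: "i < n"
  have "degree q = n" using q by (simp add: monic_polys_def)
  hence "(poly_mat q (companion n p) * evec n 0) $$ (i, 0) =
      (\<Sum>k\<le>n. coeff q k * (companion n p ^\<^sub>m k * evec n 0) $$ (i, 0))"
    using poly_mat_mult_entry[OF C vec_dims(5) i, of 0 q 0] by simp
  also have "{..n} = insert n {..<n}" by auto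
  also have "(\<Sum>k\<in>insert n {..<n}. coeff q k * (companion n p ^\<^sub>m k * evec n 0) $$ (i, 0)) =
      - coeff p i + (\<Sum>k<n. coeff q k * evec n k $$ (i, 0))"
    using companion_pow_evec[of _ n p] i by (simp add: top monic_coeff(1)[OF q] vec_dims del: index_mult_mat(1))
      (simp add: pvec_def)
  also have "(\<Sum>k<n. coeff q k * evec n k $$ (i, 0)) = (\<Sum>k<n. if k = i then coeff q k else 0)"
    using i by (intro sum.cong refl) (auto simp: evec_def)
  also have "\<dots> = coeff q i" using i by (simp add: sum.delta)
  finally show "(poly_mat q (companion n p) * evec n 0) $$ (i, 0) = (pvec n q - pvec n p) $$ (i, 0)"
    using i by (simp add: pvec_def)
qed (use poly_mat_carrier[OF companion_carrier(1)[of n p]] in \<open>auto simp: vec_dims\<close>)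

text \<open>The last basis vector is cyclic for \<open>C\<^sub>p\<^sup>T\<close>, so an intertwiner from \<open>C\<^sub>p\<^sup>T\<close> to \<open>C\<^sub>p\<close> is
  determined by its value there.\<close>

lemma companion_intertwiner_unique:
  assumes X: "X \<in> carrier_mat n n" "X * transpose_mat (companion n p) = companion n p * X"
    and Z: "Z \<in> carrier_mat n n" "Z * transpose_mat (companion n p) = companion n p * Z"
    and e: "X * evec n (n - 1) = Z * evec n (n - 1)"
  shows "X = Z"
proof (rule mat_eq_columns)
  show "X \<in> carrier_mat n n" "Z \<in> carrier_mat n n" by fact+
  let ?C = "companion n p"
  have pred: "Y * evec n (k - 1) = ?C * (Y * evec n k) + coeff p k \<cdot>\<^sub>m (Y * evec n (n - 1))"
    if k: "0 < k" "k < n" and Y: "Y \<in> carrier_mat n n" "Y * transpose_mat ?C = ?C * Y" for Y k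
  proof -
    have "transpose_mat ?C * evec n k + coeff p k \<cdot>\<^sub>m evec n (n - 1) = evec n (k - 1)"
      unfolding companion_transpose_evec[OF k] by (rule eq_matI) (auto simp: evec_def)
    hence "Y * evec n (k - 1) = Y * (transpose_mat ?C * evec n k + coeff p k \<cdot>\<^sub>m evec n (n - 1))" by simp
    also have "\<dots> = Y * (transpose_mat ?C * evec n k) + Y * (coeff p k \<cdot>\<^sub>m evec n (n - 1))"
      using Y(1) by (intro mult_add_distrib_mat[of _ n n _ 1])
        (auto simp: vec_dims companion_carrier intro!: carrier_matI)
    also have "Y * (transpose_mat ?C * evec n k) = Y * transpose_mat ?C * evec n k"
      using Y(1) by (simp add: mat_assoc companion_carrier vec_dims)
    also have "\<dots> = ?C * (Y * evec n k)"
      using Y by (simp add: mat_assoc companion_carrier vec_dims)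
    also have "Y * (coeff p k \<cdot>\<^sub>m evec n (n - 1)) = coeff p k \<cdot>\<^sub>m (Y * evec n (n - 1))"
      using Y(1) by (simp add: mat_mult_smult vec_dims)
    finally show ?thesis .
  qed
  fix k assume "k < n"
  hence "k \<le> n - 1" by simp
  thus "X * evec n k = Z * evec n k"
  proof (induction k rule: inc_induct)
    case base
    show ?case by (rule e)
  next
    case (step k)
    hence k: "0 < Suc k" "Suc k < n" by auto
    show ?case using step.IH pred[OF k X] pred[OF k Z] e by simp
  qed
qed

lemma companion_rank_one:
  assumes "n > 0"
  shows "companion n p = companion n q + (pvec n q - pvec n p) * transpose_mat (evec n (n - 1))"
proof (rule eq_matI)
  fix i j assume "i < dim_row (companion n q + (pvec n q - pvec n p) * transpose_mat (evec n (n - 1)))"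
    "j < dim_col (companion n q + (pvec n q - pvec n p) * transpose_mat (evec n (n - 1)))"
  hence i: "i < n" "j < n" by (auto simp: vec_dims companion_carrier)
  have "((pvec n q - pvec n p) * transpose_mat (evec n (n - 1))) $$ (i, j) =
      (if j = n - 1 then coeff q i - coeff p i else 0)"
    using i by (subst mat_mult_entry) (auto simp: evec_def pvec_def)
  thus "companion n p $$ (i, j) = (companion n q + (pvec n q - pvec n p) * transpose_mat (evec n (n - 1))) $$ (i, j)"
    using i by (auto simp: companion_carrier vec_dims simp del: index_mult_mat(1)) (auto simp: companion_def)
qed (auto simp: vec_dims companion_carrier)

lemma poly_mat_Smat:
  assumes "p \<in> monic_polys n"
  shows "poly_mat q (companion n p) * Smat n p = Smat n p * poly_mat q (transpose_mat (companion n p))"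
  by (rule poly_mat_intertwine[OF companion_carrier(1) _ Smat_carrier(1) companion_Smat[OF assms]])
    (simp add: companion_carrier)

lemma poly_mat_Smat_sym:
  assumes "p \<in> monic_polys n"
  shows "transpose_mat (poly_mat q (companion n p) * Smat n p) = poly_mat q (companion n p) * Smat n p"
  using poly_mat_carrier[OF companion_carrier(1), of q n p] poly_mat_Smat[OF assms, of q]
  by (simp add: mat_transpose_mult Smat_carrier Smat_sym poly_mat_transpose[OF companion_carrier(1)])

lemma Smat_last_evec:
  assumes "n > 0" and p: "p \<in> monic_polys n" shows "Smat n p * evec n (n - 1) = evec n 0"
  by (rule col_eqI[of _ n])
    (use assms(1) in \<open>simp_all add: Smat_carrier vec_dims mult_evec_entry[of _ n] del: index_mult_mat(1)\<close>,
      use assms(1) monic_coeff[OF p] in \<open>auto simp: Smat_def evec_def\<close>)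

text \<open>This is the antisymmetry of the Bezoutian of \<open>p\<close> and \<open>q\<close>.  Both sides are intertwiners from
  \<open>C\<^sub>p\<^sup>T\<close> to \<open>C\<^sub>p\<close> with the same last column: for the right hand side this uses that \<open>C\<^sub>p\<close> and \<open>C\<^sub>q\<close>
  differ by a matrix of rank one and that the right hand side is symmetric.\<close>

lemma bezoutian_antisym:
  assumes n: "n > 0" and p: "p \<in> monic_polys n" and q: "q \<in> monic_polys n"
  shows "poly_mat q (companion n p) * Smat n p = - (poly_mat p (companion n q) * Smat n q)"
proof (rule companion_intertwiner_unique[where p = p])
  let ?C = "companion n p" and ?D = "companion n q" and ?d = "pvec n q - pvec n p" and ?e = "evec n (n - 1)"
  define X where "X = poly_mat q ?C * Smat n p"
  define Z where "Z = - (poly_mat p ?D * Smat n q)"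
  note cs = companion_carrier Smat_carrier vec_dims
  have P: "dim_row (poly_mat q ?C) = n" "dim_col (poly_mat q ?C) = n" "dim_row (poly_mat p ?D) = n" "dim_col (poly_mat p ?D) = n"
    using poly_mat_carrier[OF companion_carrier(1), of q n p] poly_mat_carrier[OF companion_carrier(1), of p n q] by auto
  show Xc: "poly_mat q ?C * Smat n p \<in> carrier_mat n n" and Zc: "- (poly_mat p ?D * Smat n q) \<in> carrier_mat n n"
    using P by (auto simp: cs)
  have comm: "poly_mat r (companion n s) * companion n s = companion n s * poly_mat r (companion n s)" for r s
    by (rule poly_mat_intertwine) (auto simp: cs)
  have twine: "poly_mat r (companion n s) * Smat n s * transpose_mat (companion n s) =
      companion n s * (poly_mat r (companion n s) * Smat n s)" if s: "s \<in> monic_polys n" for r s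
  proof -
    have d: "dim_row (poly_mat r (companion n s)) = n" "dim_col (poly_mat r (companion n s)) = n"
      using poly_mat_carrier[OF companion_carrier(1), of r n s] by auto
    have "poly_mat r (companion n s) * Smat n s * transpose_mat (companion n s) =
        poly_mat r (companion n s) * (companion n s * Smat n s)"
      using d by (simp add: mat_assoc cs companion_Smat[OF s])
    also have "\<dots> = companion n s * (poly_mat r (companion n s) * Smat n s)"
      using d comm[of r s] by (simp add: mat_assoc[symmetric] cs)
    finally show ?thesis .
  qed
  show "poly_mat q ?C * Smat n p * transpose_mat ?C = ?C * (poly_mat q ?C * Smat n p)" by (rule twine[OF p])
  have ev: "poly_mat r (companion n s) * Smat n s * ?e = pvec n r - pvec n s"
    if r: "r \<in> monic_polys n" and s: "s \<in> monic_polys n" for r s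
  proof -
    have d: "dim_row (poly_mat r (companion n s)) = n" "dim_col (poly_mat r (companion n s)) = n"
      using poly_mat_carrier[OF companion_carrier(1), of r n s] by auto
    show ?thesis using d by (simp add: mat_assoc cs Smat_last_evec[OF n s, simplified] poly_mat_companion_evec[OF n s r])
  qed
  have Ze: "Z * ?e = ?d"
  proof -
    have "Z * ?e = - (poly_mat p ?D * Smat n q * ?e)" unfolding Z_def by (rule mat_mult_uminus(1)) (simp add: cs P)
    also have "\<dots> = - (pvec n p - pvec n q)" by (simp only: ev[OF p q])
    also have "\<dots> = ?d" by (rule eq_matI) (auto simp: pvec_def)
    finally show ?thesis .
  qed
  show "poly_mat q ?C * Smat n p * ?e = - (poly_mat p ?D * Smat n q) * ?e"
    using Ze ev[OF q p] by (simp add: Z_def)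
  have Zsym: "transpose_mat Z = Z" unfolding Z_def by (simp add: transpose_uminus poly_mat_Smat_sym[OF q])
  have Zd: "dim_row Z = n" "dim_col Z = n" using Zc by (auto simp: Z_def)
  have ZD: "Z * transpose_mat ?D = ?D * Z" unfolding Z_def
    using twine[OF q, of p] by (simp add: mat_mult_uminus cs P)
  have eZ: "transpose_mat ?e * Z = transpose_mat ?d"
  proof -
    have "transpose_mat ?e * Z = transpose_mat (Z * ?e)" using Zd by (simp add: mat_transpose_mult cs Zsym)
    thus ?thesis by (simp only: Ze)
  qed
  have "?C * Z = ?D * Z + ?d * transpose_mat ?e * Z"
    unfolding companion_rank_one[OF n, of p q] using Zd
    by (intro add_mult_distrib_mat[of _ n n _ _ n]) (auto simp: cs intro!: carrier_matI)
  also have "\<dots> = ?D * Z + ?d * transpose_mat ?d" using Zd by (simp add: mat_assoc cs eZ[simplified])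
  finally have CZ: "?C * Z = ?D * Z + ?d * transpose_mat ?d" .
  have "transpose_mat (?C * Z) = transpose_mat (?D * Z) + transpose_mat (?d * transpose_mat ?d)"
    unfolding CZ using Zd by (intro transpose_add[of _ n n]) (auto simp: cs intro!: carrier_matI)
  also have "transpose_mat (?D * Z) = Z * transpose_mat ?D" using Zd by (simp add: mat_transpose_mult cs Zsym)
  also have "transpose_mat (?d * transpose_mat ?d) = ?d * transpose_mat ?d" by (simp add: mat_transpose_mult cs)
  finally have "transpose_mat (?C * Z) = ?C * Z" unfolding CZ ZD .
  hence "Z * transpose_mat ?C = ?C * Z" using Zd by (simp add: mat_transpose_mult cs Zsym)
  thus "- (poly_mat p ?D * Smat n q) * transpose_mat ?C = ?C * - (poly_mat p ?D * Smat n q)" by (simp add: Z_def)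
qed

section \<open>Algebras of functions\<close>

text \<open>
  \<open>Q\<close> is a property of functions on \<open>X\<close> which defines a subalgebra, such as being regular, being
  polynomial, or being a fraction with a given denominator.  Closure under the operations of
  matrix calculus is proved once for all of these.
\<close>

locale fun_algebra =
  fixes X :: "'p set" and Q :: "('p \<Rightarrow> complex) \<Rightarrow> bool"
  assumes const: "Q (\<lambda>x. c)"
    and add: "Q f \<Longrightarrow> Q g \<Longrightarrow> Q (\<lambda>x. f x + g x)"
    and mult: "Q f \<Longrightarrow> Q g \<Longrightarrow> Q (\<lambda>x. f x * g x)"
    and cong: "(\<And>x. x \<in> X \<Longrightarrow> f x = g x) \<Longrightarrow> Q f \<Longrightarrow> Q g"
begin

lemmas closed = const add mult

lemma uminus: "Q f \<Longrightarrow> Q (\<lambda>x. - f x)"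
  using mult[OF const[of "- 1"], of f] by simp

lemma diff: "Q f \<Longrightarrow> Q g \<Longrightarrow> Q (\<lambda>x. f x - g x)"
  using add[OF _ uminus, of f g] by simp

lemma sum: "(\<And>i. i \<in> I \<Longrightarrow> Q (f i)) \<Longrightarrow> Q (\<lambda>x. \<Sum>i\<in>I. f i x)"
proof (induction I rule: infinite_finite_induct)
  case (insert i I)
  thus ?case using add[of "f i" "\<lambda>x. \<Sum>i\<in>I. f i x"] by simp
qed (simp_all add: const)

lemma prod: "(\<And>i. i \<in> I \<Longrightarrow> Q (f i)) \<Longrightarrow> Q (\<lambda>x. \<Prod>i\<in>I. f i x)"
proof (induction I rule: infinite_finite_induct)
  case (insert i I)
  thus ?case using mult[of "f i" "\<lambda>x. \<Prod>i\<in>I. f i x"] by simp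
qed (simp_all add: const)

lemma power: "Q f \<Longrightarrow> Q (\<lambda>x. f x ^ k)"
  by (induction k) (use const[of 1] mult in auto)

lemma gen_funs_comp:
  assumes "F \<in> gen_funs Y G" and "\<And>x. x \<in> X \<Longrightarrow> \<pi> x \<in> Y" and "\<And>f. f \<in> G \<Longrightarrow> Q (\<lambda>x. f (\<pi> x))"
  shows "Q (\<lambda>x. F (\<pi> x))"
  using assms(1)
proof induction
  case (const c)
  show ?case by (rule cong[OF _ closed(1)[of c]]) (simp add: assms(2))
next
  case (gen f)
  show ?case by (rule cong[OF _ assms(3)[OF gen]]) (simp add: assms(2))
next
  case (add f g)
  show ?case by (rule cong[OF _ closed(2)[OF add.IH]]) (simp add: assms(2))
next
  case (mult f g)
  show ?case by (rule cong[OF _ closed(3)[OF mult.IH]]) (simp add: assms(2))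
qed

definition regmat :: "nat \<Rightarrow> nat \<Rightarrow> ('p \<Rightarrow> complex mat) \<Rightarrow> bool" where
  "regmat r c M \<longleftrightarrow> (\<forall>x\<in>X. M x \<in> carrier_mat r c) \<and> (\<forall>i<r. \<forall>j<c. Q (\<lambda>x. M x $$ (i, j)))"

lemma regmat_carrier: "regmat r c M \<Longrightarrow> x \<in> X \<Longrightarrow> M x \<in> carrier_mat r c"
  by (simp add: regmat_def)

lemma regmat_entry: "regmat r c M \<Longrightarrow> i < r \<Longrightarrow> j < c \<Longrightarrow> Q (\<lambda>x. M x $$ (i, j))"
  by (simp add: regmat_def)

lemma regmatI:
  assumes "\<And>x. x \<in> X \<Longrightarrow> M x \<in> carrier_mat r c"
    and "\<And>i j. i < r \<Longrightarrow> j < c \<Longrightarrow> \<exists>f. Q f \<and> (\<forall>x\<in>X. M x $$ (i, j) = f x)"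
  shows "regmat r c M"
  unfolding regmat_def
proof (intro conjI ballI allI impI)
  fix i j assume "i < r" "j < c"
  then obtain f where f: "Q f" "\<forall>x\<in>X. M x $$ (i, j) = f x" using assms(2) by blast
  show "Q (\<lambda>x. M x $$ (i, j))" by (rule cong[OF _ f(1)]) (simp add: f(2))
qed (fact assms(1))

lemma regmat_cong: "(\<And>x. x \<in> X \<Longrightarrow> M x = N x) \<Longrightarrow> regmat r c M \<Longrightarrow> regmat r c N"
  unfolding regmat_def
proof (intro conjI ballI allI impI)
  assume a: "\<And>x. x \<in> X \<Longrightarrow> M x = N x"
    and M: "(\<forall>x\<in>X. M x \<in> carrier_mat r c) \<and> (\<forall>i<r. \<forall>j<c. Q (\<lambda>x. M x $$ (i, j)))"
  show "N x \<in> carrier_mat r c" if "x \<in> X" for x using a[OF that] M that by metis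
  show "Q (\<lambda>x. N x $$ (i, j))" if "i < r" "j < c" for i j
    by (rule cong[of "\<lambda>x. M x $$ (i, j)"]) (use a M that in auto)
qed

lemma regmat_const: "A \<in> carrier_mat r c \<Longrightarrow> regmat r c (\<lambda>x. A)"
  by (auto simp: regmat_def const)

lemma regmat_mult:
  assumes M: "regmat r m M" and N: "regmat m c N" shows "regmat r c (\<lambda>x. M x * N x)"
proof (rule regmatI)
  fix x assume "x \<in> X"
  thus "M x * N x \<in> carrier_mat r c" using M N by (auto simp: regmat_def)
next
  fix i j assume i: "i < r" "j < c"
  have "Q (\<lambda>x. \<Sum>k<m. M x $$ (i, k) * N x $$ (k, j))"
    using M N i by (intro sum mult) (auto simp: regmat_def)
  moreover have "(M x * N x) $$ (i, j) = (\<Sum>k<m. M x $$ (i, k) * N x $$ (k, j))" if "x \<in> X" for x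
    using regmat_carrier[OF M that] regmat_carrier[OF N that] i by (subst mat_mult_entry) auto
  ultimately show "\<exists>f. Q f \<and> (\<forall>x\<in>X. (M x * N x) $$ (i, j) = f x)" by blast
qed

lemma regmat_map2:
  assumes M: "regmat r c M" and N: "regmat r c N"
    and "\<And>x. x \<in> X \<Longrightarrow> L x \<in> carrier_mat r c"
    and "\<And>f g. Q f \<Longrightarrow> Q g \<Longrightarrow> Q (\<lambda>x. h x (f x) (g x))"
    and "\<And>x i j. x \<in> X \<Longrightarrow> i < r \<Longrightarrow> j < c \<Longrightarrow> L x $$ (i, j) = h x (M x $$ (i, j)) (N x $$ (i, j))"
  shows "regmat r c L"
proof (rule regmatI)
  fix i j assume i: "i < r" "j < c"
  show "\<exists>f. Q f \<and> (\<forall>x\<in>X. L x $$ (i, j) = f x)"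
    using assms(4)[OF regmat_entry[OF M i] regmat_entry[OF N i]] assms(5) i by blast
qed (fact assms(3))

lemma regmat_add: "regmat r c M \<Longrightarrow> regmat r c N \<Longrightarrow> regmat r c (\<lambda>x. M x + N x)"
  by (erule regmat_map2[where h = "\<lambda>x a b. a + b"], assumption) (auto simp: regmat_def add)

lemma regmat_minus: "regmat r c M \<Longrightarrow> regmat r c N \<Longrightarrow> regmat r c (\<lambda>x. M x - N x)"
  by (erule regmat_map2[where h = "\<lambda>x a b. a - b"], assumption) (auto simp: regmat_def diff intro!: minus_carrier_mat)

lemma regmat_uminus: "regmat r c M \<Longrightarrow> regmat r c (\<lambda>x. - M x)"
  by (rule regmat_map2[where h = "\<lambda>x a b. - a" and M = M and N = M]) (auto simp: regmat_def uminus intro!: carrier_matI)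

lemma regmat_smult: "Q f \<Longrightarrow> regmat r c M \<Longrightarrow> regmat r c (\<lambda>x. f x \<cdot>\<^sub>m M x)"
  by (rule regmat_map2[where h = "\<lambda>x a b. f x * a" and M = M and N = M]) (auto simp: regmat_def mult)

lemma regmat_transpose: "regmat r c M \<Longrightarrow> regmat c r (\<lambda>x. transpose_mat (M x))"
  unfolding regmat_def
proof (intro conjI ballI allI impI)
  assume M: "(\<forall>x\<in>X. M x \<in> carrier_mat r c) \<and> (\<forall>i<r. \<forall>j<c. Q (\<lambda>x. M x $$ (i, j)))"
  thus "transpose_mat (M x) \<in> carrier_mat c r" if "x \<in> X" for x using that by simp
  show "Q (\<lambda>x. transpose_mat (M x) $$ (i, j))" if "i < c" "j < r" for i j
    by (rule cong[of "\<lambda>x. M x $$ (j, i)"]) (use M that in auto)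
qed

lemma regmat_pow: "regmat n n M \<Longrightarrow> regmat n n (\<lambda>x. M x ^\<^sub>m k)"
proof (induction k)
  case 0
  show ?case
    by (rule regmat_cong[OF _ regmat_const[OF one_carrier_mat]]) (use 0 in \<open>auto simp: regmat_def\<close>)
next
  case (Suc k)
  thus ?case by (simp add: regmat_mult)
qed

lemma det:
  assumes M: "regmat n n M" shows "Q (\<lambda>x. det (M x))"
proof -
  have "Q (\<lambda>x. \<Sum>p\<in>{p. p permutes {0..<n}}. signof p * (\<Prod>i=0..<n. M x $$ (i, p i)))"
  proof (intro sum mult prod const)
    fix p i assume p: "p \<in> {p. p permutes {0..<n}}" and i: "i \<in> {0..<n}"
    hence "p i < n" using permutes_in_image[of p "{0..<n}" i] by auto
    thus "Q (\<lambda>x. M x $$ (i, p i))" using M i by (intro regmat_entry) auto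
  qed
  thus ?thesis by (rule cong[rotated]) (simp add: det_def'[OF regmat_carrier[OF M]])
qed

lemma regmat_adj:
  assumes M: "regmat n n M" shows "regmat n n (\<lambda>x. adj_mat (M x))"
proof (rule regmatI)
  fix x assume "x \<in> X"
  thus "adj_mat (M x) \<in> carrier_mat n n" using adj_mat(1) regmat_carrier[OF M] by blast
next
  fix i j assume i: "i < n" "j < n"
  have "regmat (n - 1) (n - 1) (\<lambda>x. mat_delete (M x) j i)"
  proof (rule regmatI)
    fix x assume "x \<in> X"
    thus "mat_delete (M x) j i \<in> carrier_mat (n - 1) (n - 1)"
      using regmat_carrier[OF M, of x] by (auto simp: mat_delete_def)
  next
    fix k l assume kl: "k < n - 1" "l < n - 1"
    let ?k = "if k < j then k else Suc k" and ?l = "if l < i then l else Suc l"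
    have "Q (\<lambda>x. M x $$ (?k, ?l))" using kl by (intro regmat_entry[OF M]) auto
    moreover have "mat_delete (M x) j i $$ (k, l) = M x $$ (?k, ?l)" if "x \<in> X" for x
      using regmat_carrier[OF M that] kl by (auto simp: mat_delete_def)
    ultimately show "\<exists>f. Q f \<and> (\<forall>x\<in>X. mat_delete (M x) j i $$ (k, l) = f x)" by blast
  qed
  hence "Q (\<lambda>x. (- 1) ^ (j + i) * det (mat_delete (M x) j i))" by (intro mult const det)
  moreover have "adj_mat (M x) $$ (i, j) = (- 1) ^ (j + i) * det (mat_delete (M x) j i)" if "x \<in> X" for x
    using regmat_carrier[OF M that] i by (auto simp: adj_mat_def cofactor_def)
  ultimately show "\<exists>f. Q f \<and> (\<forall>x\<in>X. adj_mat (M x) $$ (i, j) = f x)" by blast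
qed

lemma regmat_minv:
  assumes M: "regmat n n M" and G: "\<And>x. x \<in> X \<Longrightarrow> M x \<in> GL n" and Qd: "Q (\<lambda>x. inverse (det (M x)))"
  shows "regmat n n (\<lambda>x. minv (M x))"
proof (rule regmat_cong[OF _ regmat_smult[OF Qd regmat_adj[OF M]]])
  fix x assume "x \<in> X"
  from G[OF this] have A: "M x \<in> carrier_mat n n" "det (M x) \<noteq> 0" by (auto simp: GL_iff)
  have "minv (M x) = inverse (det (M x)) \<cdot>\<^sub>m adj_mat (M x)"
  proof (rule GL_I(2))
    have "1 \<cdot>\<^sub>m 1\<^sub>m n = (1\<^sub>m n :: complex mat)" by (rule eq_matI) auto
    thus "M x * (inverse (det (M x)) \<cdot>\<^sub>m adj_mat (M x)) = 1\<^sub>m n"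
      using A adj_mat(1,2)[OF A(1)] by (simp add: mat_mult_smult smult_smult_mat)
  qed (use A adj_mat(1)[OF A(1)] in auto)
  thus "inverse (det (M x)) \<cdot>\<^sub>m adj_mat (M x) = minv (M x)" ..
qed

lemma regmat_poly_mat:
  assumes M: "regmat n n M" and d: "\<And>x. x \<in> X \<Longrightarrow> degree (p x) = n" and c: "\<And>k. Q (\<lambda>x. coeff (p x) k)"
  shows "regmat n n (\<lambda>x. poly_mat (p x) (M x))"
proof (rule regmatI)
  fix x assume "x \<in> X"
  thus "poly_mat (p x) (M x) \<in> carrier_mat n n" using regmat_carrier[OF M] poly_mat_carrier by blast
next
  fix i j assume i: "i < n" "j < n"
  have "Q (\<lambda>x. \<Sum>k\<le>n. coeff (p x) k * (M x ^\<^sub>m k) $$ (i, j))"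
    by (intro sum mult c regmat_entry[OF regmat_pow[OF M]] i)
  moreover have "poly_mat (p x) (M x) $$ (i, j) = (\<Sum>k\<le>n. coeff (p x) k * (M x ^\<^sub>m k) $$ (i, j))" if "x \<in> X" for x
    using poly_mat_entry[OF regmat_carrier[OF M that] i] d[OF that] by simp
  ultimately show "\<exists>f. Q f \<and> (\<forall>x\<in>X. poly_mat (p x) (M x) $$ (i, j) = f x)" by blast
qed

end

lemma gen_funs_restrict: "f \<in> gen_funs X G \<Longrightarrow> restrict f X = f"
  by (induction rule: gen_funs.induct) auto

lemma fun_algebra_gen_funs: "fun_algebra X (\<lambda>f. restrict f X \<in> gen_funs X G)"
proof
  show "restrict (\<lambda>x. c) X \<in> gen_funs X G" for c by (rule gen_funs.const)
next
  fix f g assume fg: "restrict f X \<in> gen_funs X G" "restrict g X \<in> gen_funs X G"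
  have "(\<lambda>x\<in>X. restrict f X x + restrict g X x) = restrict (\<lambda>x. f x + g x) X" by (auto simp: fun_eq_iff)
  thus "restrict (\<lambda>x. f x + g x) X \<in> gen_funs X G" using gen_funs.add[OF fg] by simp
next
  fix f g assume fg: "restrict f X \<in> gen_funs X G" "restrict g X \<in> gen_funs X G"
  have "(\<lambda>x\<in>X. restrict f X x * restrict g X x) = restrict (\<lambda>x. f x * g x) X" by (auto simp: fun_eq_iff)
  thus "restrict (\<lambda>x. f x * g x) X \<in> gen_funs X G" using gen_funs.mult[OF fg] by simp
next
  fix f g :: "'a \<Rightarrow> complex" assume "\<And>x. x \<in> X \<Longrightarrow> f x = g x" "restrict f X \<in> gen_funs X G"
  moreover from this(1) have "restrict f X = restrict g X" by (rule restrict_ext)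
  ultimately show "restrict g X \<in> gen_funs X G" by simp
qed

lemma fun_algebra_poly: "fun_algebra UNIV (\<lambda>f. \<exists>p. \<forall>s. f s = poly p s)"
proof
  show "\<exists>p. \<forall>s. c = poly p s" for c :: complex by (rule exI[of _ "[:c:]"]) simp
next
  fix f g :: "complex \<Rightarrow> complex" assume "\<exists>p. \<forall>s. f s = poly p s" "\<exists>p. \<forall>s. g s = poly p s"
  then obtain p q where "\<forall>s. f s = poly p s" "\<forall>s. g s = poly q s" by blast
  thus "\<exists>p. \<forall>s. f s + g s = poly p s" by (intro exI[of _ "p + q"]) simp
next
  fix f g :: "complex \<Rightarrow> complex" assume "\<exists>p. \<forall>s. f s = poly p s" "\<exists>p. \<forall>s. g s = poly p s"
  then obtain p q where "\<forall>s. f s = poly p s" "\<forall>s. g s = poly q s" by blast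
  thus "\<exists>p. \<forall>s. f s * g s = poly p s" by (intro exI[of _ "p * q"]) simp
qed auto

definition reg_Cot :: "nat \<Rightarrow> (mat4 \<Rightarrow> complex) \<Rightarrow> bool" where
  "reg_Cot n f \<longleftrightarrow> restrict f (Cot n) \<in> carrier (O_Cot n)"

definition reg_Wh :: "nat \<Rightarrow> (mat4 \<Rightarrow> complex) \<Rightarrow> bool" where
  "reg_Wh n f \<longleftrightarrow> restrict f (Wh n) \<in> O_Wh n"

lemma fun_algebra_reg_Cot: "fun_algebra (Cot n) (reg_Cot n)"
  unfolding reg_Cot_def[abs_def] O_Cot_def fun_alg_def partial_object.simps by (rule fun_algebra_gen_funs)

lemma fun_algebra_reg_Wh: "fun_algebra (Wh n) (reg_Wh n)"
  unfolding reg_Wh_def[abs_def] O_Wh_def by (rule fun_algebra_gen_funs)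

lemma O_Cot_reg_Cot: "F \<in> carrier (O_Cot n) \<longleftrightarrow> reg_Cot n F \<and> F \<in> extensional (Cot n)"
proof
  assume "F \<in> carrier (O_Cot n)"
  hence "restrict F (Cot n) = F" unfolding O_Cot_def fun_alg_def by (simp add: gen_funs_restrict)
  thus "reg_Cot n F \<and> F \<in> extensional (Cot n)" using \<open>F \<in> carrier (O_Cot n)\<close>
    by (metis reg_Cot_def restrict_extensional)
qed (metis reg_Cot_def extensional_restrict)

lemma O_Wh_reg_Wh: "F \<in> O_Wh n \<longleftrightarrow> reg_Wh n F \<and> F \<in> extensional (Wh n)"
proof
  assume "F \<in> O_Wh n"
  hence "restrict F (Wh n) = F" unfolding O_Wh_def by (simp add: gen_funs_restrict)
  thus "reg_Wh n F \<and> F \<in> extensional (Wh n)" using \<open>F \<in> O_Wh n\<close>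
    by (metis reg_Wh_def restrict_extensional)
qed (metis reg_Wh_def extensional_restrict)

lemma (in fun_algebra) Cot_comp:
  assumes F: "reg_Cot n F" and a: "regmat n n a" "\<And>x. x \<in> X \<Longrightarrow> a x \<in> GL n" "Q (\<lambda>x. inverse (det (a x)))"
    and y: "regmat n n y" and v: "regmat n 1 v" and u: "regmat 1 n u"
  shows "Q (\<lambda>x. F (a x, y x, v x, u x))"
proof -
  have *: "\<And>x. x \<in> X \<Longrightarrow> (a x, y x, v x, u x) \<in> Cot n"
    using a y v u by (auto simp: Cot_def regmat_def)
  have "Q (\<lambda>x. restrict F (Cot n) (a x, y x, v x, u x))"
    by (rule gen_funs_comp[OF F[unfolded reg_Cot_def O_Cot_def fun_alg_def partial_object.simps] *])
      (auto intro: a regmat_entry[OF a(1)] regmat_entry[OF y] regmat_entry[OF v] regmat_entry[OF u])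
  thus ?thesis by (rule cong[rotated]) (simp add: *)
qed

lemma (in fun_algebra) Wh_comp:
  assumes F: "reg_Wh n F" and g: "regmat n n g" "\<And>x. x \<in> X \<Longrightarrow> g x \<in> GL n" "Q (\<lambda>x. inverse (det (g x)))"
    and h: "regmat n n h" "\<And>x. x \<in> X \<Longrightarrow> h x \<in> GL n" "Q (\<lambda>x. inverse (det (h x)))"
    and a: "regmat n n a" "\<And>x. x \<in> X \<Longrightarrow> a x \<in> companions n"
    and b: "regmat n n b" "\<And>x. x \<in> X \<Longrightarrow> b x \<in> companions n"
  shows "Q (\<lambda>x. F (g x, h x, a x, b x))"
proof -
  have *: "\<And>x. x \<in> X \<Longrightarrow> (g x, h x, a x, b x) \<in> Wh n"
    using g h a b by (auto simp: Wh_def)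
  have "Q (\<lambda>x. restrict F (Wh n) (g x, h x, a x, b x))"
    by (rule gen_funs_comp[OF F[unfolded reg_Wh_def O_Wh_def] *])
      (auto intro: g h regmat_entry[OF g(1)] regmat_entry[OF h(1)] regmat_entry[OF a(1)] regmat_entry[OF b(1)])
  thus ?thesis by (rule cong[rotated]) (simp add: *)
qed

definition pr1 :: "mat4 \<Rightarrow> complex mat" where "pr1 = (\<lambda>(a, b, c, d). a)"
definition pr2 :: "mat4 \<Rightarrow> complex mat" where "pr2 = (\<lambda>(a, b, c, d). b)"
definition pr3 :: "mat4 \<Rightarrow> complex mat" where "pr3 = (\<lambda>(a, b, c, d). c)"
definition pr4 :: "mat4 \<Rightarrow> complex mat" where "pr4 = (\<lambda>(a, b, c, d). d)"

lemma coords: "pr1 (a, b, c, d) = a" "pr2 (a, b, c, d) = b" "pr3 (a, b, c, d) = c" "pr4 (a, b, c, d) = d"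
    "(pr1 x, pr2 x, pr3 x, pr4 x) = x"
  by (simp_all add: pr1_def pr2_def pr3_def pr4_def split_beta)

lemma Cot_carriers: "x \<in> Cot n \<Longrightarrow> pr1 x \<in> carrier_mat n n" "x \<in> Cot n \<Longrightarrow> pr2 x \<in> carrier_mat n n"
    "x \<in> Cot n \<Longrightarrow> pr3 x \<in> carrier_mat n 1" "x \<in> Cot n \<Longrightarrow> pr4 x \<in> carrier_mat 1 n"
  by (auto simp: Cot_def coords GL_carrier)

lemma Cot_coords:
  shows "fun_algebra.regmat (Cot n) (reg_Cot n) n n pr1" "fun_algebra.regmat (Cot n) (reg_Cot n) n n pr2"
    "fun_algebra.regmat (Cot n) (reg_Cot n) n 1 pr3" "fun_algebra.regmat (Cot n) (reg_Cot n) 1 n pr4"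
    "\<And>x. x \<in> Cot n \<Longrightarrow> pr1 x \<in> GL n" "reg_Cot n (\<lambda>x. inverse (det (pr1 x)))"
proof -
  interpret C: fun_algebra "Cot n" "reg_Cot n" by (rule fun_algebra_reg_Cot)
  have gen: "reg_Cot n (\<lambda>x. f (pr1 x) (pr2 x) (pr3 x) (pr4 x))"
    if "(\<lambda>(a, y, v, u). f a y v u) \<in> ((\<Union>i<n. \<Union>j<n. {\<lambda>(a, y, v, u). a $$ (i, j), \<lambda>(a, y, v, u). y $$ (i, j)}) \<union>
      (\<Union>i<n. {\<lambda>(a, y, v, u). v $$ (i, 0), \<lambda>(a, y, v, u). u $$ (0, i)}) \<union>
      {\<lambda>(a, y, v, u). inverse (det a)})" for f
  proof -
    have e: "(\<lambda>(a, y, v, u). f a y v u) = (\<lambda>x. f (pr1 x) (pr2 x) (pr3 x) (pr4 x))"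
      by (auto simp: coords fun_eq_iff)
    show ?thesis using gen_funs.gen[OF that, of "Cot n"] unfolding e
      by (simp add: reg_Cot_def O_Cot_def fun_alg_def)
  qed
  have "reg_Cot n (\<lambda>x. pr1 x $$ (i, j))" "reg_Cot n (\<lambda>x. pr2 x $$ (i, j))" if "i < n" "j < n" for i j
    using gen[of "\<lambda>a y v u. a $$ (i, j)"] gen[of "\<lambda>a y v u. y $$ (i, j)"] that by blast+
  moreover have "reg_Cot n (\<lambda>x. pr3 x $$ (i, 0))" "reg_Cot n (\<lambda>x. pr4 x $$ (0, i))" if "i < n" for i
    using gen[of "\<lambda>a y v u. v $$ (i, 0)"] gen[of "\<lambda>a y v u. u $$ (0, i)"] that by blast+
  ultimately show "C.regmat n n pr1" "C.regmat n n pr2" "C.regmat n 1 pr3" "C.regmat 1 n pr4"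
    by (simp_all add: C.regmat_def Cot_carriers[simplified])
  show "reg_Cot n (\<lambda>x. inverse (det (pr1 x)))" using gen[of "\<lambda>a y v u. inverse (det a)"] by blast
  show "\<And>x. x \<in> Cot n \<Longrightarrow> pr1 x \<in> GL n" by (auto simp: Cot_def coords)
qed

lemma companions_carrier: "a \<in> companions n \<Longrightarrow> a \<in> carrier_mat n n"
  by (auto simp: companions_def companion_carrier)

lemma Wh_carriers: "x \<in> Wh n \<Longrightarrow> pr1 x \<in> carrier_mat n n" "x \<in> Wh n \<Longrightarrow> pr2 x \<in> carrier_mat n n"
    "x \<in> Wh n \<Longrightarrow> pr3 x \<in> carrier_mat n n" "x \<in> Wh n \<Longrightarrow> pr4 x \<in> carrier_mat n n"
  by (auto simp: Wh_def coords GL_carrier companions_carrier)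

lemma Wh_coords:
  shows "fun_algebra.regmat (Wh n) (reg_Wh n) n n pr1" "fun_algebra.regmat (Wh n) (reg_Wh n) n n pr2"
    "fun_algebra.regmat (Wh n) (reg_Wh n) n n pr3" "fun_algebra.regmat (Wh n) (reg_Wh n) n n pr4"
    "\<And>x. x \<in> Wh n \<Longrightarrow> pr1 x \<in> GL n" "\<And>x. x \<in> Wh n \<Longrightarrow> pr2 x \<in> GL n"
    "reg_Wh n (\<lambda>x. inverse (det (pr1 x)))" "reg_Wh n (\<lambda>x. inverse (det (pr2 x)))"
proof -
  interpret W: fun_algebra "Wh n" "reg_Wh n" by (rule fun_algebra_reg_Wh)
  have gen: "reg_Wh n (\<lambda>x. f (pr1 x) (pr2 x) (pr3 x) (pr4 x))"
    if "(\<lambda>(g, h, a, b). f g h a b) \<in> ((\<Union>i<n. \<Union>j<n. {\<lambda>(g, h, a, b). g $$ (i, j), \<lambda>(g, h, a, b). h $$ (i, j),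
                      \<lambda>(g, h, a, b). a $$ (i, j), \<lambda>(g, h, a, b). b $$ (i, j)}) \<union>
      {\<lambda>(g, h, a, b). inverse (det g), \<lambda>(g, h, a, b). inverse (det h)})" for f
  proof -
    have e: "(\<lambda>(a, y, v, u). f a y v u) = (\<lambda>x. f (pr1 x) (pr2 x) (pr3 x) (pr4 x))"
      by (auto simp: coords fun_eq_iff)
    show ?thesis using gen_funs.gen[OF that, of "Wh n"] unfolding e
      by (simp add: reg_Wh_def O_Wh_def)
  qed
  have "reg_Wh n (\<lambda>x. pr1 x $$ (i, j))" "reg_Wh n (\<lambda>x. pr2 x $$ (i, j))"
      "reg_Wh n (\<lambda>x. pr3 x $$ (i, j))" "reg_Wh n (\<lambda>x. pr4 x $$ (i, j))" if "i < n" "j < n" for i j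
    using gen[of "\<lambda>g h a b. g $$ (i, j)"] gen[of "\<lambda>g h a b. h $$ (i, j)"]
      gen[of "\<lambda>g h a b. a $$ (i, j)"] gen[of "\<lambda>g h a b. b $$ (i, j)"] that by blast+
  thus "W.regmat n n pr1" "W.regmat n n pr2" "W.regmat n n pr3" "W.regmat n n pr4"
    by (simp_all add: W.regmat_def Wh_carriers)
  show "reg_Wh n (\<lambda>x. inverse (det (pr1 x)))" "reg_Wh n (\<lambda>x. inverse (det (pr2 x)))"
    using gen[of "\<lambda>g h a b. inverse (det g)"] gen[of "\<lambda>g h a b. inverse (det h)"] by blast+
  show "\<And>x. x \<in> Wh n \<Longrightarrow> pr1 x \<in> GL n" "\<And>x. x \<in> Wh n \<Longrightarrow> pr2 x \<in> GL n" by (auto simp: Wh_def coords)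
qed

section \<open>The map from \<open>Wh\<close> to the cotangent bundle\<close>

text \<open>
  The formula is found from the two symmetries.  Equivariance forces each component to be a function of \<open>(p, q)\<close> between the
  factors coming from \<open>g\<close> and \<open>h\<close>.  With \<open>y\<close> conjugate to \<open>C\<^sub>q\<close>, the matrix \<open>a y a\<^sup>-\<^sup>1\<close> is conjugate to \<open>C\<^sub>q\<^sup>T\<close> through \<open>S\<^sub>q\<close>, and subtracting
  the rank one matrix \<open>v u\<close> turns it into a conjugate of \<open>C\<^sub>p\<^sup>T\<close>.
\<close>

definition phi :: "nat \<Rightarrow> mat4 \<Rightarrow> mat4" where
  "phi n = (\<lambda>(g, h, a, b).
     let p = cpoly n a; q = cpoly n b; G = Jmat n * minv (transpose_mat g) in
     (G * minv (Smat n q) * minv h * Jmat n, Jmat n * h * b * minv h * Jmat n,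
      G * evec n (n - 1), transpose_mat (pvec n p - pvec n q) * transpose_mat g * Jmat n))"

lemma WhE:
  assumes "x \<in> Wh n"
  obtains g h p q where "x = (g, h, companion n p, companion n q)" "g \<in> GL n" "h \<in> GL n"
    "p \<in> monic_polys n" "q \<in> monic_polys n"
  using assms unfolding Wh_def companions_def by blast

lemma phi_eq:
  assumes "p \<in> monic_polys n" "q \<in> monic_polys n"
  shows "phi n (g, h, companion n p, companion n q) =
    (Jmat n * minv (transpose_mat g) * minv (Smat n q) * minv h * Jmat n,
     Jmat n * h * companion n q * minv h * Jmat n,
     Jmat n * minv (transpose_mat g) * evec n (n - 1),
     transpose_mat (pvec n p - pvec n q) * transpose_mat g * Jmat n)"
  using assms by (simp add: phi_def cpoly_companion Let_def)

lemmas mat_dims = GL_dim Jmat_simps(4,5) companion_carrier(2,3) Smat_carrier(2,3) vec_dims(1-4)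

lemmas GL_intros = GL_mult GL_minv GL_transpose Jmat_GL(1)

lemma phi_Cot:
  assumes "x \<in> Wh n" shows "phi n x \<in> Cot n"
proof -
  obtain g h p q where x: "x = (g, h, companion n p, companion n q)" and g: "g \<in> GL n" and h: "h \<in> GL n"
    and p: "p \<in> monic_polys n" and q: "q \<in> monic_polys n" by (rule WhE[OF assms])
  note d = GL_dim[OF g] GL_dim[OF h] GL_dim[OF GL_transpose[OF g]] GL_dim[OF Smat_GL[OF q]]
  show ?thesis unfolding x phi_eq[OF p q] Cot_def
    using g h Smat_GL[OF q] by (auto intro!: GL_intros carrier_matI simp: mat_dims d)
qed

lemma phi_act:
  assumes "\<gamma> \<in> GL n \<times> GL n" "x \<in> Wh n" shows "phi n (Wh_act \<gamma> x) = Cot_act n \<gamma> (phi n x)"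
proof -
  obtain k l where \<gamma>: "\<gamma> = (k, l)" and k: "k \<in> GL n" and l: "l \<in> GL n" using assms(1) by blast
  obtain g h p q where x: "x = (g, h, companion n p, companion n q)" and g: "g \<in> GL n" and h: "h \<in> GL n"
    and p: "p \<in> monic_polys n" and q: "q \<in> monic_polys n" by (rule WhE[OF assms(2)])
  note S = Smat_GL[OF q]
  note G = g h k l S g[THEN GL_transpose] k[THEN GL_transpose]
  note d = G[THEN GL_dim(1)] G[THEN GL_dim(2)] G[THEN GL_dim(3)] G[THEN GL_dim(4)]
  have e: "minv (transpose_mat (k * g)) = minv (transpose_mat k) * minv (transpose_mat g)"
    using G by (simp add: mat_transpose_mult d minv_mult)
  have e2: "minv (l * h) = minv h * minv l" using minv_mult[OF l h] .
  show ?thesis unfolding x \<gamma> Wh_act_def case_prod_conv phi_eq[OF p q] Cot_act_def Let_def e e2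
    by (simp add: mat_assoc d mat_dims Jmat_cancel mat_transpose_mult)
qed

lemma Wh_act_Wh:
  assumes "\<gamma> \<in> GL n \<times> GL n" "x \<in> Wh n" shows "Wh_act \<gamma> x \<in> Wh n"
  using assms by (auto simp: Wh_act_def Wh_def GL_mult)

lemma one_smult_mat: "(1 :: complex) \<cdot>\<^sub>m A = A"
  by (rule eq_matI) auto

text \<open>
  Write \<open>G = J g\<^sup>-\<^sup>T\<close>, so that \<open>phi\<close> is \<open>(G S\<^sub>q\<^sup>-\<^sup>1 h\<^sup>-\<^sup>1 J, J h C\<^sub>q h\<^sup>-\<^sup>1 J, G e\<^sub>n, (p - q)\<^sup>T G\<^sup>-\<^sup>1)\<close>.  The involution \<open>\<tau>\<^sub>\<rho>\<close> replaces \<open>G\<close> by \<open>g X\<close> with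
  \<open>X = q(C\<^sub>p) S\<^sub>p\<close>.  This matrix is symmetric, its last column is \<open>q - p\<close>, and by the antisymmetry of the Bezoutian it
  equals \<open>- S\<^sub>q p(C\<^sub>q\<^sup>T)\<close>, which cancels the factor \<open>p(C\<^sub>q\<^sup>T)\<close> in the second component.  The sign \<open>(-1)\<^sup>n\<close> of \<open>\<tau>\<^sub>\<rho>\<close> and the sign of the
  Bezoutian combine to \<open>(-1)\<^sup>n\<^sup>-\<^sup>1\<close>.
\<close>

lemma phi_tau:
  assumes n: "n > 0" and x: "x \<in> tau_dom n"
  shows "tau_rho n x \<in> Wh n" "phi n (tau_rho n x) = Cot_inv n (phi n x)"
proof -
  have "x \<in> Wh n" using x by (auto simp: tau_dom_def)
  then obtain g h p q where xe: "x = (g, h, companion n p, companion n q)" and g: "g \<in> GL n" and h: "h \<in> GL n"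
    and p: "p \<in> monic_polys n" and q: "q \<in> monic_polys n" by (rule WhE)
  define P where "P = poly_mat p (transpose_mat (companion n q))"
  define R where "R = poly_mat q (transpose_mat (companion n p))"
  define J where "J = Jmat n"
  define c :: complex where "c = (- 1) ^ n"
  have c: "c \<noteq> 0" "inverse c = c" "c * c = 1"
    by (auto simp: c_def power_mult_distrib[symmetric] power_inverse[symmetric])
  have ct: "transpose_mat (companion n p) \<in> carrier_mat n n" "transpose_mat (companion n q) \<in> carrier_mat n n"
    by (simp_all add: companion_carrier)
  have PR: "P \<in> GL n" "R \<in> GL n"
    using x poly_mat_carrier[OF ct(1), of q] poly_mat_carrier[OF ct(2), of p]
    by (simp_all add: xe tau_dom_def P_def R_def cpoly_companion p q GL_def)
  note S = Smat_GL[OF p] Smat_GL[OF q]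
  \<comment> \<open>the Bezoutian of \<open>p\<close> and \<open>q\<close> up to sign, in several guises\<close>
  define X where "X = Smat n p * R"
  have RT: "transpose_mat R = poly_mat q (companion n p)"
    unfolding R_def by (simp add: poly_mat_transpose[OF companion_carrier(1)])
  have X1: "transpose_mat R * Smat n p = X"
    unfolding RT X_def unfolding R_def by (rule poly_mat_Smat[OF p])
  have X2: "X = - (Smat n q * P)"
    unfolding X1[symmetric] RT bezoutian_antisym[OF n p q] P_def poly_mat_Smat[OF q] ..
  have XGL: "X \<in> GL n" unfolding X_def using S PR by (simp add: GL_mult)
  have Xe: "X * evec n (n - 1) = pvec n q - pvec n p"
    unfolding X1[symmetric] RT
    using poly_mat_carrier[OF companion_carrier(1), of q n p]
    by (simp add: mat_assoc mat_dims Smat_last_evec[OF n p, simplified] poly_mat_companion_evec[OF n p q])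
  have Xsym: "transpose_mat X = X" unfolding X1[symmetric] RT by (rule poly_mat_Smat_sym[OF p])
  have JG: "J \<in> GL n" "minv J = J" "transpose_mat J = J" by (simp_all add: J_def Jmat_GL Jmat_simps)
  note G0 = g h PR S XGL JG(1)
  note G = G0 G0[THEN GL_transpose]
  note d = G[THEN GL_dim(1)] G[THEN GL_dim(2)] G[THEN GL_dim(3)] G[THEN GL_dim(4)]
  note dd = d mat_dims(5-)
  note can = GL_cancel[OF g] GL_cancel[OF h] GL_cancel[OF PR(1)] GL_cancel[OF PR(2)] GL_cancel[OF S(1)]
    GL_cancel[OF S(2)] GL_cancel[OF XGL]
    GL_cancel[OF g[THEN GL_transpose]] GL_cancel[OF h[THEN GL_transpose]]
  have JJ: "J * (J * C) = C" if "dim_row C = n" for C using that by (simp add: J_def Jmat_cancel)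
  have JJ1: "J * J = 1\<^sub>m n" by (simp add: J_def Jmat_simps)
  define g' where "g' = J * minv (transpose_mat g) * minv R * minv (Smat n p)"
  define h' where "h' = c \<cdot>\<^sub>m (J * minv (transpose_mat h) * P * minv (Smat n q))"
  have tau: "tau_rho n x = (g', h', companion n p, companion n q)"
    by (simp add: xe tau_rho_def Let_def cpoly_companion p q g'_def h'_def P_def R_def c_def J_def)
  have gGL: "g' \<in> GL n" and hGL: "h' \<in> GL n"
    unfolding g'_def h'_def using G0 c by (auto intro!: GL_intros GL_smult)
  show "tau_rho n x \<in> Wh n" unfolding tau Wh_def companions_def using gGL hGL p q by blast
  have a: "transpose_mat (minv (Smat n p)) = minv (Smat n p)" "transpose_mat (minv R) = minv (transpose_mat R)"
      "transpose_mat (minv (transpose_mat g)) = minv g" "transpose_mat (minv h) = minv (transpose_mat h)"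
      "transpose_mat (minv (Smat n q)) = minv (Smat n q)"
    using minv_transpose[OF S(1)] minv_transpose[OF S(2)] minv_transpose[OF PR(2)] minv_transpose[OF g]
      minv_transpose[OF h] by (simp_all add: Smat_sym)
  have "minv X = minv (Smat n p) * minv (transpose_mat R)"
    unfolding X1[symmetric] by (rule minv_mult[OF GL_transpose[OF PR(2)] S(1)])
  hence g'T: "transpose_mat g' = minv X * minv g * J"
    unfolding g'_def by (simp add: mat_transpose_mult dd a JG mat_assoc)
  have "minv (transpose_mat g') = J * g * X"
    unfolding g'T using G0 by (simp add: minv_mult[of _ n] minv_minv[of _ n] GL_intros JG mat_assoc dd)
  hence G': "J * minv (transpose_mat g') = g * X" by (simp add: mat_assoc dd JJ)
  have h'i: "minv h' = c \<cdot>\<^sub>m (Smat n q * minv P * transpose_mat h * J)"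
    unfolding h'_def using G0 c
    by (simp add: minv_smult[of _ n] minv_mult[of _ n] minv_minv[of _ n] GL_intros JG mat_assoc dd)
  have XP: "X * (minv P * C) = - (Smat n q * C)" if "dim_row C = n" for C
    unfolding X2 using that by (simp add: mat_mult_uminus mat_assoc dd can)
  have sgn: "(- 1) ^ (n - 1) = - c" using n by (cases n) (auto simp: c_def)
  have 1: "g * X * minv (Smat n q) * minv h' * J =
      (- 1) ^ (n - 1) \<cdot>\<^sub>m (J * minv (transpose_mat (J * minv (transpose_mat g) * minv (Smat n q) * minv h * J)) * J)"
  proof -
    have "transpose_mat (J * minv (transpose_mat g) * minv (Smat n q) * minv h * J) =
        J * minv (transpose_mat h) * minv (Smat n q) * minv g * J"
      by (simp add: mat_transpose_mult dd a JG mat_assoc)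
    also have "minv \<dots> = J * g * Smat n q * transpose_mat h * J"
      using G by (simp add: minv_mult[of _ n] minv_minv[of _ n] GL_intros JG mat_assoc dd)
    finally have "J * minv (transpose_mat (J * minv (transpose_mat g) * minv (Smat n q) * minv h * J)) * J =
        g * Smat n q * transpose_mat h" using GL_carrier[OF GL_transpose[OF h]]
      by (simp add: mat_assoc dd JJ JJ1)
    moreover have "g * X * minv (Smat n q) * minv h' * J = c \<cdot>\<^sub>m (- (g * Smat n q * transpose_mat h))"
      unfolding h'i using GL_carrier[OF GL_transpose[OF h]]
      by (simp add: mat_assoc dd JJ1 mat_mult_smult can XP mat_mult_uminus)
    moreover have "c \<cdot>\<^sub>m (- M) = (- c) \<cdot>\<^sub>m M" for M by (rule eq_matI) auto
    ultimately show ?thesis unfolding sgn by simp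
  qed
  have PC: "P * (transpose_mat (companion n q) * C) = transpose_mat (companion n q) * (P * C)"
    if "dim_row C = n" for C
    using poly_mat_intertwine[OF ct(2) ct(2) ct(2) refl, of p] that
    by (simp add: P_def[symmetric] mat_assoc[symmetric] dd)
  have SC: "minv (Smat n q) * (companion n q * (Smat n q * C)) = transpose_mat (companion n q) * C"
    if "dim_row C = n" for C
  proof -
    have "companion n q * (Smat n q * C) = Smat n q * (transpose_mat (companion n q) * C)"
      using companion_Smat[OF q] that by (simp add: mat_assoc[symmetric] dd)
    thus ?thesis using that by (simp add: can dd)
  qed
  have 2: "J * h' * companion n q * minv h' * J = J * transpose_mat (J * h * companion n q * minv h * J) * J"
  proof -
    have "J * h' * companion n q * minv h' * J = minv (transpose_mat h) * transpose_mat (companion n q) * transpose_mat h"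
      unfolding h'i unfolding h'_def using GL_carrier[OF GL_transpose[OF h]] c
      by (simp add: mat_assoc dd JJ JJ1 mat_mult_smult can SC PC smult_smult_mat one_smult_mat)
    also have "\<dots> = J * transpose_mat (J * h * companion n q * minv h * J) * J"
      using GL_carrier[OF GL_transpose[OF h]] by (simp add: mat_transpose_mult dd a JG mat_assoc JJ JJ1)
    finally show ?thesis .
  qed
  have neg: "pvec n q - pvec n p = - (pvec n p - pvec n q)" by (rule eq_matI) (auto simp: pvec_def)
  have 3: "g * X * evec n (n - 1) = - (J * transpose_mat (transpose_mat (pvec n p - pvec n q) * transpose_mat g * J))"
  proof -
    have "g * X * evec n (n - 1) = g * (X * evec n (n - 1))" by (rule mat_assoc) (simp_all add: dd vec_dims)
    also have "\<dots> = - (g * (pvec n p - pvec n q))" unfolding Xe neg by (rule mat_mult_uminus(2)) (simp add: dd vec_dims)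
    finally show ?thesis by (simp add: mat_transpose_mult dd JG JJ mat_assoc vec_dims)
  qed
  have 4: "transpose_mat (pvec n p - pvec n q) * transpose_mat g' * J =
      - (transpose_mat (J * minv (transpose_mat g) * evec n (n - 1)) * J)"
  proof -
    have "transpose_mat (X * evec n (n - 1)) = transpose_mat (evec n (n - 1)) * X"
      by (simp only: mat_transpose_mult dd vec_dims Xsym)
    hence "transpose_mat (- (pvec n p - pvec n q)) = transpose_mat (evec n (n - 1)) * X" unfolding Xe neg .
    hence "- (- transpose_mat (pvec n p - pvec n q)) = - (transpose_mat (evec n (n - 1)) * X)"
      by (simp only: transpose_uminus)
    hence "transpose_mat (pvec n p - pvec n q) = - (transpose_mat (evec n (n - 1)) * X)" by simp
    hence "transpose_mat (pvec n p - pvec n q) * transpose_mat g' * J = - (transpose_mat (evec n (n - 1)) * minv g)"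
      unfolding g'T using minv(1)[OF g] by (simp add: mat_mult_uminus mat_assoc dd vec_dims can JJ1)
    thus ?thesis using minv(1)[OF g] by (simp add: mat_transpose_mult dd vec_dims a JG mat_assoc JJ1)
  qed
  show "phi n (tau_rho n x) = Cot_inv n (phi n x)"
    unfolding tau unfolding xe phi_eq[OF p q] Cot_inv_def Let_def case_prod_conv J_def[symmetric] G' 1 2 3 4 ..
qed

lemma Cot_inv_Cot:
  assumes "z \<in> Cot n" shows "Cot_inv n z \<in> Cot n"
proof -
  obtain a y v u where z: "z = (a, y, v, u)" and a: "a \<in> GL n" and y: "y \<in> carrier_mat n n"
    and v: "v \<in> carrier_mat n 1" and u: "u \<in> carrier_mat 1 n" using assms by (auto simp: Cot_def)
  note d = GL_dim[OF a[THEN GL_transpose]] carrier_matD[OF y] carrier_matD[OF v] carrier_matD[OF u]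
  show ?thesis unfolding z Cot_inv_def Cot_def Let_def case_prod_conv
    using a by (auto intro!: GL_intros GL_smult carrier_matI simp: d mat_dims)
qed

lemma Cot_inv_invol:
  assumes "z \<in> Cot n" shows "Cot_inv n (Cot_inv n z) = z"
proof -
  obtain a y v u where z: "z = (a, y, v, u)" and a: "a \<in> GL n" and y: "y \<in> carrier_mat n n"
    and v: "v \<in> carrier_mat n 1" and u: "u \<in> carrier_mat 1 n" using assms by (auto simp: Cot_def)
  define c :: complex where "c = (- 1) ^ (n - 1)"
  have c: "c \<noteq> 0" "c * inverse c = 1" by (auto simp: c_def)
  let ?J = "Jmat n"
  note G = a a[THEN GL_transpose]
  note d = G[THEN GL_dim(1)] G[THEN GL_dim(2)] G[THEN GL_dim(3)] G[THEN GL_dim(4)]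
    carrier_matD[OF y] carrier_matD[OF v] carrier_matD[OF u] Jmat_simps(4,5)
  have m: "M \<in> GL n \<Longrightarrow> minv (c \<cdot>\<^sub>m M) = inverse c \<cdot>\<^sub>m minv M" for M using minv_smult c(1) by blast
  have tr: "transpose_mat (c \<cdot>\<^sub>m M) = c \<cdot>\<^sub>m transpose_mat M" for M :: "complex mat" by (rule eq_matI) auto
  have 1: "c \<cdot>\<^sub>m (?J * minv (transpose_mat (c \<cdot>\<^sub>m (?J * minv (transpose_mat a) * ?J))) * ?J) = a"
  proof -
    have "transpose_mat (?J * minv (transpose_mat a) * ?J) = ?J * minv a * ?J"
      using a by (simp add: mat_transpose_mult d Jmat_simps minv_transpose mat_assoc)
    hence "minv (transpose_mat (c \<cdot>\<^sub>m (?J * minv (transpose_mat a) * ?J))) = inverse c \<cdot>\<^sub>m minv (?J * minv a * ?J)"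
      using a by (simp add: tr m GL_intros)
    also have "minv (?J * minv a * ?J) = ?J * a * ?J"
      using a by (simp add: minv_mult[of _ n] GL_intros Jmat_GL(2) minv_minv[of _ n] d mat_assoc)
    finally have e: "minv (transpose_mat (c \<cdot>\<^sub>m (?J * minv (transpose_mat a) * ?J))) = inverse c \<cdot>\<^sub>m (?J * a * ?J)" .
    have "?J * (inverse c \<cdot>\<^sub>m (?J * a * ?J)) * ?J = inverse c \<cdot>\<^sub>m a"
      using GL_carrier[OF a] by (simp add: mat_mult_smult d mat_assoc Jmat_cancel Jmat_simps(3))
    thus ?thesis unfolding e using c(2) by (simp add: smult_smult_mat) (rule eq_matI, auto)
  qed
  have 2: "?J * transpose_mat (?J * transpose_mat y * ?J) * ?J = y"
    using y by (simp add: mat_transpose_mult d Jmat_simps mat_assoc Jmat_cancel)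
  have 3: "- (?J * transpose_mat (- (transpose_mat v * ?J))) = v"
    by (simp add: transpose_uminus mat_transpose_mult d Jmat_simps mat_mult_uminus Jmat_cancel)
  have 4: "- (transpose_mat (- (?J * transpose_mat u)) * ?J) = u"
    using u by (simp add: transpose_uminus mat_transpose_mult d Jmat_simps mat_mult_uminus mat_assoc)
  show ?thesis unfolding z Cot_inv_def Let_def case_prod_conv c_def[symmetric] 1 2 3 4 ..
qed


section \<open>Cyclic vectors and the image of the map\<close>

definition Krylov :: "nat \<Rightarrow> complex mat \<Rightarrow> complex mat \<Rightarrow> complex mat" where
  "Krylov n y v = mat n n (\<lambda>(i, k). (y ^\<^sub>m k * v) $$ (i, 0))"

lemma Krylov_carrier: "Krylov n y v \<in> carrier_mat n n"
  by (simp add: Krylov_def)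

lemma Krylov_evec:
  assumes "y \<in> carrier_mat n n" "v \<in> carrier_mat n 1" "k < n"
  shows "Krylov n y v * evec n k = y ^\<^sub>m k * v"
proof (rule col_eqI[of _ n])
  fix i assume "i < n"
  thus "(Krylov n y v * evec n k) $$ (i, 0) = (y ^\<^sub>m k * v) $$ (i, 0)"
    using assms by (subst mult_evec_entry) (auto simp: Krylov_def)
qed (use assms pow_carrier_mat[OF assms(1), of k] in \<open>auto simp: Krylov_def vec_dims\<close>)

text \<open>
  Passing from \<open>y\<close> to \<open>a y a\<^sup>-\<^sup>1\<close> undoes the left-invariant trivialization; the result acts on the copy of \<open>\<complex>\<^sup>n\<close> that
  contains \<open>v\<close>.  So \<open>cyc\<close> vanishes precisely when \<open>v\<close> is not a cyclic vector.
\<close>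

definition Kmat :: "nat \<Rightarrow> mat4 \<Rightarrow> complex mat" where
  "Kmat n z = Krylov n (pr1 z * pr2 z * minv (pr1 z)) (pr3 z)"

definition cyc :: "nat \<Rightarrow> mat4 \<Rightarrow> complex" where
  "cyc n z = det (Kmat n z)"

text \<open>
  On the image of \<open>phi\<close> the pair \<open>(a y a\<^sup>-\<^sup>1, v)\<close> is conjugate to \<open>(C\<^sub>q\<^sup>T, e\<^sub>n)\<close>, hence through \<open>S\<^sub>q\<close> to \<open>(C\<^sub>q, e\<^sub>1)\<close>, whose iterates are
  the standard basis.  This shows that \<open>cyc\<close> has no zeros on the image.
\<close>

lemma Kmat_phi:
  assumes n: "n > 0" and g: "g \<in> GL n" and h: "h \<in> GL n" and p: "p \<in> monic_polys n" and q: "q \<in> monic_polys n"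
  defines "G \<equiv> Jmat n * minv (transpose_mat g)" and "z \<equiv> phi n (g, h, companion n p, companion n q)"
  shows "pr1 z * pr2 z * minv (pr1 z) = G * transpose_mat (companion n q) * minv G"
    and "Kmat n z = G * minv (Smat n q)"
proof -
  let ?C = "companion n q" and ?S = "Smat n q"
  note S = Smat_GL[OF q]
  have GG: "G \<in> GL n" unfolding G_def using g by (intro GL_intros)
  note G = GG h S Jmat_GL(1)[of n]
  note d = G[THEN GL_dim(1)] G[THEN GL_dim(2)] G[THEN GL_dim(3)] G[THEN GL_dim(4)] mat_dims(5-)
  note can = GL_cancel[OF GG] GL_cancel[OF h] GL_cancel[OF S] Jmat_cancel Jmat_simps(3)
  have z: "pr1 z = G * minv ?S * minv h * Jmat n" "pr2 z = Jmat n * h * ?C * minv h * Jmat n"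
    "pr3 z = G * evec n (n - 1)"
    unfolding z_def phi_eq[OF p q] coords G_def by simp_all
  have mi: "minv (pr1 z) = Jmat n * h * ?S * minv G"
    unfolding z using G by (simp add: minv_mult[of _ n] minv_minv[of _ n] GL_intros Jmat_GL(2) mat_assoc d)
  have SC: "minv ?S * (?C * (?S * W)) = transpose_mat ?C * W" if "dim_row W = n" for W
  proof -
    have "?C * (?S * W) = ?S * (transpose_mat ?C * W)"
      using companion_Smat[OF q] that by (simp add: mat_assoc[symmetric] d)
    thus ?thesis using that by (simp add: can d)
  qed
  show Y: "pr1 z * pr2 z * minv (pr1 z) = G * transpose_mat ?C * minv G"
    unfolding mi unfolding z by (simp add: mat_assoc d can SC)
  have Yc: "G * transpose_mat ?C * minv G \<in> carrier_mat n n" by (auto simp: d)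
  have vc: "G * evec n (n - 1) \<in> carrier_mat n 1" by (auto simp: d vec_dims)
  show "Kmat n z = G * minv ?S"
  proof (rule mat_eq_columns)
    show "Kmat n z \<in> carrier_mat n n" by (simp add: Kmat_def Krylov_carrier)
    show "G * minv ?S \<in> carrier_mat n n" by (auto simp: d)
    fix k assume k: "k < n"
    have cT: "transpose_mat ?C \<in> carrier_mat n n" by (simp add: companion_carrier)
    have d1: "dim_row (transpose_mat ?C ^\<^sub>m k) = n" "dim_col (transpose_mat ?C ^\<^sub>m k) = n"
      "dim_row (?C ^\<^sub>m k) = n" "dim_col (?C ^\<^sub>m k) = n"
      "dim_row ((G * transpose_mat ?C * minv G) ^\<^sub>m k) = n" "dim_col ((G * transpose_mat ?C * minv G) ^\<^sub>m k) = n"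
      using pow_carrier_mat[OF cT, of k] pow_carrier_mat[OF companion_carrier(1), of n q k]
        pow_carrier_mat[OF Yc, of k] by auto
    have i1: "(G * transpose_mat ?C * minv G) ^\<^sub>m k * G = G * transpose_mat ?C ^\<^sub>m k"
    proof (rule pow_mat_intertwine[OF Yc cT GL_carrier[OF GG]])
      show "G * transpose_mat ?C * minv G * G = G * transpose_mat ?C"
        using minv(3)[OF GG] cT by (simp add: mat_assoc d)
    qed
    have i2: "transpose_mat ?C ^\<^sub>m k * minv ?S = minv ?S * ?C ^\<^sub>m k"
    proof (rule pow_mat_intertwine[OF cT companion_carrier(1) minv(1)[OF S]])
      have "transpose_mat ?C * minv ?S = minv ?S * (?C * (?S * minv ?S))"
        by (rule SC[symmetric]) (simp add: d)
      also have "\<dots> = minv ?S * ?C" using minv(2)[OF S] companion_carrier(1)[of n q] by simp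
      finally show "transpose_mat ?C * minv ?S = minv ?S * ?C" .
    qed
    have e: "evec n (n - 1) = minv ?S * evec n 0"
      using Smat_last_evec[OF n q] by (metis GL_cancel(2)[OF S] vec_dims(1))
    have "Kmat n z * evec n k = (G * transpose_mat ?C * minv G) ^\<^sub>m k * (G * evec n (n - 1))"
      unfolding Kmat_def Y z(3) by (rule Krylov_evec[OF Yc vc k])
    also have "\<dots> = (G * transpose_mat ?C * minv G) ^\<^sub>m k * G * evec n (n - 1)"
      by (simp add: mat_assoc d d1 vec_dims)
    also have "\<dots> = G * (transpose_mat ?C ^\<^sub>m k * minv ?S * evec n 0)"
      unfolding i1 e by (simp add: mat_assoc d d1 vec_dims)
    also have "\<dots> = G * (minv ?S * (?C ^\<^sub>m k * evec n 0))"
      unfolding i2 by (simp add: mat_assoc d d1 vec_dims)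
    also have "\<dots> = G * minv ?S * evec n k"
      unfolding companion_pow_evec[OF k] by (simp add: mat_assoc d vec_dims)
    finally show "Kmat n z * evec n k = G * minv ?S * evec n k" .
  qed
qed

lemma Kmat_phi_GL: "n > 0 \<Longrightarrow> x \<in> Wh n \<Longrightarrow> Kmat n (phi n x) \<in> GL n"
  by (erule WhE) (auto simp: Kmat_phi(2) Smat_GL intro!: GL_intros)

lemma cyc_phi: "n > 0 \<Longrightarrow> x \<in> Wh n \<Longrightarrow> cyc n (phi n x) \<noteq> 0"
  using Kmat_phi_GL[of n x] by (simp add: cyc_def GL_iff)

lemma monic_poly_exists: "\<exists>p\<in>monic_polys n. \<forall>i<n. coeff p i = c i"
proof
  let ?p = "Abs_poly (\<lambda>i. if i < n then c i else if i = n then 1 else 0)"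
  have c: "coeff ?p i = (if i < n then c i else if i = n then 1 else 0)" for i
    by (subst Abs_poly_inverse) (auto simp: MOST_nat intro!: exI[of _ n])
  show "\<forall>i<n. coeff ?p i = c i" using c by simp
  have "degree ?p = n" using c by (intro antisym degree_le le_degree) auto
  thus "?p \<in> monic_polys n" using c[of n] by (simp add: monic_polys_def)
qed

text \<open>If \<open>v\<close> is cyclic for \<open>a y a\<^sup>-\<^sup>1\<close> then in the basis of its iterates \<open>a y a\<^sup>-\<^sup>1\<close> becomes a companion matrix;
  this determines the preimage.\<close>

lemma phi_surj:
  assumes n: "n > 0" and z: "z \<in> Cot n" and cyc: "cyc n z \<noteq> 0"
  obtains x where "x \<in> Wh n" "phi n x = z"
proof -
  obtain a y v u where ze: "z = (a, y, v, u)" and a: "a \<in> GL n" and y: "y \<in> carrier_mat n n"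
    and v: "v \<in> carrier_mat n 1" and u: "u \<in> carrier_mat 1 n" using z by (auto simp: Cot_def)
  define J where "J = Jmat n"
  define Y where "Y = a * y * minv a"
  define K where "K = Krylov n Y v"
  have J: "J \<in> GL n" "minv J = J" "transpose_mat J = J" by (simp_all add: J_def Jmat_GL Jmat_simps)
  have K: "K \<in> GL n"
    using cyc Krylov_carrier by (auto simp: cyc_def Kmat_def ze coords GL_iff K_def Y_def)
  note yd = carrier_matD[OF y] carrier_matD[OF v] carrier_matD[OF u]
  have Yc: "Y \<in> carrier_mat n n" using a by (auto simp: Y_def GL_dim yd)
  obtain q where q: "q \<in> monic_polys n" and qc: "\<And>i. i < n \<Longrightarrow> coeff q i = - (minv K * Y * K) $$ (i, n - 1)"
    using monic_poly_exists[of n "\<lambda>i. - (minv K * Y * K) $$ (i, n - 1)"] by blast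
  have C: "minv K * Y * K = companion n q"
  proof (rule mat_eq_columns)
    show Cc: "minv K * Y * K \<in> carrier_mat n n" "companion n q \<in> carrier_mat n n"
      using K Yc by (auto simp: GL_dim companion_carrier)
    fix k assume k: "k < n"
    show "minv K * Y * K * evec n k = companion n q * evec n k"
    proof (cases "k + 1 < n")
      case True
      have "dim_row (Y ^\<^sub>m k) = n" "dim_col (Y ^\<^sub>m k) = n" using pow_carrier_mat[OF Yc, of k] by auto
      moreover have "Y ^\<^sub>m (k + 1) = Y * Y ^\<^sub>m k" using pow_mat_intertwine[OF Yc Yc Yc refl, of k] by simp
      moreover have "minv K * Y * K * evec n k = minv K * Y * (K * evec n k)"
        using K Yc by (intro mat_assoc) (auto simp: GL_dim vec_dims)
      ultimately have "minv K * Y * K * evec n k = minv K * (K * evec n (k + 1))"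
        unfolding K_def using Krylov_evec[OF Yc v True] Krylov_evec[OF Yc v k] Yc K[unfolded K_def]
        by (simp add: GL_dim mat_assoc yd del: pow_mat.simps)
      also have "\<dots> = evec n (k + 1)" by (rule GL_cancel[OF K]) (simp add: vec_dims)
      finally show ?thesis using companion_evec[OF True] by simp
    next
      case False
      hence k1: "k = n - 1" using k by simp
      show ?thesis
      proof (rule col_eqI[of _ n])
        fix i assume i: "i < n"
        show "(minv K * Y * K * evec n k) $$ (i, 0) = (companion n q * evec n k) $$ (i, 0)"
          using i k Cc qc[OF i] k1 by (subst (1 2) mult_evec_entry) (auto simp: companion_def)
      qed (use Cc in \<open>auto simp: vec_dims\<close>)
    qed
  qed
  note S = Smat_GL[OF q]
  \<comment> \<open>the matrix that is \<open>J g\<^sup>-\<^sup>T\<close> for the preimage, by the formula for the Krylov matrix of an image point\<close>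
  define G where "G = K * Smat n q"
  have G: "G \<in> GL n" unfolding G_def using K S by (rule GL_mult)
  define g where "g = J * transpose_mat (minv G)"
  define h where "h = J * minv a * K"
  have gh: "g \<in> GL n" "h \<in> GL n" unfolding g_def h_def using G J(1) a K by (auto intro!: GL_intros)
  obtain p where p: "p \<in> monic_polys n" and pc: "\<And>i. i < n \<Longrightarrow> coeff p i = coeff q i + (u * G) $$ (0, i)"
    using monic_poly_exists[of n "\<lambda>i. coeff q i + (u * G) $$ (0, i)"] by blast
  note GG = G J(1) a K S gh GL_transpose[OF G] GL_minv[OF a] GL_minv[OF K]
  note d = GG[THEN GL_dim(1)] GG[THEN GL_dim(2)] GG[THEN GL_dim(3)] GG[THEN GL_dim(4)] yd mat_dims(5-)
  note can = GL_cancel[OF G] GL_cancel[OF a] GL_cancel[OF K] GL_cancel[OF S]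
  have JJ: "J * (J * W) = W" if "dim_row W = n" for W using that by (simp add: J_def Jmat_cancel)
  have JJ1: "J * J = 1\<^sub>m n" by (simp add: J_def Jmat_simps)
  have gT: "transpose_mat g = minv G * J" unfolding g_def by (simp add: mat_transpose_mult d J)
  have "minv (transpose_mat g) = J * G" unfolding gT using G J
    by (simp add: minv_mult[of _ n] minv_minv[of _ n] GL_intros)
  hence Ge: "J * minv (transpose_mat g) = G" by (simp add: JJ d)
  have hi: "minv h = minv K * a * J" unfolding h_def using a K J
    by (simp add: minv_mult[of _ n] minv_minv[of _ n] GL_intros mat_assoc d)
  have 1: "G * minv (Smat n q) * minv h * J = a"
    unfolding hi G_def using GL_carrier[OF a] by (simp add: mat_assoc d can JJ1)
  have 2: "J * h * companion n q * minv h * J = y"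
    unfolding hi C[symmetric] unfolding h_def Y_def using y minv(3)[OF a]
    by (simp add: mat_assoc d can JJ JJ1)
  have 3: "G * evec n (n - 1) = v"
  proof -
    have "G * evec n (n - 1) = K * evec n 0"
      unfolding G_def by (simp add: mat_assoc d vec_dims Smat_last_evec[OF n q, simplified])
    also have "\<dots> = v" unfolding K_def using Krylov_evec[OF Yc v, of 0] n v Yc by simp
    finally show ?thesis .
  qed
  have 4: "transpose_mat (pvec n p - pvec n q) * transpose_mat g * J = u"
  proof -
    have "transpose_mat (pvec n p - pvec n q) = u * G"
      by (rule eq_matI) (auto simp: pvec_def pc d simp del: index_mult_mat(1))
    thus ?thesis unfolding gT using minv(2)[OF G] u by (simp add: mat_assoc d JJ1 can)
  qed
  have "phi n (g, h, companion n p, companion n q) = z"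
    unfolding phi_eq[OF p q] J_def[symmetric] Ge 1 2 3 4 ze ..
  moreover have "(g, h, companion n p, companion n q) \<in> Wh n"
    using gh p q by (auto simp: Wh_def companions_def)
  ultimately show ?thesis using that by blast
qed

section \<open>Regularity of the maps\<close>

lemma cpoly_monic: "a \<in> companions n \<Longrightarrow> cpoly n a \<in> monic_polys n" "a \<in> companions n \<Longrightarrow> companion n (cpoly n a) = a"
  by (auto simp: companions_def cpoly_companion)

context fun_algebra
begin

lemma cpoly_coeff:
  assumes A: "regmat n n A" and c: "\<And>x. x \<in> X \<Longrightarrow> A x \<in> companions n"
  shows "Q (\<lambda>x. coeff (cpoly n (A x)) k)"
proof -
  consider "k < n" | "k = n" | "k > n" by linarith
  thus ?thesis
  proof cases
    case 1
    have "Q (\<lambda>x. - A x $$ (k, n - 1))" using 1 by (intro uminus regmat_entry[OF A]) auto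
    thus ?thesis
    proof (rule cong[rotated])
      fix x assume "x \<in> X"
      from cpoly_monic(2)[OF c[OF this]] have "A x $$ (k, n - 1) = companion n (cpoly n (A x)) $$ (k, n - 1)" by simp
      thus "- A x $$ (k, n - 1) = coeff (cpoly n (A x)) k" using 1 by (simp add: companion_def)
    qed
  next
    case 2
    show ?thesis by (rule cong[OF _ const[of 1]]) (use 2 monic_coeff(1)[OF cpoly_monic(1)[OF c]] in simp)
  next
    case 3
    show ?thesis by (rule cong[OF _ const[of 0]]) (use 3 monic_coeff(2)[OF cpoly_monic(1)[OF c]] in simp)
  qed
qed

lemma regmat_Smat:
  assumes A: "regmat n n A" and c: "\<And>x. x \<in> X \<Longrightarrow> A x \<in> companions n"
  shows "regmat n n (\<lambda>x. Smat n (cpoly n (A x)))" "regmat n n (\<lambda>x. minv (Smat n (cpoly n (A x))))"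
proof -
  show S: "regmat n n (\<lambda>x. Smat n (cpoly n (A x)))"
  proof (rule regmatI)
    fix i j assume "i < n" "j < n"
    thus "\<exists>f. Q f \<and> (\<forall>x\<in>X. Smat n (cpoly n (A x)) $$ (i, j) = f x)"
      using cpoly_coeff[OF A c, of "i + j + 1"] by (auto simp: Smat_def)
  qed (simp add: Smat_carrier)
  show "regmat n n (\<lambda>x. minv (Smat n (cpoly n (A x))))"
  proof (rule regmat_minv[OF S])
    fix x assume "x \<in> X"
    thus "Smat n (cpoly n (A x)) \<in> GL n" using Smat_GL cpoly_monic(1) c by blast
  next
    show "Q (\<lambda>x. inverse (det (Smat n (cpoly n (A x)))))"
      by (rule cong[OF _ const[of "det (Jmat n)"]])
        (rule inverse_unique[symmetric, OF det_Smat[OF cpoly_monic(1)[OF c]]])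
  qed
qed

lemma Cot_comp':
  assumes "reg_Cot n F" "\<And>x. x \<in> X \<Longrightarrow> \<pi> x \<in> Cot n"
    and "regmat n n (\<lambda>x. pr1 (\<pi> x))" "Q (\<lambda>x. inverse (det (pr1 (\<pi> x))))" "regmat n n (\<lambda>x. pr2 (\<pi> x))"
      "regmat n 1 (\<lambda>x. pr3 (\<pi> x))" "regmat 1 n (\<lambda>x. pr4 (\<pi> x))"
  shows "Q (\<lambda>x. F (\<pi> x))"
  using Cot_comp[OF assms(1,3) _ assms(4-7)] Cot_coords(5)[OF assms(2)] by (simp add: coords)

lemma regmat_Krylov:
  assumes y: "regmat n n y" and v: "regmat n 1 v" shows "regmat n n (\<lambda>x. Krylov n (y x) (v x))"
proof (rule regmatI)
  fix i j assume i: "i < n" "j < n"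
  have "Q (\<lambda>x. (y x ^\<^sub>m j * v x) $$ (i, 0))"
    using i by (intro regmat_entry[OF regmat_mult[OF regmat_pow[OF y] v]]) auto
  thus "\<exists>f. Q f \<and> (\<forall>x\<in>X. Krylov n (y x) (v x) $$ (i, j) = f x)" using i by (auto simp: Krylov_def)
qed (simp add: Krylov_carrier)

end

lemma Cot_minv: "fun_algebra.regmat (Cot n) (reg_Cot n) n n (\<lambda>z. minv (pr1 z))"
proof -
  interpret C: fun_algebra "Cot n" "reg_Cot n" by (rule fun_algebra_reg_Cot)
  show ?thesis by (rule C.regmat_minv[OF Cot_coords(1,5,6)])
qed

lemma reg_Cot_Kmat: "fun_algebra.regmat (Cot n) (reg_Cot n) n n (Kmat n)"
proof -
  interpret C: fun_algebra "Cot n" "reg_Cot n" by (rule fun_algebra_reg_Cot)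
  show ?thesis unfolding Kmat_def[abs_def]
    by (intro C.regmat_Krylov C.regmat_mult[where m = n] Cot_coords(1-4) Cot_minv)
qed

lemma reg_Cot_cyc: "reg_Cot n (cyc n)"
proof -
  interpret C: fun_algebra "Cot n" "reg_Cot n" by (rule fun_algebra_reg_Cot)
  show ?thesis unfolding cyc_def[abs_def] by (rule C.det[OF reg_Cot_Kmat])
qed

lemma phi_coords:
  "pr1 (phi n x) = Jmat n * minv (transpose_mat (pr1 x)) * minv (Smat n (cpoly n (pr4 x))) * minv (pr2 x) * Jmat n"
  "pr2 (phi n x) = Jmat n * pr2 x * pr4 x * minv (pr2 x) * Jmat n"
  "pr3 (phi n x) = Jmat n * minv (transpose_mat (pr1 x)) * evec n (n - 1)"
  "pr4 (phi n x) = transpose_mat (pvec n (cpoly n (pr3 x)) - pvec n (cpoly n (pr4 x))) * transpose_mat (pr1 x) * Jmat n"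
  by (simp_all add: phi_def Let_def pr1_def pr2_def pr3_def pr4_def split_beta)

lemma reg_Wh_phi:
  assumes F: "reg_Cot n F" shows "reg_Wh n (\<lambda>x. F (phi n x))"
proof -
  interpret W: fun_algebra "Wh n" "reg_Wh n" by (rule fun_algebra_reg_Wh)
  have co: "\<And>x. x \<in> Wh n \<Longrightarrow> pr3 x \<in> companions n" "\<And>x. x \<in> Wh n \<Longrightarrow> pr4 x \<in> companions n"
    by (auto simp: Wh_def coords)
  note S = W.regmat_Smat[OF Wh_coords(4) co(2)]
  have ci: "W.regmat n n (\<lambda>x. minv (pr1 x))" "W.regmat n n (\<lambda>x. minv (pr2 x))"
    by (rule W.regmat_minv[OF Wh_coords(1) _ Wh_coords(7)], erule Wh_coords(5))
      (rule W.regmat_minv[OF Wh_coords(2) _ Wh_coords(8)], erule Wh_coords(6))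
  have cti: "W.regmat n n (\<lambda>x. minv (transpose_mat (pr1 x)))"
    by (rule W.regmat_cong[OF _ W.regmat_transpose[OF ci(1)]]) (simp add: minv_transpose[OF Wh_coords(5)])
  have pv: "W.regmat n 1 (\<lambda>x. pvec n (cpoly n (A x)))"
    if "W.regmat n n A" "\<And>x. x \<in> Wh n \<Longrightarrow> A x \<in> companions n" for A
    by (rule W.regmatI) (use W.cpoly_coeff[OF that] in \<open>auto simp: pvec_def\<close>)
  note pv' = pv[OF Wh_coords(3) co(1)] pv[OF Wh_coords(4) co(2)]
  note J = W.regmat_const[OF Jmat_simps(1)]
  show ?thesis
  proof (rule W.Cot_comp'[OF F phi_Cot])
    show "W.regmat n n (\<lambda>x. pr1 (phi n x))"
      unfolding phi_coords by (intro W.regmat_mult[where m = n] W.regmat_transpose W.regmat_minus J cti S ci pv' Wh_coords(1-4)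
          W.regmat_const[OF vec_dims(5)])
    show "W.regmat n n (\<lambda>x. pr2 (phi n x))"
      unfolding phi_coords by (intro W.regmat_mult[where m = n] W.regmat_transpose W.regmat_minus J cti S ci pv' Wh_coords(1-4)
          W.regmat_const[OF vec_dims(5)])
    show "W.regmat n 1 (\<lambda>x. pr3 (phi n x))"
      unfolding phi_coords by (intro W.regmat_mult[where m = n] W.regmat_transpose W.regmat_minus J cti S ci pv' Wh_coords(1-4)
          W.regmat_const[OF vec_dims(5)])
    show "W.regmat 1 n (\<lambda>x. pr4 (phi n x))"
      unfolding phi_coords by (intro W.regmat_mult[where m = n] W.regmat_transpose W.regmat_minus J cti S ci pv' Wh_coords(1-4)
          W.regmat_const[OF vec_dims(5)])
    have "reg_Wh n (\<lambda>x. inverse (det (Jmat n)) * inverse (det (Jmat n)) * (det (pr1 x) *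
        det (Smat n (cpoly n (pr4 x))) * det (pr2 x)))"
      by (intro W.mult W.const W.det[where n = n] Wh_coords(1-4) S)
    thus "reg_Wh n (\<lambda>x. inverse (det (pr1 (phi n x))))"
    proof (rule W.cong[rotated])
      fix x assume x: "x \<in> Wh n"
      have S: "Smat n (cpoly n (pr4 x)) \<in> GL n" by (rule Smat_GL[OF cpoly_monic(1)[OF co(2)[OF x]]])
      note G = Wh_coords(5,6)[OF x] S Jmat_GL(1)[of n] GL_transpose[OF Wh_coords(5)[OF x]]
      note G' = G G[THEN GL_minv]
      have "det (pr1 (phi n x)) = det (Jmat n) * inverse (det (pr1 x)) * inverse (det (Smat n (cpoly n (pr4 x)))) *
          inverse (det (pr2 x)) * det (Jmat n)"
        unfolding phi_coords using G'[THEN GL_carrier] G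
        by (simp add: det_mult[of _ n] mult_carrier_mat[of _ n n _ n] det_minv[of _ n] det_transpose)
      thus "inverse (det (Jmat n)) * inverse (det (Jmat n)) * (det (pr1 x) *
          det (Smat n (cpoly n (pr4 x))) * det (pr2 x)) = inverse (det (pr1 (phi n x)))"
        by (simp add: ac_simps)
    qed
  qed
qed

lemma Cot_inv_coords:
  "pr1 (Cot_inv n z) = (- 1) ^ (n - 1) \<cdot>\<^sub>m (Jmat n * minv (transpose_mat (pr1 z)) * Jmat n)"
  "pr2 (Cot_inv n z) = Jmat n * transpose_mat (pr2 z) * Jmat n"
  "pr3 (Cot_inv n z) = - (Jmat n * transpose_mat (pr4 z))"
  "pr4 (Cot_inv n z) = - (transpose_mat (pr3 z) * Jmat n)"
  by (simp_all add: Cot_inv_def Let_def pr1_def pr2_def pr3_def pr4_def split_beta)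

lemma reg_Cot_Cot_inv:
  assumes F: "reg_Cot n F" shows "reg_Cot n (\<lambda>z. F (Cot_inv n z))"
proof -
  interpret C: fun_algebra "Cot n" "reg_Cot n" by (rule fun_algebra_reg_Cot)
  have cti: "C.regmat n n (\<lambda>x. minv (transpose_mat (pr1 x)))"
    by (rule C.regmat_cong[OF _ C.regmat_transpose[OF Cot_minv]]) (simp add: minv_transpose[OF Cot_coords(5)])
  note J = C.regmat_const[OF Jmat_simps(1)]
  show ?thesis
  proof (rule C.Cot_comp'[OF F Cot_inv_Cot])
    show "C.regmat n n (\<lambda>x. pr1 (Cot_inv n x))" "C.regmat n n (\<lambda>x. pr2 (Cot_inv n x))"
      "C.regmat n 1 (\<lambda>x. pr3 (Cot_inv n x))" "C.regmat 1 n (\<lambda>x. pr4 (Cot_inv n x))"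
      unfolding Cot_inv_coords
      by - (intro C.regmat_mult[where m = n] C.regmat_smult C.regmat_transpose C.regmat_uminus J cti Cot_coords(1-4) C.const)+
    have "reg_Cot n (\<lambda>x. inverse (((- 1) ^ (n - 1)) ^ n) * inverse (det (Jmat n)) * inverse (det (Jmat n)) * det (pr1 x))"
      by (intro C.mult C.const C.det[where n = n] Cot_coords(1-4))
    thus "reg_Cot n (\<lambda>x. inverse (det (pr1 (Cot_inv n x))))"
    proof (rule C.cong[rotated])
      fix x assume x: "x \<in> Cot n"
      note G = Cot_coords(5)[OF x] Jmat_GL(1)[of n] GL_transpose[OF Cot_coords(5)[OF x]]
      note G' = G G[THEN GL_minv]
      have "det (pr1 (Cot_inv n x)) = ((- 1) ^ (n - 1)) ^ n * (det (Jmat n) * inverse (det (pr1 x)) * det (Jmat n))"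
        unfolding Cot_inv_coords using G'[THEN GL_carrier] G
        by (simp add: det_mult[of _ n] mult_carrier_mat[of _ n n _ n] det_minv[of _ n] det_transpose mat_dims)
      thus "inverse (((- 1) ^ (n - 1)) ^ n) * inverse (det (Jmat n)) * inverse (det (Jmat n)) * det (pr1 x) =
          inverse (det (pr1 (Cot_inv n x)))"
        by (simp add: ac_simps)
    qed
  qed
qed

lemma Cot_act_coords:
  "pr1 (Cot_act n (k, l) z) = Jmat n * minv (transpose_mat k) * Jmat n * pr1 z * Jmat n * minv l * Jmat n"
  "pr2 (Cot_act n (k, l) z) = Jmat n * l * Jmat n * pr2 z * Jmat n * minv l * Jmat n"
  "pr3 (Cot_act n (k, l) z) = Jmat n * minv (transpose_mat k) * Jmat n * pr3 z"
  "pr4 (Cot_act n (k, l) z) = pr4 z * Jmat n * transpose_mat k * Jmat n"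
  by (simp_all add: Cot_act_def Let_def pr1_def pr2_def pr3_def pr4_def split_beta)

lemma Cot_I:
  "pr1 z \<in> GL n \<Longrightarrow> pr2 z \<in> carrier_mat n n \<Longrightarrow> pr3 z \<in> carrier_mat n 1 \<Longrightarrow> pr4 z \<in> carrier_mat 1 n \<Longrightarrow> z \<in> Cot n"
  unfolding Cot_def by (cases z) (simp add: coords)

lemma reg_Cot_Cot_act:
  assumes k: "k \<in> GL n" and l: "l \<in> GL n"
  shows "z \<in> Cot n \<Longrightarrow> Cot_act n (k, l) z \<in> Cot n"
    and "reg_Cot n F \<Longrightarrow> reg_Cot n (\<lambda>z. F (Cot_act n (k, l) z))"
proof -
  interpret C: fun_algebra "Cot n" "reg_Cot n" by (rule fun_algebra_reg_Cot)
  note J = C.regmat_const[OF Jmat_simps(1)]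
  note G = k l Jmat_GL(1)[of n] GL_transpose[OF k]
  note K = G[THEN GL_carrier, THEN C.regmat_const] G[THEN GL_minv, THEN GL_carrier, THEN C.regmat_const]
  have m: "C.regmat n n (\<lambda>x. pr1 (Cot_act n (k, l) x))" "C.regmat n n (\<lambda>x. pr2 (Cot_act n (k, l) x))"
      "C.regmat n 1 (\<lambda>x. pr3 (Cot_act n (k, l) x))" "C.regmat 1 n (\<lambda>x. pr4 (Cot_act n (k, l) x))"
    unfolding Cot_act_coords by - (intro C.regmat_mult[where m = n] J K Cot_coords(1-4))+
  show Cot: "z \<in> Cot n \<Longrightarrow> Cot_act n (k, l) z \<in> Cot n" for z
  proof (rule Cot_I)
    assume z: "z \<in> Cot n"
    show "pr1 (Cot_act n (k, l) z) \<in> GL n" unfolding Cot_act_coords using G Cot_coords(5)[OF z] by (intro GL_intros)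
  qed (use m C.regmat_carrier in blast)+
  show "reg_Cot n F \<Longrightarrow> reg_Cot n (\<lambda>z. F (Cot_act n (k, l) z))"
  proof (rule C.Cot_comp'[OF _ Cot m(1) _ m(2-4)])
    let ?c = "inverse (det (Jmat n * minv (transpose_mat k) * Jmat n) * det (Jmat n * minv l * Jmat n))"
    have "reg_Cot n (\<lambda>x. ?c * inverse (det (pr1 x)))"
      by (intro C.mult C.const Cot_coords)
    thus "reg_Cot n (\<lambda>x. inverse (det (pr1 (Cot_act n (k, l) x))))"
    proof (rule C.cong[rotated])
      fix x assume x: "x \<in> Cot n"
      have c: "Jmat n * minv (transpose_mat k) * Jmat n \<in> carrier_mat n n" "Jmat n * minv l * Jmat n \<in> carrier_mat n n"
        using G by (auto intro!: GL_carrier GL_intros)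
      have "pr1 (Cot_act n (k, l) x) = (Jmat n * minv (transpose_mat k) * Jmat n) * pr1 x * (Jmat n * minv l * Jmat n)"
        unfolding Cot_act_coords using G[THEN GL_dim(3)] G[THEN GL_dim(4)] Cot_coords(5)[OF x, THEN GL_dim(1)] Cot_coords(5)[OF x, THEN GL_dim(2)]
        by (simp add: mat_assoc mat_dims)
      thus "?c * inverse (det (pr1 x)) = inverse (det (pr1 (Cot_act n (k, l) x)))"
        using c Cot_coords(5)[OF x, THEN GL_carrier] by (simp add: det_mult[of _ n] mult_carrier_mat[of _ n n _ n])
    qed
  qed assumption+
qed


section \<open>Regular functions on \<open>Wh\<close> as fractions\<close>

text \<open>Since the map \<open>phi\<close> is an isomorphism onto the locus where \<open>cyc\<close> does not vanish, regular functions
  on \<open>Wh\<close> are fractions of regular functions on the cotangent bundle.\<close>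

definition is_fraction :: "nat \<Rightarrow> (mat4 \<Rightarrow> complex) \<Rightarrow> bool" where
  "is_fraction n f \<longleftrightarrow> (\<exists>F k. reg_Cot n F \<and> (\<forall>x\<in>Wh n. f x * cyc n (phi n x) ^ k = F (phi n x)))"

lemma fun_algebra_is_fraction: "fun_algebra (Wh n) (is_fraction n)"
proof -
  interpret C: fun_algebra "Cot n" "reg_Cot n" by (rule fun_algebra_reg_Cot)
  show ?thesis
  proof
    show "is_fraction n (\<lambda>x. c)" for c unfolding is_fraction_def
      by (rule exI[of _ "\<lambda>_. c"], rule exI[of _ 0]) (simp add: C.const)
  next
    fix f g assume "is_fraction n f" "is_fraction n g"
    then obtain F k G l where F: "reg_Cot n F" "\<forall>x\<in>Wh n. f x * cyc n (phi n x) ^ k = F (phi n x)"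
      and G: "reg_Cot n G" "\<forall>x\<in>Wh n. g x * cyc n (phi n x) ^ l = G (phi n x)" unfolding is_fraction_def by blast
    have "reg_Cot n (\<lambda>z. F z * cyc n z ^ l + G z * cyc n z ^ k)"
      by (intro C.add C.mult C.power F(1) G(1) reg_Cot_cyc)
    moreover have "(f x + g x) * cyc n (phi n x) ^ (k + l) =
        F (phi n x) * cyc n (phi n x) ^ l + G (phi n x) * cyc n (phi n x) ^ k" if "x \<in> Wh n" for x
      using F(2)[rule_format, OF that, symmetric] G(2)[rule_format, OF that, symmetric]
      by (simp add: power_add algebra_simps)
    ultimately show "is_fraction n (\<lambda>x. f x + g x)" unfolding is_fraction_def
      by (intro exI[of _ "\<lambda>z. F z * cyc n z ^ l + G z * cyc n z ^ k"] exI[of _ "k + l"]) blast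
  next
    fix f g assume "is_fraction n f" "is_fraction n g"
    then obtain F k G l where F: "reg_Cot n F" "\<forall>x\<in>Wh n. f x * cyc n (phi n x) ^ k = F (phi n x)"
      and G: "reg_Cot n G" "\<forall>x\<in>Wh n. g x * cyc n (phi n x) ^ l = G (phi n x)" unfolding is_fraction_def by blast
    have "reg_Cot n (\<lambda>z. F z * G z)"
      by (intro C.mult F(1) G(1))
    moreover have "(f x * g x) * cyc n (phi n x) ^ (k + l) = F (phi n x) * G (phi n x)" if "x \<in> Wh n" for x
      using F(2)[rule_format, OF that, symmetric] G(2)[rule_format, OF that, symmetric]
      by (simp add: power_add algebra_simps)
    ultimately show "is_fraction n (\<lambda>x. f x * g x)" unfolding is_fraction_def
      by (intro exI[of _ "\<lambda>z. F z * G z"] exI[of _ "k + l"]) blast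
  next
    fix f g :: "mat4 \<Rightarrow> complex" assume "\<And>x. x \<in> Wh n \<Longrightarrow> f x = g x" "is_fraction n f"
    thus "is_fraction n g" unfolding is_fraction_def by simp
  qed
qed

lemma is_fraction_phi: "reg_Cot n F \<Longrightarrow> is_fraction n (\<lambda>x. F (phi n x))"
  unfolding is_fraction_def by (rule exI[of _ F], rule exI[of _ 0]) simp

text \<open>
  All coordinates of \<open>Wh\<close> can be recovered from the image under \<open>phi\<close> with no other denominators than the
  determinant of the Krylov matrix \<open>K\<close>: for instance \<open>C\<^sub>q = K\<^sup>-\<^sup>1 (a y a\<^sup>-\<^sup>1) K\<close>, \<open>h = J a\<^sup>-\<^sup>1 K\<close> and \<open>J g\<^sup>-\<^sup>T = K S\<^sub>q\<close>.
\<close>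

lemma reg_Wh_is_fraction:
  assumes n: "n > 0" and f: "reg_Wh n f" shows "is_fraction n f"
proof -
  interpret C: fun_algebra "Cot n" "reg_Cot n" by (rule fun_algebra_reg_Cot)
  interpret R: fun_algebra "Wh n" "is_fraction n" by (rule fun_algebra_is_fraction)
  have lift: "R.regmat r c (\<lambda>x. M (phi n x))" if "C.regmat r c M" for r c M
    using that phi_Cot is_fraction_phi unfolding R.regmat_def C.regmat_def by blast
  note Kr = lift[OF reg_Cot_Kmat]
  have Ki: "R.regmat n n (\<lambda>x. minv (Kmat n (phi n x)))"
  proof (rule R.regmat_minv[OF Kr Kmat_phi_GL[OF n]])
    show "is_fraction n (\<lambda>x. inverse (det (Kmat n (phi n x))))" unfolding is_fraction_def
      by (rule exI[of _ "\<lambda>_. 1"], rule exI[of _ 1])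
        (use cyc_phi[OF n] in \<open>simp add: C.const cyc_def\<close>)
  qed
  have co: "\<And>x. x \<in> Wh n \<Longrightarrow> pr3 x \<in> companions n" "\<And>x. x \<in> Wh n \<Longrightarrow> pr4 x \<in> companions n"
    by (auto simp: Wh_def coords)
  have inv: "is_fraction n (\<lambda>x. inverse (det (M x)))"
    if "\<And>x. x \<in> Wh n \<Longrightarrow> M x \<in> GL n" "R.regmat n n (\<lambda>x. minv (M x))" for M
    by (rule R.cong[OF _ R.det[OF that(2)]]) (simp add: det_minv[OF that(1)])
  note J = R.regmat_const[OF Jmat_simps(1)]
  let ?S = "\<lambda>x. Smat n (cpoly n (pr4 x))" and ?K = "\<lambda>x. Kmat n (phi n x)"
  have eq: "pr4 x = minv (?K x) * (pr1 (phi n x) * pr2 (phi n x) * minv (pr1 (phi n x))) * ?K x"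
      "pr2 x = Jmat n * minv (pr1 (phi n x)) * ?K x" "minv (pr2 x) = minv (?K x) * pr1 (phi n x) * Jmat n"
      "pr1 x = transpose_mat (minv (?S x) * minv (?K x) * Jmat n)" "minv (pr1 x) = transpose_mat (Jmat n * ?K x * ?S x)"
      "transpose_mat (pvec n (cpoly n (pr3 x)) - pvec n (cpoly n (pr4 x))) = pr4 (phi n x) * (?K x * ?S x)"
    if x: "x \<in> Wh n" for x
  proof -
    obtain g h p q where xe: "x = (g, h, companion n p, companion n q)" and g: "g \<in> GL n" and h: "h \<in> GL n"
      and p: "p \<in> monic_polys n" and q: "q \<in> monic_polys n" by (rule WhE[OF x])
    note S = Smat_GL[OF q]
    define G where "G = Jmat n * minv (transpose_mat g)"
    have GG: "G \<in> GL n" unfolding G_def using g by (intro GL_intros)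
    note gT = GL_transpose[OF g]
    note GL = g h S GG gT Jmat_GL(1)[of n]
    note d = GL[THEN GL_dim(1)] GL[THEN GL_dim(2)] GL[THEN GL_dim(3)] GL[THEN GL_dim(4)] mat_dims(5-)
    note can = GL_cancel[OF GG] GL_cancel[OF h] GL_cancel[OF S] GL_cancel[OF g] GL_cancel[OF gT] Jmat_cancel Jmat_simps(3)
    have s: "?S x = Smat n q" "pr1 x = g" "pr2 x = h" "pr3 x = companion n p" "pr4 x = companion n q"
      "cpoly n (pr3 x) = p" "cpoly n (pr4 x) = q" "cpoly n (companion n p) = p" "cpoly n (companion n q) = q"
      by (simp_all add: xe coords cpoly_companion p q)
    note K = Kmat_phi[OF n g h p q, folded G_def xe]
    have mK: "minv (?K x) = Smat n q * minv G" unfolding K(2) using GL by (simp add: minv_mult[of _ n] minv_minv[of _ n] GL_intros)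
    have ph: "pr1 (phi n x) = ?K x * minv h * Jmat n"
      unfolding K(2) unfolding phi_coords s by (simp add: G_def mat_assoc d)
    have KG: "?K x \<in> GL n" by (rule Kmat_phi_GL[OF n x])
    note kd = GL_dim[OF KG] and kc = GL_cancel[OF KG]
    have mph: "minv (pr1 (phi n x)) = Jmat n * h * minv (?K x)"
      unfolding ph using GL KG by (simp add: minv_mult[of _ n] minv_minv[of _ n] GL_intros Jmat_GL(2) mat_assoc d kd)
    have "transpose_mat (companion n q) * (minv (Smat n q) * W) = minv (Smat n q) * (companion n q * W)"
      if "dim_row W = n" for W
    proof -
      have "companion n q * W = companion n q * (Smat n q * (minv (Smat n q) * W))" using that by (simp add: can)
      also have "\<dots> = Smat n q * (transpose_mat (companion n q) * (minv (Smat n q) * W))"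
        using companion_Smat[OF q] that by (simp add: mat_assoc[symmetric] d)
      finally show ?thesis using that by (simp add: can d)
    qed
    from this[of "1\<^sub>m n"] have SC: "transpose_mat (companion n q) * minv (Smat n q) = minv (Smat n q) * companion n q"
      using minv(1)[OF S] companion_carrier(1)[of n q] by simp
    show "pr4 x = minv (?K x) * (pr1 (phi n x) * pr2 (phi n x) * minv (pr1 (phi n x))) * ?K x"
      unfolding mK unfolding K s by (simp add: mat_assoc d can SC)
    show "pr2 x = Jmat n * minv (pr1 (phi n x)) * ?K x"
      unfolding mph s using minv(3)[OF KG] GL_carrier[OF h] by (simp add: mat_assoc d kd can)
    show "minv (pr2 x) = minv (?K x) * pr1 (phi n x) * Jmat n"
      unfolding ph s using minv(1)[OF h] by (simp add: mat_assoc d kd kc can)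
    have m2: "minv G = transpose_mat g * Jmat n" unfolding G_def using g
      by (simp add: minv_mult[of _ n] minv_minv[of _ n] GL_intros Jmat_GL(2))
    show "pr1 x = transpose_mat (minv (?S x) * minv (?K x) * Jmat n)"
      unfolding mK s m2 using GL_carrier[OF gT] by (simp add: mat_assoc d can)
    have "minv (transpose_mat g) = Jmat n * ?K x * Smat n q"
      unfolding K(2) using minv(3)[OF S] GL_carrier[OF GG] minv(1)[OF gT] by (simp add: mat_assoc d can) (simp add: G_def d can)
    thus "minv (pr1 x) = transpose_mat (Jmat n * ?K x * ?S x)"
      unfolding s using minv_transpose[OF g] by (metis transpose_transpose)
    have "?K x * ?S x = G" unfolding K(2) s using minv(3)[OF S] GL_carrier[OF GG] by (simp add: mat_assoc d)
    thus "transpose_mat (pvec n (cpoly n (pr3 x)) - pvec n (cpoly n (pr4 x))) = pr4 (phi n x) * (?K x * ?S x)"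
      unfolding phi_coords s G_def using minv(2)[OF gT]
      by (simp add: mat_assoc d can vec_dims)
  qed
  have cm: "R.regmat n n (\<lambda>x. minv (pr1 (phi n x)))" by (rule lift[OF Cot_minv])
  note cc = Cot_coords(1-4)[THEN lift]
  have r4: "R.regmat n n pr4"
    by (rule R.regmat_cong, erule eq(1)[symmetric]) (intro R.regmat_mult[where m = n] Kr Ki cm cc)+
  have r2: "R.regmat n n pr2"
    by (rule R.regmat_cong, erule eq(2)[symmetric]) (intro R.regmat_mult[where m = n] Kr Ki cm cc J)+
  have r2i: "R.regmat n n (\<lambda>x. minv (pr2 x))"
    by (rule R.regmat_cong, erule eq(3)[symmetric]) (intro R.regmat_mult[where m = n] Kr Ki cm cc J)+
  note S = R.regmat_Smat[OF r4 co(2)]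
  have r1: "R.regmat n n pr1"
    by (rule R.regmat_cong, erule eq(4)[symmetric]) (intro R.regmat_mult[where m = n] R.regmat_transpose Kr Ki cm cc J S)+
  have r1i: "R.regmat n n (\<lambda>x. minv (pr1 x))"
    by (rule R.regmat_cong, erule eq(5)[symmetric]) (intro R.regmat_mult[where m = n] R.regmat_transpose Kr Ki cm cc J S)+
  have rd: "R.regmat 1 n (\<lambda>x. pr4 (phi n x) * (?K x * ?S x))" by (intro R.regmat_mult[where m = n] Kr cc S)
  have r3: "R.regmat n n pr3"
  proof (rule R.regmatI)
    fix x assume "x \<in> Wh n" thus "pr3 x \<in> carrier_mat n n" by (rule Wh_carriers)
  next
    fix i j assume i: "i < n" "j < n"
    let ?f = "\<lambda>x. if j + 1 = n then - (coeff (cpoly n (pr4 x)) i + (pr4 (phi n x) * (?K x * ?S x)) $$ (0, i))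
      else if i = j + 1 then 1 else 0"
    have "is_fraction n (\<lambda>x. - (coeff (cpoly n (pr4 x)) i + (pr4 (phi n x) * (?K x * ?S x)) $$ (0, i)))"
      using i by (intro R.uminus R.add R.cpoly_coeff[OF r4 co(2)] R.regmat_entry[OF rd]) auto
    hence "is_fraction n ?f" by (cases "j + 1 = n"; cases "i = j + 1") (simp_all add: R.const)
    moreover have "pr3 x $$ (i, j) = ?f x" if x: "x \<in> Wh n" for x
    proof -
      have "pr3 x $$ (i, j) = companion n (cpoly n (pr3 x)) $$ (i, j)" by (simp add: cpoly_monic(2)[OF co(1)[OF x]])
      thus ?thesis unfolding eq(6)[OF x, symmetric] using i by (simp add: companion_def pvec_def)
    qed
    ultimately show "\<exists>f. is_fraction n f \<and> (\<forall>x\<in>Wh n. pr3 x $$ (i, j) = f x)" by (intro exI[of _ ?f]) blast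
  qed
  have "is_fraction n (\<lambda>x. f (pr1 x, pr2 x, pr3 x, pr4 x))"
    by (rule R.Wh_comp[OF f r1 Wh_coords(5) inv[OF Wh_coords(5) r1i] r2 Wh_coords(6) inv[OF Wh_coords(6) r2i] r3 co(1) r4 co(2)])
  thus ?thesis by (simp add: coords)
qed


section \<open>Density\<close>

text \<open>A segment in the cotangent bundle with constant first coordinate.  Regular functions restrict to
  polynomials on it, since the inverse of the determinant is constant there.\<close>

definition seg :: "mat4 \<Rightarrow> mat4 \<Rightarrow> complex \<Rightarrow> mat4" where
  "seg z w s = (pr1 z, pr2 z + s \<cdot>\<^sub>m (pr2 w - pr2 z), pr3 z + s \<cdot>\<^sub>m (pr3 w - pr3 z), pr4 z + s \<cdot>\<^sub>m (pr4 w - pr4 z))"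

lemma seg_Cot:
  assumes "z \<in> Cot n" "w \<in> Cot n" shows "seg z w s \<in> Cot n"
  using Cot_coords(5)[OF assms(1)] Cot_carriers[OF assms(1)] Cot_carriers[OF assms(2)]
  by (intro Cot_I) (auto simp: seg_def coords intro!: minus_carrier_mat)

lemma seg_ends:
  assumes z: "z \<in> Cot n" and w: "w \<in> Cot n"
  shows "seg z w 0 = z" "pr1 w = pr1 z \<Longrightarrow> seg z w 1 = w"
proof -
  have a: "A + 0 \<cdot>\<^sub>m (B - A) = A" "A + 1 \<cdot>\<^sub>m (B - A) = B"
    if "A \<in> carrier_mat r c" "B \<in> carrier_mat r c" for A B :: "complex mat" and r c
    by (rule eq_matI; use that in auto)+
  note cz = Cot_carriers[OF z] and cw = Cot_carriers[OF w]
  show "seg z w 0 = z" unfolding seg_def a(1)[OF cz(2) cw(2)] a(1)[OF cz(3) cw(3)] a(1)[OF cz(4) cw(4)] coords ..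
  show "pr1 w = pr1 z \<Longrightarrow> seg z w 1 = w"
    unfolding seg_def a(2)[OF cz(2) cw(2)] a(2)[OF cz(3) cw(3)] a(2)[OF cz(4) cw(4)] by (metis coords(5))
qed

lemma seg_poly:
  assumes F: "reg_Cot n F" and z: "z \<in> Cot n" and w: "w \<in> Cot n"
  shows "\<exists>p. \<forall>s. F (seg z w s) = poly p s"
proof -
  interpret P: fun_algebra UNIV "\<lambda>f. \<exists>p. \<forall>s. f s = poly p s" by (rule fun_algebra_poly)
  note cz = Cot_carriers[OF z, THEN P.regmat_const] and cw = Cot_carriers[OF w, THEN P.regmat_const]
  have id: "\<exists>p. \<forall>s :: complex. s = poly p s" by (rule exI[of _ "[:0, 1:]"]) simp
  show ?thesis unfolding seg_def
    by (rule P.Cot_comp[OF F cz(1) Cot_coords(5)[OF z] P.const])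
      (intro P.regmat_add P.regmat_smult P.regmat_minus cz cw id)+
qed

text \<open>
  On a segment the two functions are polynomials in one variable whose product vanishes.  The hypothesis on \<open>H\<close> is made
  for each value of the first coordinate, because segments keep it fixed.
\<close>

lemma Cot_density:
  assumes F: "reg_Cot n F" and H: "reg_Cot n H" and FH: "\<And>z. z \<in> Cot n \<Longrightarrow> F z * H z = 0"
    and ex: "\<And>a. a \<in> GL n \<Longrightarrow> \<exists>w\<in>Cot n. pr1 w = a \<and> H w \<noteq> 0" and z: "z \<in> Cot n"
  shows "F z = 0"
proof -
  obtain w where w: "w \<in> Cot n" "pr1 w = pr1 z" "H w \<noteq> 0" using ex[OF Cot_coords(5)[OF z]] by blast
  obtain p where p: "\<And>s. F (seg z w s) = poly p s" using seg_poly[OF F z w(1)] by blast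
  obtain q where q: "\<And>s. H (seg z w s) = poly q s" using seg_poly[OF H z w(1)] by blast
  have "poly (p * q) s = 0" for s using FH[OF seg_Cot[OF z w(1)], of s] by (simp add: p q)
  hence "p * q = 0" using poly_all_0_iff_0 by blast
  moreover have "q \<noteq> 0" using q[of 1] w seg_ends(2)[OF z w(1,2)] by auto
  ultimately have "p = 0" by simp
  thus ?thesis using p[of 0] seg_ends(1)[OF z w(1)] by simp
qed

text \<open>
  For \<open>q = p + 1\<close> the matrices \<open>q(C\<^sub>p)\<close> and \<open>p(C\<^sub>q)\<close> are \<open>1\<close> and \<open>- 1\<close> by the theorem of Cayley and Hamilton, so the
  corresponding points of \<open>Wh\<close> lie in \<open>tau_dom\<close>.  The first coordinate of their images is arbitrary, since \<open>h\<close> can be chosen freely.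
\<close>

lemma tau_dom_fibre:
  assumes n: "n > 0" and a: "a \<in> GL n"
  shows "\<exists>x\<in>tau_dom n. pr1 (phi n x) = a"
proof -
  define p :: "complex poly" where "p = monom 1 n"
  define q where "q = p + [:1:]"
  have p: "p \<in> monic_polys n" by (simp add: p_def monic_polys_def degree_monom_eq)
  have "coeff q i = (if i = n then 1 else if i = 0 then 1 else 0)" for i
    using n by (cases i) (auto simp: q_def p_def coeff_pCons)
  note cq = this
  have "degree q = n" using cq by (intro antisym degree_le le_degree) auto
  hence q: "q \<in> monic_polys n" using cq[of n] by (simp add: monic_polys_def)
  have inv: "det (poly_mat s (transpose_mat (companion n r))) \<noteq> 0"
    if r: "r \<in> monic_polys n" and s: "s \<in> monic_polys n" and c: "c \<noteq> 0"
      and e: "pvec n s - pvec n r = c \<cdot>\<^sub>m evec n 0" for r s c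
  proof -
    let ?C = "companion n r"
    have "poly_mat s ?C = c \<cdot>\<^sub>m 1\<^sub>m n"
    proof (rule mat_eq_columns)
      fix k assume k: "k < n"
      have d: "dim_row (?C ^\<^sub>m k) = n" "dim_col (?C ^\<^sub>m k) = n" "dim_row (poly_mat s ?C) = n" "dim_col (poly_mat s ?C) = n"
        using pow_carrier_mat[OF companion_carrier(1), of n r k] poly_mat_carrier[OF companion_carrier(1), of s n r] by auto
      have comm: "poly_mat s ?C * ?C ^\<^sub>m k = ?C ^\<^sub>m k * poly_mat s ?C"
        by (rule poly_mat_intertwine[OF companion_carrier(1) companion_carrier(1)])
          (use pow_mat_intertwine[OF companion_carrier(1) companion_carrier(1) companion_carrier(1) refl, of n r k]
            pow_carrier_mat[OF companion_carrier(1), of n r k] in auto)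
      have "poly_mat s ?C * evec n k = poly_mat s ?C * ?C ^\<^sub>m k * evec n 0"
        using d companion_pow_evec[OF k, of r] by (simp add: mat_assoc vec_dims)
      also have "\<dots> = ?C ^\<^sub>m k * (c \<cdot>\<^sub>m evec n 0)"
        unfolding comm using d poly_mat_companion_evec[OF n r s] e by (simp add: mat_assoc vec_dims)
      also have "\<dots> = c \<cdot>\<^sub>m evec n k"
        using d companion_pow_evec[OF k, of r] by (simp add: mat_mult_smult vec_dims)
      also have "\<dots> = c \<cdot>\<^sub>m 1\<^sub>m n * evec n k" using left_mult_one_mat[OF vec_dims(5)[of n k]] by (simp add: mat_mult_smult vec_dims)
      finally show "poly_mat s ?C * evec n k = c \<cdot>\<^sub>m 1\<^sub>m n * evec n k" .
    qed (use poly_mat_carrier[OF companion_carrier(1), of s n r] in auto)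
    thus ?thesis using c poly_mat_carrier[OF companion_carrier(1), of s n r]
      by (simp add: poly_mat_transpose[OF companion_carrier(1)] det_transpose[of _ n])
  qed
  have 1: "det (poly_mat q (transpose_mat (companion n p))) \<noteq> 0"
    by (rule inv[OF p q, of 1], simp, rule eq_matI) (auto simp: pvec_def evec_def cq p_def)
  have 2: "det (poly_mat p (transpose_mat (companion n q))) \<noteq> 0"
    by (rule inv[OF q p, of "- 1"], simp, rule eq_matI) (auto simp: pvec_def evec_def cq p_def)
  have c: "poly_mat r (transpose_mat (companion n s)) \<in> carrier_mat n n" for r s
    by (rule poly_mat_carrier) (simp add: companion_carrier)
  note S = Smat_GL[OF q]
  define h where "h = Jmat n * minv a * Jmat n * minv (Smat n q)"
  have h: "h \<in> GL n" unfolding h_def using a S by (intro GL_intros)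
  have I: "1\<^sub>m n \<in> GL n" by (simp add: GL_iff)
  have mI: "minv (transpose_mat (1\<^sub>m n)) = 1\<^sub>m n" using GL_I(2)[of "1\<^sub>m n" n "1\<^sub>m n"] by simp
  have hi: "minv h = Smat n q * Jmat n * a * Jmat n" unfolding h_def using a S Jmat_GL[of n]
    by (simp add: minv_mult[of _ n] minv_minv[of _ n] GL_intros mat_assoc GL_dim mat_dims)
  define x where "x = (1\<^sub>m n :: complex mat, h, companion n p, companion n q)"
  have "x \<in> Wh n" unfolding x_def Wh_def companions_def using I h p q by blast
  moreover have "poly_mat q (transpose_mat (companion n p)) \<in> GL n" "poly_mat p (transpose_mat (companion n q)) \<in> GL n"
    unfolding GL_iff using 1 2 c by blast+
  ultimately have "x \<in> tau_dom n" by (simp add: x_def tau_dom_def cpoly_companion p q GL_def)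
  moreover have "pr1 (phi n x) = a"
    unfolding x_def phi_eq[OF p q] coords mI hi using a S GL_carrier[OF a]
    by (simp add: mat_assoc GL_dim mat_dims GL_cancel[OF S] Jmat_cancel Jmat_simps(3))
  ultimately show ?thesis by blast
qed

section \<open>Division by monic polynomials in families\<close>

lemma degree_div_le: "degree (p div q) \<le> degree (p :: 'a :: field poly)"
proof (cases "q = 0 \<or> p div q = 0")
  case False
  hence d: "degree (p div q * q) = degree (p div q) + degree q" by (simp add: degree_mult_eq)
  have "p div q * q = p - p mod q" by (simp add: minus_mod_eq_div_mult)
  hence "degree (p div q * q) \<le> max (degree p) (degree (p mod q))" by (metis degree_diff_le_max)
  moreover have "p mod q = 0 \<or> degree (p mod q) < degree q" using False by (intro degree_mod_less) simp
  ultimately show ?thesis using d by auto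
qed auto

context fun_algebra
begin

definition regpoly :: "('p \<Rightarrow> complex poly) \<Rightarrow> bool" where
  "regpoly P \<longleftrightarrow> (\<forall>i. Q (\<lambda>x. coeff (P x) i)) \<and> (\<exists>N. \<forall>x\<in>X. degree (P x) \<le> N)"

lemma regpoly_add:
  assumes "regpoly P" "regpoly R" shows "regpoly (\<lambda>x. P x + R x)"
proof -
  obtain M N where "\<forall>x\<in>X. degree (P x) \<le> M" "\<forall>x\<in>X. degree (R x) \<le> N" using assms by (auto simp: regpoly_def)
  hence "\<forall>x\<in>X. degree (P x + R x) \<le> max M N" by (meson degree_add_le_max order_trans max.mono)
  thus ?thesis using assms add by (auto simp: regpoly_def)
qed

lemma regpoly_mult:
  assumes "regpoly P" "regpoly R" shows "regpoly (\<lambda>x. P x * R x)"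
proof -
  obtain M N where "\<forall>x\<in>X. degree (P x) \<le> M" "\<forall>x\<in>X. degree (R x) \<le> N" using assms by (auto simp: regpoly_def)
  hence "\<forall>x\<in>X. degree (P x * R x) \<le> M + N" by (meson degree_mult_le order_trans add_mono)
  moreover have "Q (\<lambda>x. coeff (P x * R x) i)" for i
    unfolding coeff_mult using assms by (intro sum mult) (auto simp: regpoly_def)
  ultimately show ?thesis by (auto simp: regpoly_def)
qed

lemma regpoly_monom: "Q f \<Longrightarrow> regpoly (\<lambda>x. monom (f x) k)"
  unfolding regpoly_def
proof (intro conjI allI)
  assume "Q f"
  thus "Q (\<lambda>x. coeff (monom (f x) k) i)" for i by (cases "i = k") (simp_all add: const)
qed (auto intro: degree_monom_le)

lemma regpoly_uminus: "regpoly P \<Longrightarrow> regpoly (\<lambda>x. - P x)"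
  by (auto simp: regpoly_def uminus)

lemma regpoly_power: "regpoly P \<Longrightarrow> regpoly (\<lambda>x. P x ^ k)"
proof (induction k)
  case 0
  show ?case using regpoly_monom[OF const[of 1], of 0] by (simp add: monom_0 one_pCons)
next
  case (Suc k)
  thus ?case by (simp add: regpoly_mult)
qed

text \<open>
  Long division by a monic polynomial only uses ring operations on the coefficients.
\<close>

lemma regpoly_div:
  assumes P: "regpoly P" and M: "regpoly M" and m: "\<And>x. x \<in> X \<Longrightarrow> degree (M x) = m \<and> coeff (M x) m = 1"
  shows "regpoly (\<lambda>x. P x div M x)"
proof -
  have M0: "M x \<noteq> 0" if "x \<in> X" for x using m[OF that] by auto
  have *: "Q (\<lambda>x. coeff (P x div M x) i)"
    if "regpoly P" "\<And>x j. x \<in> X \<Longrightarrow> j \<ge> N \<Longrightarrow> coeff (P x) j = 0" for P N i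
    using that
  proof (induction N arbitrary: P)
    case 0
    hence "P x = 0" if "x \<in> X" for x using that by (intro poly_eqI) simp
    thus ?case by (intro cong[OF _ const[of 0]]) simp
  next
    case (Suc N)
    show ?case
    proof (cases "N < m")
      case True
      have "P x div M x = 0" if "x \<in> X" for x
      proof -
        have "degree (P x) \<le> N" using Suc.prems(2)[OF that] by (intro degree_le) auto
        thus ?thesis using m[OF that] True by (intro div_poly_less) simp
      qed
      thus ?thesis by (intro cong[OF _ const[of 0]]) simp
    next
      case False
      \<comment> \<open>one step of long division: \<open>B M\<close> has the same coefficient in degree \<open>N\<close> as \<open>P\<close>\<close>
      define B where "B x = monom (coeff (P x) N) (N - m)" for x
      define P' where "P' x = P x + - (B x * M x)" for x
      have B: "regpoly B" unfolding B_def[abs_def] using Suc.prems(1) by (intro regpoly_monom) (simp add: regpoly_def)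
      have P': "regpoly P'" unfolding P'_def[abs_def]
        by (intro regpoly_add regpoly_uminus regpoly_mult B M Suc.prems)
      have "coeff (P' x) j = 0" if x: "x \<in> X" and j: "j \<ge> N" for x j
      proof (cases "j = N")
        case True
        have "coeff (B x * M x) N = coeff (P x) N * coeff (M x) m"
          unfolding B_def using False by (subst coeff_monom_mult) auto
        thus ?thesis using True m[OF x] by (simp add: P'_def)
      next
        case jN: False
        hence "j > N" using j by simp
        hence "coeff (B x * M x) j = 0" unfolding B_def using False m[OF x]
          by (subst coeff_monom_mult) (auto intro!: coeff_eq_0)
        thus ?thesis using Suc.prems(2)[OF x, of j] \<open>j > N\<close> by (simp add: P'_def)
      qed
      hence "Q (\<lambda>x. coeff (P' x div M x) i)" by (rule Suc.IH[OF P'])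
      hence "Q (\<lambda>x. coeff (B x) i + coeff (P' x div M x) i)" using B by (intro add) (auto simp: regpoly_def)
      thus ?thesis
      proof (rule cong[rotated])
        fix x assume x: "x \<in> X"
        have "P x = P' x + B x * M x" by (simp add: P'_def)
        hence "P x div M x = B x + P' x div M x" using M0[OF x] by simp
        thus "coeff (B x) i + coeff (P' x div M x) i = coeff (P x div M x) i" by simp
      qed
    qed
  qed
  obtain N where N: "\<forall>x\<in>X. degree (P x) \<le> N" using P by (auto simp: regpoly_def)
  have "Q (\<lambda>x. coeff (P x div M x) i)" for i
    using N by (intro *[OF P, of "Suc N"] coeff_eq_0) auto
  moreover have "\<forall>x\<in>X. degree (P x div M x) \<le> N"
    using N by (meson degree_div_le order_trans)
  ultimately show ?thesis by (auto simp: regpoly_def)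
qed

lemma regpoly_mod:
  assumes P: "regpoly P" and M: "regpoly M" and m: "\<And>x. x \<in> X \<Longrightarrow> degree (M x) = m \<and> coeff (M x) m = 1"
  shows "regpoly (\<lambda>x. P x mod M x)"
proof -
  have "regpoly (\<lambda>x. P x + - (P x div M x * M x))"
    by (intro regpoly_add regpoly_uminus regpoly_mult regpoly_div[OF P M m] P M)
  thus ?thesis by (simp add: minus_div_mult_eq_mod)
qed

end

interpretation Poly: fun_algebra UNIV "\<lambda>f :: complex \<Rightarrow> complex. \<exists>p. \<forall>s. f s = poly p s"
  by (rule fun_algebra_poly)

text \<open>
  If \<open>M\<close> divides \<open>A D\<close> for all parameters \<open>s\<close> and \<open>D\<close> is invertible at \<open>s = 0\<close>, then every power of \<open>s\<close>
  divides the remainder of \<open>A\<close> modulo \<open>M\<close>.  Indeed, cancel a power of \<open>s\<close> from the remainder.  The product with \<open>D\<close> is still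
  divisible by \<open>M\<close> for \<open>s \<noteq> 0\<close>, hence for \<open>s = 0\<close>, where \<open>D\<close> is a unit; as the degree is smaller than that of \<open>M\<close>, the
  cancelled remainder vanishes at \<open>s = 0\<close> and contains another factor \<open>s\<close>.
\<close>

lemma monic_dvd_family:
  assumes A: "Poly.regpoly A" and D: "Poly.regpoly D" and M: "Poly.regpoly M"
    and m: "\<And>s. degree (M s) = m \<and> coeff (M s) m = 1"
    and dvd: "\<And>s. M s dvd A s * D s" and D0: "D 0 = [:c:]" "c \<noteq> 0"
  shows "M s dvd A s"
proof -
  define r where "r s = A s mod M s" for s
  have M0: "M s \<noteq> 0" for s using m[of s] by auto
  have r: "Poly.regpoly r" unfolding r_def[abs_def] by (rule Poly.regpoly_mod[OF A M]) (rule m)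
  have deg: "coeff (r s) i = 0" if "i \<ge> m" for s i
  proof (cases "r s = 0")
    case False
    hence "degree (r s) < m" using degree_mod_less[OF M0, of "A s" s] m[of s] by (auto simp: r_def)
    thus ?thesis using that by (intro coeff_eq_0) simp
  qed simp
  have rdvd: "M s dvd r s * D s" for s
  proof -
    have "A s * D s = (A s div M s * D s) * M s + r s * D s"
      unfolding r_def by (metis div_mult_mod_eq distrib_right mult.assoc mult.commute)
    thus ?thesis using dvd[of s] by (metis dvd_add_right_iff dvd_triv_right)
  qed
  obtain \<rho> where \<rho>: "\<And>i s. coeff (r s) i = poly (\<rho> i) s" using r unfolding Poly.regpoly_def by metis
  have div: "\<exists>\<sigma>. \<forall>i. \<rho> i = [:0, 1:] ^ e * \<sigma> i" for e
  proof (induction e)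
    case 0
    show ?case by (rule exI[of _ \<rho>]) simp
  next
    case (Suc e)
    then obtain \<sigma> where \<sigma>: "\<And>i. \<rho> i = [:0, 1:] ^ e * \<sigma> i" by blast
    \<comment> \<open>the remainder divided by \<open>s\<^sup>e\<close>, a family that makes sense at \<open>s = 0\<close> too\<close>
    define R where "R s = (\<Sum>i<m. monom (poly (\<sigma> i) s) i)" for s
    have cR: "coeff (R s) i = (if i < m then poly (\<sigma> i) s else 0)" for s i
      by (simp add: R_def coeff_sum coeff_monom)
    have rR: "r s = smult (s ^ e) (R s)" for s
      by (rule poly_eqI) (use deg in \<open>auto simp: cR \<rho> \<sigma> not_less\<close>)
    have R: "Poly.regpoly R" unfolding Poly.regpoly_def
    proof (intro conjI allI)
      show "\<exists>p. \<forall>s. coeff (R s) i = poly p s" for i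
        by (rule exI[of _ "if i < m then \<sigma> i else 0"]) (simp add: cR)
      show "\<exists>N. \<forall>s\<in>UNIV. degree (R s) \<le> N"
        by (rule exI[of _ m]) (auto simp: cR intro!: degree_le)
    qed
    have "Poly.regpoly (\<lambda>s. (R s * D s) mod M s)"
      by (rule Poly.regpoly_mod[OF Poly.regpoly_mult[OF R D] M]) (rule m)
    then obtain \<mu> where \<mu>: "\<And>i s. coeff ((R s * D s) mod M s) i = poly (\<mu> i) s"
      unfolding Poly.regpoly_def by metis
    have z: "(R s * D s) mod M s = 0" if "s \<noteq> 0" for s
    proof -
      have "M s dvd smult (s ^ e) (R s * D s)" using rdvd[of s] by (simp add: rR)
      hence "M s dvd R s * D s" using that by (simp add: dvd_smult_iff)
      thus ?thesis by simp
    qed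
    \<comment> \<open>the coefficients of this remainder are polynomials in \<open>s\<close> without nonzero values off \<open>s = 0\<close>\<close>
    have "\<mu> i = 0" for i
    proof (rule ccontr)
      assume "\<mu> i \<noteq> 0"
      moreover have "poly (\<mu> i) s = 0" if "s \<noteq> 0" for s using \<mu>[of s i] z[OF that] by simp
      ultimately have "finite (- {0 :: complex})"
        using finite_subset[of "- {0}" "{s. poly (\<mu> i) s = 0}"] poly_roots_finite[of "\<mu> i"] by auto
      thus False using infinite_UNIV_char_0[where 'a = complex] by (simp add: Compl_eq_Diff_UNIV)
    qed
    hence "(R 0 * D 0) mod M 0 = 0" using \<mu>[of 0] by (intro poly_eqI) simp
    hence "M 0 dvd R 0 * [:c:]" using D0(1) by (simp add: mod_eq_0_iff_dvd)
    hence "M 0 dvd R 0" using D0(2) by (simp add: dvd_smult_iff)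
    hence R0: "R 0 = 0"
    proof (rule contrapos_pp)
      assume nz: "R 0 \<noteq> 0"
      have "degree (R 0) < degree (M 0)"
      proof (rule ccontr)
        assume "\<not> degree (R 0) < degree (M 0)"
        hence "coeff (R 0) (degree (R 0)) = 0" using m[of 0] by (simp add: cR)
        thus False using nz by simp
      qed
      thus "\<not> M 0 dvd R 0" using nz dvd_imp_degree_le[of "M 0" "R 0"] by auto
    qed
    have "[:0, 1:] dvd (if i < m then \<sigma> i else 0)" for i
      using cR[of 0 i] R0 poly_eq_0_iff_dvd[of "\<sigma> i" 0] by (cases "i < m") simp_all
    then obtain \<tau> where \<tau>: "\<And>i. (if i < m then \<sigma> i else 0) = [:0, 1:] * \<tau> i" unfolding dvd_def by metis
    have "\<rho> i = [:0, 1:] ^ Suc e * \<tau> i" for i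
    proof (cases "i < m")
      case True
      thus ?thesis using \<sigma>[of i] \<tau>[of i] by (simp only: power_Suc2 if_True mult.assoc)
    next
      case False
      hence "poly (\<rho> i) s = 0" for s using deg[of i s] \<rho>[of s i] by simp
      hence "\<rho> i = 0" using poly_all_0_iff_0 by blast
      moreover have "\<tau> i = 0" using \<tau>[of i] False by simp
      ultimately show ?thesis by simp
    qed
    thus ?case by blast
  qed
  have "\<rho> i = 0" for i
  proof (rule ccontr)
    assume nz: "\<rho> i \<noteq> 0"
    obtain \<sigma> where "\<rho> i = [:0, 1:] ^ Suc (degree (\<rho> i)) * \<sigma>" using div[of "Suc (degree (\<rho> i))"] by blast
    hence "[:0, 1:] ^ Suc (degree (\<rho> i)) dvd \<rho> i" by (metis dvd_triv_left)
    from dvd_imp_degree_le[OF this nz] show False by (simp add: degree_power_eq del: power_Suc)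
  qed
  hence "r s = 0" using \<rho>[of s] by (intro poly_eqI) simp
  thus ?thesis by (simp add: r_def mod_eq_0_iff_dvd)
qed


section \<open>The cyclicity determinant along a pencil\<close>

definition Lmat :: "nat \<Rightarrow> complex mat" where
  "Lmat n = mat n n (\<lambda>(i, j). if i = j + 1 then 1 else 0)"

lemma Lmat_carrier: "Lmat n \<in> carrier_mat n n" "dim_row (Lmat n) = n" "dim_col (Lmat n) = n"
  by (simp_all add: Lmat_def)

lemma coeff_prod_top:
  assumes "finite I" "\<And>i. i \<in> I \<Longrightarrow> degree (f i) \<le> d i"
  shows "degree (\<Prod>i\<in>I. f i) \<le> (\<Sum>i\<in>I. d i) \<and> coeff (\<Prod>i\<in>I. f i) (\<Sum>i\<in>I. d i) = (\<Prod>i\<in>I. coeff (f i :: 'a :: comm_ring_1 poly) (d i))"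
  using assms
proof (induction I)
  case (insert i I)
  have top: "coeff (p * q) (a + b) = coeff p a * coeff q b" if "degree p \<le> a" "degree q \<le> b" for p q :: "'a poly" and a b
  proof -
    have "coeff (p * q) (a + b) = (\<Sum>k\<le>a + b. if k = a then coeff p a * coeff q b else 0)"
      unfolding coeff_mult
    proof (rule sum.cong)
      fix k assume k: "k \<in> {..a + b}"
      consider "k = a" | "k > a" | "k < a" by linarith
      thus "coeff p k * coeff q (a + b - k) = (if k = a then coeff p a * coeff q b else 0)"
      proof cases
        case 2
        thus ?thesis using that(1) by (simp add: coeff_eq_0)
      next
        case 3
        hence "degree q < a + b - k" using that(2) by linarith
        thus ?thesis using 3 by (simp add: coeff_eq_0)
      qed simp
    qed simp
    thus ?thesis by (simp add: sum.delta)
  qed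
  have d: "degree (f i) \<le> d i" and IH: "degree (\<Prod>i\<in>I. f i) \<le> (\<Sum>i\<in>I. d i)"
      "coeff (\<Prod>i\<in>I. f i) (\<Sum>i\<in>I. d i) = (\<Prod>i\<in>I. coeff (f i) (d i))"
    using insert by auto
  have "degree (f i * (\<Prod>i\<in>I. f i)) \<le> d i + (\<Sum>i\<in>I. d i)"
    using degree_mult_le[of "f i" "\<Prod>i\<in>I. f i"] d IH(1) by linarith
  thus ?case using insert(1,2) top[OF d IH(1)] IH(2) by simp
qed simp

text \<open>
  The term of highest order in \<open>t\<close> of \<open>(M + t L)\<^sup>k (w + t e\<^sub>0)\<close> is \<open>t\<^sup>k\<^sup>+\<^sup>1 L\<^sup>k e\<^sub>0\<close>, which is \<open>t\<^sup>k\<^sup>+\<^sup>1\<close> times the \<open>k\<close>-th basis vector.  Hence the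
  coefficient matrix of the highest terms of the columns is the identity.
\<close>

lemma Krylov_pencil_monic:
  assumes M: "M \<in> carrier_mat n n" and w: "w \<in> carrier_mat n 1"
  shows "\<exists>P. (\<forall>t. det (Krylov n (M + t \<cdot>\<^sub>m Lmat n) (w + t \<cdot>\<^sub>m evec n 0)) = poly P t) \<and>
    degree P = (\<Sum>k<n. k + 1) \<and> coeff P (\<Sum>k<n. k + 1) = 1"
proof -
  let ?Y = "\<lambda>t. M + t \<cdot>\<^sub>m Lmat n" and ?v = "\<lambda>t. w + t \<cdot>\<^sub>m evec n 0"
  have Yc: "?Y t \<in> carrier_mat n n" for t using M by (auto simp: Lmat_carrier)
  have vc: "?v t \<in> carrier_mat n 1" for t using w by (auto simp: vec_dims)
  have "\<exists>f. \<forall>i<n. (\<forall>t. (?Y t ^\<^sub>m k * ?v t) $$ (i, 0) = poly (f i) t) \<and> degree (f i) \<le> k + 1 \<and>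
      coeff (f i) (k + 1) = (if i = k then 1 else 0)" if "k < n" for k
    using that
  proof (induction k)
    case 0
    show ?case
    proof (rule exI[of _ "\<lambda>i. [:w $$ (i, 0), if i = 0 then 1 else 0:]"], intro allI impI conjI)
      fix i t assume i: "i < n"
      have "?Y t ^\<^sub>m 0 * ?v t = ?v t" using M left_mult_one_mat[OF vc[of t]] by (simp add: Lmat_carrier)
      thus "(?Y t ^\<^sub>m 0 * ?v t) $$ (i, 0) = poly [:w $$ (i, 0), if i = 0 then 1 else 0:] t"
        using i w by (simp only:) (auto simp: evec_def)
    qed auto
  next
    case (Suc k)
    then obtain f where f: "\<And>i t. i < n \<Longrightarrow> (?Y t ^\<^sub>m k * ?v t) $$ (i, 0) = poly (f i) t"
      "\<And>i. i < n \<Longrightarrow> degree (f i) \<le> k + 1" "\<And>i. i < n \<Longrightarrow> coeff (f i) (k + 1) = (if i = k then 1 else 0)"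
      by force
    let ?g = "\<lambda>i. \<Sum>j<n. [:M $$ (i, j), if i = j + 1 then 1 else 0:] * f j"
    show ?case
    proof (rule exI[of _ ?g], intro allI impI conjI)
      fix i t assume i: "i < n"
      have "?Y t ^\<^sub>m Suc k = ?Y t * ?Y t ^\<^sub>m k" using pow_mat_intertwine[OF Yc Yc Yc refl, of t k] by simp
      moreover have "dim_row (?Y t ^\<^sub>m k) = n" "dim_col (?Y t ^\<^sub>m k) = n" using pow_carrier_mat[OF Yc, of t k] by auto
      ultimately have "?Y t ^\<^sub>m Suc k * ?v t = ?Y t * (?Y t ^\<^sub>m k * ?v t)"
        by (simp only: assoc_mult_mat[OF Yc pow_carrier_mat[OF Yc] vc])
      also have "\<dots> $$ (i, 0) = (\<Sum>j<n. ?Y t $$ (i, j) * (?Y t ^\<^sub>m k * ?v t) $$ (j, 0))"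
        using i Yc[of t] vc[of t] \<open>dim_row (?Y t ^\<^sub>m k) = n\<close> by (subst mat_mult_entry) auto
      also have "\<dots> = (\<Sum>j<n. poly ([:M $$ (i, j), if i = j + 1 then 1 else 0:] * f j) t)"
      proof (rule sum.cong[OF refl])
        fix j assume "j \<in> {..<n}"
        hence j: "j < n" by simp
        have "?Y t $$ (i, j) = M $$ (i, j) + t * (if i = j + 1 then 1 else 0)"
          using i j M by (auto simp: Lmat_def)
        thus "?Y t $$ (i, j) * (?Y t ^\<^sub>m k * ?v t) $$ (j, 0) =
            poly ([:M $$ (i, j), if i = j + 1 then 1 else 0:] * f j) t"
          unfolding f(1)[OF j] by (simp add: algebra_simps)
      qed
      finally show "(?Y t ^\<^sub>m Suc k * ?v t) $$ (i, 0) = poly (?g i) t" by (simp only: poly_sum)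
    next
      fix i assume i: "i < n"
      show "degree (?g i) \<le> Suc k + 1"
      proof (rule degree_sum_le)
        fix j assume "j \<in> {..<n}"
        hence "degree (f j) \<le> k + 1" using f(2) by simp
        thus "degree ([:M $$ (i, j), if i = j + 1 then 1 else 0:] * f j) \<le> Suc k + 1"
          using degree_mult_le[of "[:M $$ (i, j), if i = j + 1 then 1 else 0:]" "f j"] degree_pCons_le[of "M $$ (i, j)" "[:if i = j + 1 then 1 else 0:]"]
          by simp
      qed simp
      have "coeff (?g i) (Suc k + 1) = (\<Sum>j<n. if i = j + 1 then coeff (f j) (k + 1) else 0)"
        unfolding coeff_sum
      proof (rule sum.cong[OF refl])
        fix j assume "j \<in> {..<n}"
        hence "coeff (f j) (Suc (Suc k)) = 0" using f(2)[of j] by (intro coeff_eq_0) simp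
        thus "coeff ([:M $$ (i, j), if i = j + 1 then 1 else 0:] * f j) (Suc k + 1) =
            (if i = j + 1 then coeff (f j) (k + 1) else 0)" by simp
      qed
      also have "\<dots> = (\<Sum>j<n. if j = k then (if i = j + 1 then 1 else 0) else 0)"
        by (intro sum.cong refl) (auto simp: f(3)[simplified])
      also have "\<dots> = (if i = Suc k then 1 else 0)" using Suc.prems by (simp add: sum.delta)
      finally show "coeff (?g i) (Suc k + 1) = (if i = Suc k then 1 else 0)" .
    qed
  qed
  then obtain f where f: "\<And>k i t. k < n \<Longrightarrow> i < n \<Longrightarrow> (?Y t ^\<^sub>m k * ?v t) $$ (i, 0) = poly (f k i) t"
    "\<And>k i. k < n \<Longrightarrow> i < n \<Longrightarrow> degree (f k i) \<le> k + 1"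
    "\<And>k i. k < n \<Longrightarrow> i < n \<Longrightarrow> coeff (f k i) (k + 1) = (if i = k then 1 else 0)" by metis
  let ?N = "\<Sum>k<n. k + 1"
  define P where "P = (\<Sum>\<sigma>\<in>{\<sigma>. \<sigma> permutes {0..<n}}. smult (signof \<sigma>) (\<Prod>i=0..<n. f (\<sigma> i) i))"
  have \<sigma>: "\<sigma> i < n" if "\<sigma> permutes {0..<n}" "i < n" for \<sigma> i using permutes_in_image[OF that(1), of i] that(2) by auto
  have P: "det (Krylov n (?Y t) (?v t)) = poly P t" for t
    unfolding det_def'[OF Krylov_carrier] P_def poly_sum poly_smult poly_prod
    by (intro sum.cong prod.cong refl arg_cong2[of _ _ _ _ "(*)"]) (auto simp: Krylov_def f(1) \<sigma> simp del: index_mult_mat(1))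
  have top: "degree (\<Prod>i=0..<n. f (\<sigma> i) i) \<le> ?N \<and>
      coeff (\<Prod>i=0..<n. f (\<sigma> i) i) ?N = (\<Prod>i=0..<n. 1\<^sub>m n $$ (i, \<sigma> i))" if p: "\<sigma> permutes {0..<n}" for \<sigma>
  proof -
    have "(\<Sum>i=0..<n. \<sigma> i + 1) = (\<Sum>i=0..<n. i + 1)"
      using sum.permute[OF p, of "\<lambda>i. i + 1"] by (simp add: comp_def)
    hence N: "(\<Sum>i=0..<n. \<sigma> i + 1) = ?N" by (simp add: lessThan_atLeast0)
    have "degree (f (\<sigma> i) i) \<le> \<sigma> i + 1" if "i \<in> {0..<n}" for i using f(2) \<sigma>[OF p] that by simp
    from coeff_prod_top[of "{0..<n}" "\<lambda>i. f (\<sigma> i) i" "\<lambda>i. \<sigma> i + 1", OF _ this]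
    show ?thesis unfolding N using f(3) \<sigma>[OF p] by (auto intro!: prod.cong)
  qed
  have dP: "degree P \<le> ?N" unfolding P_def
  proof (rule degree_sum_le)
    fix \<sigma> assume "\<sigma> \<in> {\<sigma>. \<sigma> permutes {0..<n}}"
    hence "degree (\<Prod>i=0..<n. f (\<sigma> i) i) \<le> ?N" using top by blast
    thus "degree (smult (signof \<sigma>) (\<Prod>i=0..<n. f (\<sigma> i) i)) \<le> ?N" by (rule order_trans[OF degree_smult_le])
  qed (simp add: finite_permutations)
  have c: "coeff P ?N = 1"
  proof -
    have "coeff P ?N = (\<Sum>\<sigma>\<in>{\<sigma>. \<sigma> permutes {0..<n}}. signof \<sigma> * (\<Prod>i=0..<n. 1\<^sub>m n $$ (i, \<sigma> i)))"
      unfolding P_def coeff_sum coeff_smult using top by (intro sum.cong refl) (simp only: mem_Collect_eq)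
    also have "\<dots> = det (1\<^sub>m n)" by (rule det_def'[symmetric]) simp
    finally show ?thesis by simp
  qed
  have "?N \<le> degree P" by (rule le_degree) (simp only: c, simp)
  hence "degree P = ?N" using dP by (rule antisym[rotated])
  thus ?thesis using P c by blast
qed

text \<open>
  The transpose of \<open>L\<close> moves the last basis vector up one step at a time and \<open>t L\<close> only adds vectors further down, so after
  reversing the rows the Krylov matrix is unitriangular, whatever \<open>t\<close> is.
\<close>

lemma Krylov_pencil_const:
  assumes n: "n > 0"
  shows "det (Krylov n (transpose_mat (Lmat n) + t \<cdot>\<^sub>m Lmat n) (evec n (n - 1))) = det (Jmat n)"
proof -
  let ?Y = "transpose_mat (Lmat n) + t \<cdot>\<^sub>m Lmat n" and ?e = "evec n (n - 1)"
  have Y: "?Y \<in> carrier_mat n n" by (auto simp: Lmat_carrier)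
  have ent: "(?Y ^\<^sub>m k * ?e) $$ (i, 0) = (if i + k + 1 = n then 1 else 0)" if "k < n" "i < n" "i + k + 1 \<le> n" for k i
    using that
  proof (induction k arbitrary: i)
    case 0
    have "?Y ^\<^sub>m 0 * ?e = ?e" using left_mult_one_mat[OF vec_dims(5)] by (simp add: Lmat_carrier)
    thus ?case using 0 by (simp only:) (auto simp: evec_def)
  next
    case (Suc k)
    have "?Y ^\<^sub>m Suc k = ?Y * ?Y ^\<^sub>m k" using pow_mat_intertwine[OF Y Y Y refl, of k] by simp
    moreover have d: "dim_row (?Y ^\<^sub>m k) = n" "dim_col (?Y ^\<^sub>m k) = n" using pow_carrier_mat[OF Y, of k] by auto
    ultimately have "?Y ^\<^sub>m Suc k * ?e = ?Y * (?Y ^\<^sub>m k * ?e)"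
      by (simp only: assoc_mult_mat[OF Y pow_carrier_mat[OF Y] vec_dims(5)])
    also have "\<dots> $$ (i, 0) = (\<Sum>j<n. ?Y $$ (i, j) * (?Y ^\<^sub>m k * ?e) $$ (j, 0))"
      using Suc.prems Y d by (subst mat_mult_entry) (auto simp: vec_dims)
    also have "\<dots> = (\<Sum>j<n. if j = i + 1 then (?Y ^\<^sub>m k * ?e) $$ (j, 0) else 0)"
    proof (rule sum.cong[OF refl])
      fix j assume j: "j \<in> {..<n}"
      have "(?Y ^\<^sub>m k * ?e) $$ (j, 0) = 0" if "i = j + 1" using Suc.IH[of j] Suc.prems j that by simp
      moreover have "?Y $$ (i, j) = (if j = i + 1 then 1 else 0) + t * (if i = j + 1 then 1 else 0)"
        using Suc.prems j by (auto simp: Lmat_def)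
      ultimately show "?Y $$ (i, j) * (?Y ^\<^sub>m k * ?e) $$ (j, 0) = (if j = i + 1 then (?Y ^\<^sub>m k * ?e) $$ (j, 0) else 0)"
        by auto
    qed
    also have "\<dots> = (?Y ^\<^sub>m k * ?e) $$ (i + 1, 0)" using Suc.prems by (simp add: sum.delta)
    also have "\<dots> = (if i + Suc k + 1 = n then 1 else 0)" using Suc.IH[of "i + 1"] Suc.prems by simp
    finally show ?case .
  qed
  let ?K = "Krylov n ?Y ?e"
  let ?T = "Jmat n * ?K"
  have T: "?T \<in> carrier_mat n n" by (rule mult_carrier_mat[OF Jmat_simps(1) Krylov_carrier])
  have e: "?T $$ (i, k) = (?Y ^\<^sub>m k * ?e) $$ (n - 1 - i, 0)" if "i < n" "k < n" for i k
    using that by (subst Jmat_mult_entry) (auto simp: Krylov_def)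
  have e': "?T $$ (i, k) = (if i = k then 1 else 0)" if "i < n" "k \<le> i" for i k
    using that e[of i k] ent[of k "n - 1 - i"] by auto
  have "det ?T = prod_list (diag_mat ?T)"
  proof (rule det_upper_triangular[OF _ T])
    show "upper_triangular ?T" using T e' by (auto simp: upper_triangular_def simp del: index_mult_mat(1))
  qed
  also have "diag_mat ?T = map (\<lambda>i. 1) [0..<n]"
    using T e' by (auto simp: diag_mat_def simp del: index_mult_mat(1))
  also have "prod_list \<dots> = 1" by (induction n) auto
  finally have "det (Jmat n) * det ?K = 1" using det_mult[OF Jmat_simps(1) Krylov_carrier] by simp
  moreover have "det (Jmat n) * det (Jmat n) = 1"
    using det_mult[OF Jmat_simps(1) Jmat_simps(1)] by (simp add: Jmat_simps(3))
  ultimately show ?thesis by (metis mult.assoc mult.commute mult_1)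
qed


section \<open>Removing the denominator\<close>

text \<open>
  In the direction of this pencil \<open>a y a\<^sup>-\<^sup>1\<close> moves by \<open>t L\<close> and, on the other side of \<open>Cot_inv\<close>, the vector moves by \<open>t e\<^sub>0\<close>.
  So \<open>cyc \<circ> Cot_inv\<close> becomes a monic polynomial in \<open>t\<close>, by which one can divide.  The vector \<open>v\<close> stays fixed, which leaves room
  for a starting point at which \<open>cyc\<close> itself is constant along the pencil.
\<close>

definition pencil :: "nat \<Rightarrow> mat4 \<Rightarrow> complex \<Rightarrow> mat4" where
  "pencil n z t = (pr1 z, pr2 z + t \<cdot>\<^sub>m (minv (pr1 z) * Lmat n * pr1 z), pr3 z,
     pr4 z + t \<cdot>\<^sub>m (- transpose_mat (evec n (n - 1))))"

lemma pencil_Cot: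
  assumes z: "z \<in> Cot n" shows "pencil n z t \<in> Cot n"
  using Cot_coords(5)[OF z] Cot_carriers[OF z] minv(1)[OF Cot_coords(5)[OF z]]
  by (intro Cot_I) (auto simp: pencil_def coords Lmat_carrier vec_dims)

lemma pencil_0:
  assumes z: "z \<in> Cot n" shows "pencil n z 0 = z"
proof -
  note c = Cot_carriers[OF z] minv(1)[OF Cot_coords(5)[OF z]]
  have "pr2 z + 0 \<cdot>\<^sub>m (minv (pr1 z) * Lmat n * pr1 z) = pr2 z"
    by (rule eq_matI) (use c in \<open>auto simp del: index_mult_mat(1)\<close>)
  moreover have "pr4 z + 0 \<cdot>\<^sub>m (- transpose_mat (evec n (n - 1))) = pr4 z"
    by (rule eq_matI) (use c in \<open>auto simp: evec_def\<close>)
  ultimately show ?thesis by (simp add: pencil_def coords)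
qed

lemma pencil_conj:
  assumes z: "z \<in> Cot n"
  shows "pr1 z * pr2 (pencil n z t) * minv (pr1 z) = pr1 z * pr2 z * minv (pr1 z) + t \<cdot>\<^sub>m Lmat n"
proof -
  let ?a = "pr1 z"
  note a = Cot_coords(5)[OF z] and c = Cot_carriers[OF z]
  note ca = minv(1)[OF a]
  have L: "minv ?a * Lmat n * ?a \<in> carrier_mat n n" using ca c(1) by (auto simp: Lmat_carrier)
  have "pr1 z * pr2 (pencil n z t) = ?a * pr2 z + ?a * (t \<cdot>\<^sub>m (minv ?a * Lmat n * ?a))"
    unfolding pencil_def coords using L by (intro mult_add_distrib_mat[OF c(1,2)]) auto
  also have "?a * (t \<cdot>\<^sub>m (minv ?a * Lmat n * ?a)) = t \<cdot>\<^sub>m (Lmat n * ?a)"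
    using a by (simp add: mat_mult_smult mat_assoc GL_dim Lmat_carrier GL_cancel[OF a])
  also have "(?a * pr2 z + t \<cdot>\<^sub>m (Lmat n * ?a)) * minv ?a = ?a * pr2 z * minv ?a + t \<cdot>\<^sub>m (Lmat n * ?a) * minv ?a"
    using c(1,2) ca by (intro add_mult_distrib_mat[of _ n n _ _ n]) (auto simp: Lmat_carrier)
  also have "t \<cdot>\<^sub>m (Lmat n * ?a) * minv ?a = t \<cdot>\<^sub>m Lmat n"
    using a minv(2)[OF a] Lmat_carrier(1)[of n] by (simp add: mat_mult_smult mat_assoc GL_dim Lmat_carrier)
  finally show ?thesis .
qed

lemma Kmat_pencil:
  "z \<in> Cot n \<Longrightarrow> Kmat n (pencil n z t) = Krylov n (pr1 z * pr2 z * minv (pr1 z) + t \<cdot>\<^sub>m Lmat n) (pr3 z)"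
  unfolding pencil_conj[symmetric] by (simp add: Kmat_def pencil_def coords)

lemma Kmat_Cot_inv:
  assumes z: "z \<in> Cot n"
  shows "Kmat n (Cot_inv n z) =
    Krylov n (Jmat n * transpose_mat (pr1 z * pr2 z * minv (pr1 z)) * Jmat n) (- (Jmat n * transpose_mat (pr4 z)))"
proof -
  let ?a = "pr1 z"
  define c :: complex where "c = (- 1) ^ (n - 1)"
  have c: "c \<noteq> 0" "inverse c = c" "c * c = 1"
    by (auto simp: c_def power_mult_distrib[symmetric] power_inverse[symmetric])
  note a = Cot_coords(5)[OF z] and cc = Cot_carriers[OF z]
  note G = a GL_transpose[OF a]
  note d = G[THEN GL_dim(1)] G[THEN GL_dim(2)] G[THEN GL_dim(3)] G[THEN GL_dim(4)] Jmat_simps(4,5) carrier_matD[OF cc(2)]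
  have "minv (pr1 (Cot_inv n z)) = c \<cdot>\<^sub>m (Jmat n * transpose_mat ?a * Jmat n)"
    unfolding Cot_inv_coords c_def[symmetric] using G c
    by (simp add: minv_smult[of _ n] minv_mult[of _ n] minv_minv[of _ n] GL_intros Jmat_GL(2) mat_assoc d)
  hence "pr1 (Cot_inv n z) * pr2 (Cot_inv n z) * minv (pr1 (Cot_inv n z)) =
      Jmat n * transpose_mat (pr1 z * pr2 z * minv (pr1 z)) * Jmat n"
    using minv_transpose[OF a] c unfolding Cot_inv_coords c_def[symmetric]
    by (simp add: mat_assoc d mat_mult_smult smult_smult_mat one_smult_mat Jmat_cancel mat_transpose_mult)
  thus ?thesis unfolding Kmat_def by (simp add: Cot_inv_coords)
qed

lemma Jmat_Lmat: "Jmat n * transpose_mat (Lmat n) * Jmat n = Lmat n"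
proof (rule eq_matI)
  fix i j assume "i < dim_row (Lmat n)" "j < dim_col (Lmat n)"
  hence i: "i < n" "j < n" by (simp_all add: Lmat_carrier)
  have "Jmat n * transpose_mat (Lmat n) * Jmat n = Jmat n * transpose_mat (Jmat n * Lmat n)"
    by (simp add: mat_assoc mat_transpose_mult Jmat_simps Lmat_carrier)
  also have "\<dots> $$ (i, j) = transpose_mat (Jmat n * Lmat n) $$ (n - 1 - i, j)"
    using i by (intro Jmat_mult_entry) (auto simp: Jmat_simps Lmat_carrier)
  also have "\<dots> = (Jmat n * Lmat n) $$ (j, n - 1 - i)"
    using i by (intro index_transpose_mat) (auto simp: Jmat_simps Lmat_carrier)
  also have "\<dots> = Lmat n $$ (n - 1 - j, n - 1 - i)"
    using i by (intro Jmat_mult_entry) (auto simp: Lmat_carrier)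
  also have "\<dots> = Lmat n $$ (i, j)" using i by (auto simp: Lmat_def)
  finally show "(Jmat n * transpose_mat (Lmat n) * Jmat n) $$ (i, j) = Lmat n $$ (i, j)" .
qed (auto simp: Jmat_simps Lmat_carrier)

lemma cyc_Cot_inv_pencil:
  assumes n: "n > 0" and z: "z \<in> Cot n"
  shows "\<exists>P. (\<forall>t. cyc n (Cot_inv n (pencil n z t)) = poly P t) \<and>
    degree P = (\<Sum>k<n. k + 1) \<and> coeff P (\<Sum>k<n. k + 1) = 1"
proof -
  let ?Y = "pr1 z * pr2 z * minv (pr1 z)" and ?J = "Jmat n"
  note a = Cot_coords(5)[OF z] and cc = Cot_carriers[OF z]
  have Y: "?Y \<in> carrier_mat n n" using cc minv(1)[OF a] by auto
  have "cyc n (Cot_inv n (pencil n z t)) =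
      det (Krylov n (?J * transpose_mat ?Y * ?J + t \<cdot>\<^sub>m Lmat n) (- (?J * transpose_mat (pr4 z)) + t \<cdot>\<^sub>m evec n 0))" for t
  proof -
    have pr1: "pr1 (pencil n z t) = pr1 z" by (simp add: pencil_def coords)
    have "transpose_mat (A + t \<cdot>\<^sub>m Lmat n) = transpose_mat A + t \<cdot>\<^sub>m transpose_mat (Lmat n)"
      if "A \<in> carrier_mat n n" for A by (rule eq_matI) (use that in \<open>auto simp: Lmat_carrier\<close>)
    note tr = this[OF Y]
    have "?J * (transpose_mat ?Y + t \<cdot>\<^sub>m transpose_mat (Lmat n)) = ?J * transpose_mat ?Y + t \<cdot>\<^sub>m (?J * transpose_mat (Lmat n))"
      by (subst mult_add_distrib_mat[of _ n n _ n])
        (use Y in \<open>auto simp: Lmat_carrier Jmat_simps mat_mult_smult\<close>)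
    hence A: "?J * (transpose_mat ?Y + t \<cdot>\<^sub>m transpose_mat (Lmat n)) * ?J =
        ?J * transpose_mat ?Y * ?J + t \<cdot>\<^sub>m (?J * transpose_mat (Lmat n) * ?J)"
      using mult_carrier_mat[OF Jmat_simps(1), of "transpose_mat ?Y" n] Y
      by (simp only:, subst add_mult_distrib_mat[of _ n n _ _ n])
        (auto simp: Lmat_carrier Jmat_simps mat_mult_smult)
    have B: "- (?J * transpose_mat (pr4 (pencil n z t))) = - (?J * transpose_mat (pr4 z)) + t \<cdot>\<^sub>m evec n 0"
    proof (rule col_eqI[of _ n])
      fix i assume i: "i < n"
      have "transpose_mat (pr4 (pencil n z t)) $$ (n - 1 - i, 0) = transpose_mat (pr4 z) $$ (n - 1 - i, 0) - t * (if i = 0 then 1 else 0)"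
        using i n cc by (auto simp: pencil_def coords evec_def)
      moreover have "(?J * transpose_mat (pr4 (pencil n z t))) $$ (i, 0) = transpose_mat (pr4 (pencil n z t)) $$ (n - 1 - i, 0)"
        using i cc by (intro Jmat_mult_entry) (auto simp: pencil_def coords vec_dims)
      moreover have "(?J * transpose_mat (pr4 z)) $$ (i, 0) = transpose_mat (pr4 z) $$ (n - 1 - i, 0)"
        using i cc by (intro Jmat_mult_entry) auto
      ultimately show "(- (?J * transpose_mat (pr4 (pencil n z t)))) $$ (i, 0) = (- (?J * transpose_mat (pr4 z)) + t \<cdot>\<^sub>m evec n 0) $$ (i, 0)"
        using i cc by (simp add: Jmat_simps vec_dims pencil_def coords del: index_mult_mat(1)) (simp add: evec_def)
    qed (use cc in \<open>auto simp: Jmat_simps vec_dims pencil_def coords\<close>)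
    show ?thesis
      unfolding cyc_def Kmat_Cot_inv[OF pencil_Cot[OF z]] pr1 pencil_conj[OF z] tr A B Jmat_Lmat ..
  qed
  note e = this
  have M: "?J * transpose_mat ?Y * ?J \<in> carrier_mat n n"
    by (rule mult_carrier_mat[OF mult_carrier_mat[OF Jmat_simps(1)] Jmat_simps(1)])
      (rule transpose_carrier_mat[THEN iffD2, OF Y])
  have w: "- (?J * transpose_mat (pr4 z)) \<in> carrier_mat n 1"
    by (rule uminus_carrier_mat[OF mult_carrier_mat[OF Jmat_simps(1)]])
      (rule transpose_carrier_mat[THEN iffD2, OF cc(4)])
  show ?thesis unfolding e by (rule Krylov_pencil_monic[OF M w])
qed

text \<open>
  The algebra of functions that are polynomial in the second variable with regular coefficients; the regular functions
  on the cotangent bundle fall into it when they are restricted to pencils.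
\<close>

definition polyfam :: "nat \<Rightarrow> (mat4 \<times> complex \<Rightarrow> complex) \<Rightarrow> bool" where
  "polyfam n f \<longleftrightarrow> (\<exists>P. fun_algebra.regpoly (Cot n) (reg_Cot n) P \<and> (\<forall>z\<in>Cot n. \<forall>t. f (z, t) = poly (P z) t))"

lemma fun_algebra_polyfam: "fun_algebra (Cot n \<times> UNIV) (polyfam n)"
proof -
  interpret C: fun_algebra "Cot n" "reg_Cot n" by (rule fun_algebra_reg_Cot)
  show ?thesis
  proof
    show "polyfam n (\<lambda>x. c)" for c unfolding polyfam_def
      by (rule exI[of _ "\<lambda>z. monom c 0"]) (intro conjI C.regpoly_monom C.const, simp add: poly_monom)
  next
    fix f g assume "polyfam n f" "polyfam n g"
    then obtain P R where "C.regpoly P" "\<forall>z\<in>Cot n. \<forall>t. f (z, t) = poly (P z) t"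
      "C.regpoly R" "\<forall>z\<in>Cot n. \<forall>t. g (z, t) = poly (R z) t" unfolding polyfam_def by blast
    thus "polyfam n (\<lambda>x. f x + g x)" unfolding polyfam_def
      by (intro exI[of _ "\<lambda>z. P z + R z"]) (simp add: C.regpoly_add)
  next
    fix f g assume "polyfam n f" "polyfam n g"
    then obtain P R where "C.regpoly P" "\<forall>z\<in>Cot n. \<forall>t. f (z, t) = poly (P z) t"
      "C.regpoly R" "\<forall>z\<in>Cot n. \<forall>t. g (z, t) = poly (R z) t" unfolding polyfam_def by blast
    thus "polyfam n (\<lambda>x. f x * g x)" unfolding polyfam_def
      by (intro exI[of _ "\<lambda>z. P z * R z"]) (simp add: C.regpoly_mult)
  next
    fix f g :: "mat4 \<times> complex \<Rightarrow> complex" assume "\<And>x. x \<in> Cot n \<times> UNIV \<Longrightarrow> f x = g x" "polyfam n f"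
    thus "polyfam n g" unfolding polyfam_def by simp
  qed
qed

lemma polyfam_pencil:
  assumes F: "reg_Cot n F"
  obtains P where "fun_algebra.regpoly (Cot n) (reg_Cot n) P" "\<And>z t. z \<in> Cot n \<Longrightarrow> F (pencil n z t) = poly (P z) t"
proof -
  interpret C: fun_algebra "Cot n" "reg_Cot n" by (rule fun_algebra_reg_Cot)
  interpret R: fun_algebra "Cot n \<times> UNIV" "polyfam n" by (rule fun_algebra_polyfam)
  have lift: "polyfam n (\<lambda>x. f (fst x))" if "reg_Cot n f" for f
    unfolding polyfam_def by (rule exI[of _ "\<lambda>z. monom (f z) 0"])
      (use C.regpoly_monom[OF that, of 0] in \<open>simp add: poly_monom\<close>)
  have t: "polyfam n snd" unfolding polyfam_def
    by (rule exI[of _ "\<lambda>z. monom 1 1"]) (use C.regpoly_monom[OF C.const[of 1], of 1] in \<open>simp add: poly_monom\<close>)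
  have liftm: "R.regmat r c (\<lambda>x. M (fst x))" if "C.regmat r c M" for r c M
    using that lift unfolding R.regmat_def C.regmat_def by auto
  note cc = Cot_coords(1-4)[THEN liftm] Cot_minv[THEN liftm]
  have "polyfam n (\<lambda>x. F (pencil n (fst x) (snd x)))"
    unfolding pencil_def
  proof (rule R.Cot_comp[OF F cc(1) _ lift[OF Cot_coords(6)]])
    show "pr1 (fst x) \<in> GL n" if "x \<in> Cot n \<times> UNIV" for x using that Cot_coords(5) by auto
  qed (intro R.regmat_add R.regmat_smult R.regmat_mult[where m = n] R.regmat_const t cc Lmat_carrier
      carrier_matI; simp add: vec_dims)+
  then obtain P where "C.regpoly P" "\<forall>z\<in>Cot n. \<forall>t. F (pencil n z t) = poly (P z) t"
    unfolding polyfam_def by auto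
  thus ?thesis using that by blast
qed

lemma regpoly_seg:
  assumes P: "fun_algebra.regpoly (Cot n) (reg_Cot n) P" and z: "z \<in> Cot n" and w: "w \<in> Cot n"
  shows "Poly.regpoly (\<lambda>s. P (seg z w s))"
proof -
  interpret C: fun_algebra "Cot n" "reg_Cot n" by (rule fun_algebra_reg_Cot)
  obtain N where "\<forall>z\<in>Cot n. degree (P z) \<le> N" using P unfolding C.regpoly_def by blast
  thus ?thesis using seg_poly[OF _ z w] P seg_Cot[OF z w] unfolding C.regpoly_def Poly.regpoly_def by blast
qed

text \<open>
  The functions \<open>cyc\<close> and \<open>cyc \<circ> Cot_inv\<close> have no common factor, which is proved here by exhibiting the quotient.
  Along each pencil \<open>cyc \<circ> Cot_inv\<close> is monic, so division with remainder by its power has a quotient and a remainder with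
  regular coefficients.  To see that the remainder vanishes at \<open>z\<close>, join \<open>z\<close> by a segment to a point \<open>w\<close> where \<open>cyc\<close> is a nonzero
  constant along the pencil, and apply \<open>monic_dvd_family\<close> to the polynomials along this segment.
\<close>

lemma cyc_Cot_inv_dvd:
  assumes n: "n > 0" and A: "reg_Cot n A" and B: "reg_Cot n B"
    and AB: "\<And>z. z \<in> Cot n \<Longrightarrow> A z * cyc n z ^ k = B z * cyc n (Cot_inv n z) ^ l"
  obtains H where "reg_Cot n H" "\<And>z. z \<in> Cot n \<Longrightarrow> A z = H z * cyc n (Cot_inv n z) ^ l"
proof -
  interpret C: fun_algebra "Cot n" "reg_Cot n" by (rule fun_algebra_reg_Cot)
  obtain PA where PA: "C.regpoly PA" "\<And>z t. z \<in> Cot n \<Longrightarrow> A (pencil n z t) = poly (PA z) t"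
    using polyfam_pencil[OF A] by blast
  obtain PB where PB: "C.regpoly PB" "\<And>z t. z \<in> Cot n \<Longrightarrow> B (pencil n z t) = poly (PB z) t"
    using polyfam_pencil[OF B] by blast
  obtain PD where PD: "C.regpoly PD" "\<And>z t. z \<in> Cot n \<Longrightarrow> cyc n (pencil n z t) = poly (PD z) t"
    using polyfam_pencil[OF reg_Cot_cyc] by blast
  obtain PE where PE: "C.regpoly PE" "\<And>z t. z \<in> Cot n \<Longrightarrow> cyc n (Cot_inv n (pencil n z t)) = poly (PE z) t"
    using polyfam_pencil[OF reg_Cot_Cot_inv[OF reg_Cot_cyc]] by blast
  define N where "N = (\<Sum>k<n. k + 1)"
  define M where "M z = PE z ^ l" for z
  have PEm: "degree (PE z) = N \<and> coeff (PE z) N = 1" if z: "z \<in> Cot n" for z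
  proof -
    obtain P where P: "\<And>t. cyc n (Cot_inv n (pencil n z t)) = poly P t" "degree P = N" "coeff P N = 1"
      using cyc_Cot_inv_pencil[OF n z] unfolding N_def by blast
    have "poly P = poly (PE z)" using P(1) PE(2)[OF z] by auto
    thus ?thesis using P by (simp add: poly_eq_poly_eq_iff)
  qed
  have M: "C.regpoly M" unfolding M_def[abs_def] by (rule C.regpoly_power[OF PE(1)])
  have Mm: "degree (M z) = N * l \<and> coeff (M z) (N * l) = 1" if "z \<in> Cot n" for z
  proof -
    have "PE z \<noteq> 0" "lead_coeff (PE z) = 1" using PEm[OF that] by auto
    thus ?thesis using PEm[OF that] lead_coeff_power[of "PE z" l] by (simp add: M_def degree_power_eq mult.commute)
  qed
  have eq: "PA z * PD z ^ k = PB z * M z" if z: "z \<in> Cot n" for z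
  proof -
    have "poly (PA z * PD z ^ k) t = poly (PB z * M z) t" for t
      using AB[OF pencil_Cot[OF z]] by (simp add: PA PB PD PE z M_def)
    hence "poly (PA z * PD z ^ k) = poly (PB z * M z)" by auto
    thus ?thesis by (simp add: poly_eq_poly_eq_iff)
  qed
  have dvd: "M z dvd PA z" if z: "z \<in> Cot n" for z
  proof -
    note a = Cot_coords(5)[OF z]
    \<comment> \<open>chosen such that \<open>a y a\<^sup>-\<^sup>1\<close> is the transpose of \<open>L\<close>\<close>
    define w where "w = (pr1 z, minv (pr1 z) * transpose_mat (Lmat n) * pr1 z, evec n (n - 1), pr4 z)"
    have w: "w \<in> Cot n" unfolding w_def
      using a Cot_carriers[OF z] minv(1)[OF a] by (intro Cot_I) (auto simp: coords vec_dims Lmat_carrier)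
    have "pr1 w * pr2 w * minv (pr1 w) = transpose_mat (Lmat n)"
      unfolding w_def coords using a minv(2)[OF a] Lmat_carrier(1)[of n]
      by (simp add: mat_assoc GL_dim Lmat_carrier GL_cancel[OF a])
    hence "cyc n (pencil n w t) = det (Jmat n)" for t
      unfolding cyc_def Kmat_pencil[OF w] using Krylov_pencil_const[OF n] by (simp add: w_def coords)
    hence "poly (PD w) t = poly [:det (Jmat n):] t" for t using PD(2)[OF w] by simp
    hence "poly (PD w) = poly [:det (Jmat n):]" by auto
    hence D0: "PD w = [:det (Jmat n):]" by (simp only: poly_eq_poly_eq_iff)
    have "M (seg w z 1) dvd PA (seg w z 1)"
    proof (rule monic_dvd_family[where D = "\<lambda>s. PD (seg w z s) ^ k" and c = "det (Jmat n) ^ k"])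
      show "Poly.regpoly (\<lambda>s. PA (seg w z s))" by (rule regpoly_seg[OF PA(1) w z])
      show "Poly.regpoly (\<lambda>s. M (seg w z s))" by (rule regpoly_seg[OF M w z])
      show "Poly.regpoly (\<lambda>s. PD (seg w z s) ^ k)" by (rule Poly.regpoly_power[OF regpoly_seg[OF PD(1) w z]])
      show "degree (M (seg w z s)) = N * l \<and> coeff (M (seg w z s)) (N * l) = 1" for s
        by (rule Mm[OF seg_Cot[OF w z]])
      show "M (seg w z s) dvd PA (seg w z s) * PD (seg w z s) ^ k" for s
        unfolding eq[OF seg_Cot[OF w z]] by simp
      show "PD (seg w z 0) ^ k = [:det (Jmat n) ^ k:]" unfolding seg_ends(1)[OF w z] D0
        by (simp add: poly_const_pow)
      show "det (Jmat n) ^ k \<noteq> 0" using Jmat_GL(1)[of n] by (simp add: GL_iff)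
    qed
    thus ?thesis using seg_ends(2)[OF w z] by (simp add: w_def coords)
  qed
  have q: "C.regpoly (\<lambda>z. PA z div M z)" by (rule C.regpoly_div[OF PA(1) M Mm])
  show ?thesis
  proof
    show "reg_Cot n (\<lambda>z. coeff (PA z div M z) 0)" using q by (simp add: C.regpoly_def)
    fix z assume z: "z \<in> Cot n"
    have "A z = poly (PA z div M z * M z) 0"
      using PA(2)[OF z, of 0] dvd[OF z] by (simp add: pencil_0[OF z])
    also have "\<dots> = poly (PA z div M z) 0 * poly (M z) 0" by (rule poly_mult)
    also have "\<dots> = coeff (PA z div M z) 0 * poly (PE z) 0 ^ l"
      unfolding poly_0_coeff_0[of "PA z div M z"] by (simp only: M_def poly_power)
    also have "poly (PE z) 0 = cyc n (Cot_inv n z)" using PE(2)[OF z, of 0] by (simp add: pencil_0[OF z])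
    finally show "A z = coeff (PA z div M z) 0 * cyc n (Cot_inv n z) ^ l" .
  qed
qed


section \<open>The isomorphism of algebras\<close>

lemma tau_dom_function:
  assumes "n > 0"
  shows "\<exists>e. reg_Wh n e \<and> (\<forall>x\<in>Wh n. x \<in> tau_dom n \<longleftrightarrow> e x \<noteq> 0)"
proof -
  interpret W: fun_algebra "Wh n" "reg_Wh n" by (rule fun_algebra_reg_Wh)
  have co: "\<And>x. x \<in> Wh n \<Longrightarrow> pr3 x \<in> companions n" "\<And>x. x \<in> Wh n \<Longrightarrow> pr4 x \<in> companions n"
    by (auto simp: Wh_def coords)
  let ?P = "\<lambda>x. poly_mat (cpoly n (pr4 x)) (transpose_mat (pr3 x))" and ?R = "\<lambda>x. poly_mat (cpoly n (pr3 x)) (transpose_mat (pr4 x))"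
  have deg: "degree (cpoly n a) = n" if "a \<in> companions n" for a
    using cpoly_monic(1)[OF that] by (simp add: monic_polys_def)
  have P: "W.regmat n n ?P" and R: "W.regmat n n ?R"
    by (intro W.regmat_poly_mat W.regmat_transpose Wh_coords(3,4) W.cpoly_coeff co deg; assumption)+
  show ?thesis
  proof (intro exI conjI ballI)
    show "reg_Wh n (\<lambda>x. det (?P x) * det (?R x))" by (intro W.mult W.det[OF P] W.det[OF R])
    fix x assume x: "x \<in> Wh n"
    have "?P x \<in> GL n \<longleftrightarrow> invertible_mat (?P x)" "?R x \<in> GL n \<longleftrightarrow> invertible_mat (?R x)"
      using W.regmat_carrier[OF P x] W.regmat_carrier[OF R x] by (auto simp: GL_def)
    moreover have "?P x \<in> GL n \<longleftrightarrow> det (?P x) \<noteq> 0" "?R x \<in> GL n \<longleftrightarrow> det (?R x) \<noteq> 0"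
      using W.regmat_carrier[OF P x] W.regmat_carrier[OF R x] by (auto simp: GL_iff)
    moreover have "x \<in> tau_dom n \<longleftrightarrow> invertible_mat (?P x) \<and> invertible_mat (?R x)"
      using x by (cases x) (simp add: tau_dom_def coords)
    ultimately show "x \<in> tau_dom n \<longleftrightarrow> det (?P x) * det (?R x) \<noteq> 0" by simp
  qed
qed

text \<open>
  The condition defining \<open>tau_dom\<close> is the nonvanishing of a regular function on \<open>Wh\<close>, hence of a fraction with
  denominator a power of \<open>cyc\<close>; its numerator and \<open>cyc\<close> cut out a dense set.
\<close>

lemma phi_tau_dom_dense:
  assumes n: "n > 0" and F: "reg_Cot n F" and F0: "\<And>x. x \<in> tau_dom n \<Longrightarrow> F (phi n x) = 0" and z: "z \<in> Cot n"
  shows "F z = 0"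
proof -
  interpret C: fun_algebra "Cot n" "reg_Cot n" by (rule fun_algebra_reg_Cot)
  obtain e where e: "reg_Wh n e" "\<And>x. x \<in> Wh n \<Longrightarrow> x \<in> tau_dom n \<longleftrightarrow> e x \<noteq> 0"
    using tau_dom_function[OF n] by blast
  obtain E k where E: "reg_Cot n E" "\<And>x. x \<in> Wh n \<Longrightarrow> e x * cyc n (phi n x) ^ k = E (phi n x)"
    using reg_Wh_is_fraction[OF n e(1)] unfolding is_fraction_def by blast
  show ?thesis
  proof (rule Cot_density[OF F _ _ _ z])
    show "reg_Cot n (\<lambda>z. E z * cyc n z)" by (intro C.mult E(1) reg_Cot_cyc)
    show "F z * (E z * cyc n z) = 0" if z: "z \<in> Cot n" for z
    proof (cases "cyc n z = 0")
      case False
      obtain x where x: "x \<in> Wh n" "phi n x = z" by (rule phi_surj[OF n z False])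
      show ?thesis
      proof (cases "x \<in> tau_dom n")
        case True
        thus ?thesis using F0[OF True] x(2) by simp
      next
        case False
        hence "e x = 0" using e(2)[OF x(1)] by simp
        hence "E z = 0" using E(2)[OF x(1)] x(2) by simp
        thus ?thesis by simp
      qed
    qed simp
    show "\<exists>w\<in>Cot n. pr1 w = a \<and> E w * cyc n w \<noteq> 0" if a: "a \<in> GL n" for a
    proof -
      obtain x where x: "x \<in> tau_dom n" "pr1 (phi n x) = a" using tau_dom_fibre[OF n a] by blast
      have xW: "x \<in> Wh n" using x(1) by (auto simp: tau_dom_def)
      have "e x \<noteq> 0" using x(1) e(2)[OF xW] by simp
      hence "E (phi n x) \<noteq> 0" using E(2)[OF xW, symmetric] cyc_phi[OF n xW] by simp
      thus ?thesis using x(2) phi_Cot[OF xW] cyc_phi[OF n xW] by auto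
    qed
  qed
qed

text \<open>
  Clearing the denominator reduces this to the cotangent bundle.
\<close>

lemma tau_dom_dense:
  assumes n: "n > 0" and f: "reg_Wh n f" and f0: "\<And>x. x \<in> tau_dom n \<Longrightarrow> f x = 0" and x: "x \<in> Wh n"
  shows "f x = 0"
proof -
  obtain F k where F: "reg_Cot n F" "\<And>x. x \<in> Wh n \<Longrightarrow> f x * cyc n (phi n x) ^ k = F (phi n x)"
    using reg_Wh_is_fraction[OF n f] unfolding is_fraction_def by blast
  have "F (phi n y) = 0" if "y \<in> tau_dom n" for y
    using F(2)[of y, symmetric] f0[OF that] that by (auto simp: tau_dom_def)
  hence "F (phi n x) = 0" using phi_tau_dom_dense[OF n F(1)] phi_Cot[OF x] by blast
  thus ?thesis using F(2)[OF x] cyc_phi[OF n x] by simp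
qed

lemma is_tau_pullback_phi:
  assumes n: "n > 0" and F: "reg_Cot n F"
  shows "is_tau_pullback n (\<lambda>x\<in>Wh n. F (phi n x)) (\<lambda>x\<in>Wh n. F (Cot_inv n (phi n x)))"
  unfolding is_tau_pullback_def
proof (intro conjI ballI)
  show "(\<lambda>x\<in>Wh n. F (Cot_inv n (phi n x))) \<in> O_Wh n"
    using reg_Wh_phi[OF reg_Cot_Cot_inv[OF F]] by (simp add: reg_Wh_def)
  fix x assume x: "x \<in> tau_dom n"
  hence "x \<in> Wh n" by (auto simp: tau_dom_def)
  thus "(\<lambda>x\<in>Wh n. F (Cot_inv n (phi n x))) x = (\<lambda>x\<in>Wh n. F (phi n x)) (tau_rho n x)"
    using phi_tau[OF n x] by simp
qed

lemma tau_pullback_eq: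
  assumes n: "n > 0" and f: "is_tau_pullback n f f'"
  shows "tau_pullback n f = f'"
  unfolding tau_pullback_def
proof (rule the_equality)
  show "is_tau_pullback n f f'" by (rule f)
  interpret W: fun_algebra "Wh n" "reg_Wh n" by (rule fun_algebra_reg_Wh)
  fix f'' assume f'': "is_tau_pullback n f f''"
  have r: "reg_Wh n f'" "reg_Wh n f''" "f' \<in> extensional (Wh n)" "f'' \<in> extensional (Wh n)"
    using f f'' by (auto simp: is_tau_pullback_def O_Wh_reg_Wh)
  have "f'' x - f' x = 0" if "x \<in> Wh n" for x
    by (rule tau_dom_dense[OF n W.diff[OF r(2,1)] _ that]) (use f f'' in \<open>simp add: is_tau_pullback_def\<close>)
  thus "f'' = f'" using r(3,4) by (intro extensionalityI[of _ "Wh n"]) auto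
qed

text \<open>
  Write \<open>f = F/cyc\<^sup>k\<close> and \<open>\<tau>\<^sub>\<rho>\<^sup>* f = F'/cyc\<^sup>l\<close> in terms of the cotangent bundle.  As \<open>phi\<close> intertwines \<open>\<tau>\<^sub>\<rho>\<close> and \<open>Cot_inv\<close>, this
  gives \<open>(F \<circ> Cot_inv) cyc\<^sup>l = F' (cyc \<circ> Cot_inv)\<^sup>k\<close>, so \<open>F \<circ> Cot_inv\<close> is divisible by \<open>(cyc \<circ> Cot_inv)\<^sup>k\<close>, that is, \<open>F\<close> by \<open>cyc\<^sup>k\<close>.
\<close>

lemma A_tau_surj:
  assumes n: "n > 0" and f: "f \<in> carrier (A_tau n)"
  obtains F where "F \<in> carrier (O_Cot n)" "f = (\<lambda>x\<in>Wh n. F (phi n x))"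
proof -
  interpret C: fun_algebra "Cot n" "reg_Cot n" by (rule fun_algebra_reg_Cot)
  obtain f' where f': "is_tau_pullback n f f'" and fO: "f \<in> O_Wh n" using f by (auto simp: A_tau_def fun_alg_def)
  have r: "reg_Wh n f" "reg_Wh n f'" "f \<in> extensional (Wh n)"
    using f' fO by (auto simp: is_tau_pullback_def O_Wh_reg_Wh)
  obtain F k where F: "reg_Cot n F" "\<And>x. x \<in> Wh n \<Longrightarrow> f x * cyc n (phi n x) ^ k = F (phi n x)"
    using reg_Wh_is_fraction[OF n r(1)] unfolding is_fraction_def by blast
  obtain F' l where F': "reg_Cot n F'" "\<And>x. x \<in> Wh n \<Longrightarrow> f' x * cyc n (phi n x) ^ l = F' (phi n x)"
    using reg_Wh_is_fraction[OF n r(2)] unfolding is_fraction_def by blast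
  note FI = reg_Cot_Cot_inv[OF F(1)]
  have "F (Cot_inv n z) * cyc n z ^ l - F' z * cyc n (Cot_inv n z) ^ k = 0" if z: "z \<in> Cot n" for z
  proof (rule phi_tau_dom_dense[OF n _ _ z])
    show "reg_Cot n (\<lambda>z. F (Cot_inv n z) * cyc n z ^ l - F' z * cyc n (Cot_inv n z) ^ k)"
      by (intro C.diff C.mult C.power FI F'(1) reg_Cot_cyc reg_Cot_Cot_inv)
    fix x assume x: "x \<in> tau_dom n"
    hence xW: "x \<in> Wh n" by (auto simp: tau_dom_def)
    note t = phi_tau[OF n x]
    have "f' x = f (tau_rho n x)" using f' x by (simp add: is_tau_pullback_def)
    hence "f' x * cyc n (Cot_inv n (phi n x)) ^ k = F (Cot_inv n (phi n x))"
      using F(2)[OF t(1)] by (simp add: t(2))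
    thus "F (Cot_inv n (phi n x)) * cyc n (phi n x) ^ l - F' (phi n x) * cyc n (Cot_inv n (phi n x)) ^ k = 0"
      using F'(2)[OF xW] by (simp flip: F'(2)[OF xW])
  qed
  hence "F (Cot_inv n z) * cyc n z ^ l = F' z * cyc n (Cot_inv n z) ^ k" if "z \<in> Cot n" for z using that by simp
  then obtain H where H: "reg_Cot n H" "\<And>z. z \<in> Cot n \<Longrightarrow> F (Cot_inv n z) = H z * cyc n (Cot_inv n z) ^ k"
    using cyc_Cot_inv_dvd[OF n FI F'(1)] by blast
  have "f x = H (Cot_inv n (phi n x))" if x: "x \<in> Wh n" for x
  proof -
    have "F (phi n x) = H (Cot_inv n (phi n x)) * cyc n (phi n x) ^ k"
      using H(2)[OF Cot_inv_Cot[OF phi_Cot[OF x]]] by (simp add: Cot_inv_invol[OF phi_Cot[OF x]])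
    thus ?thesis using F(2)[OF x] cyc_phi[OF n x] by simp
  qed
  hence "f = (\<lambda>x\<in>Wh n. restrict (\<lambda>z. H (Cot_inv n z)) (Cot n) (phi n x))"
    using r(3) phi_Cot by (intro extensionalityI[of _ "Wh n"]) auto
  moreover have "restrict (\<lambda>z. H (Cot_inv n z)) (Cot n) \<in> carrier (O_Cot n)"
    using reg_Cot_Cot_inv[OF H(1)] by (simp add: reg_Cot_def)
  ultimately show ?thesis using that by blast
qed

definition phi_pullback :: "nat \<Rightarrow> (mat4 \<Rightarrow> complex) \<Rightarrow> (mat4 \<Rightarrow> complex)" where
  "phi_pullback n F = (\<lambda>x\<in>Wh n. F (phi n x))"

lemma phi_pullback_A_tau:
  assumes n: "n > 0" and F: "F \<in> carrier (O_Cot n)" shows "phi_pullback n F \<in> carrier (A_tau n)"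
proof -
  have r: "reg_Cot n F" using F by (simp add: O_Cot_reg_Cot)
  show ?thesis using is_tau_pullback_phi[OF n r] reg_Wh_phi[OF r]
    by (auto simp: A_tau_def fun_alg_def phi_pullback_def reg_Wh_def)
qed

text \<open>
  The map \<open>phi\<close> is dominant.
\<close>

lemma phi_pullback_inj:
  assumes n: "n > 0" shows "inj_on (phi_pullback n) (carrier (O_Cot n))"
proof (rule inj_onI)
  interpret C: fun_algebra "Cot n" "reg_Cot n" by (rule fun_algebra_reg_Cot)
  fix F G assume F: "F \<in> carrier (O_Cot n)" and G: "G \<in> carrier (O_Cot n)" and e: "phi_pullback n F = phi_pullback n G"
  have r: "reg_Cot n F" "reg_Cot n G" "F \<in> extensional (Cot n)" "G \<in> extensional (Cot n)"
    using F G by (auto simp: O_Cot_reg_Cot)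
  have "F z - G z = 0" if "z \<in> Cot n" for z
  proof (rule phi_tau_dom_dense[OF n C.diff[OF r(1,2)] _ that])
    fix x assume "x \<in> tau_dom n"
    hence "x \<in> Wh n" by (auto simp: tau_dom_def)
    thus "F (phi n x) - G (phi n x) = 0" using fun_cong[OF e, of x] by (simp add: phi_pullback_def)
  qed
  thus "F = G" using r(3,4) by (intro extensionalityI[of _ "Cot n"]) auto
qed

lemma cring_fun_alg:
  assumes "fun_algebra X (\<lambda>f. restrict f X \<in> S)" "S \<subseteq> extensional X"
  shows "cring (fun_alg X S)" "\<forall>c. \<forall>f\<in>carrier (fun_alg X S). c \<odot>\<^bsub>fun_alg X S\<^esub> f \<in> carrier (fun_alg X S)"
proof -
  interpret A: fun_algebra X "\<lambda>f. restrict f X \<in> S" by fact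
  have ext: "restrict f X = f" if "f \<in> S" for f using assms(2) that by (auto simp: extensional_restrict)
  have e: "restrict f X \<in> S" if "f \<in> S" for f using ext that by simp
  show "\<forall>c. \<forall>f\<in>carrier (fun_alg X S). c \<odot>\<^bsub>fun_alg X S\<^esub> f \<in> carrier (fun_alg X S)"
    using A.mult[OF A.const e] by (simp add: fun_alg_def)
  have inv: "\<exists>g\<in>S. (\<lambda>x\<in>X. g x + f x) = (\<lambda>x\<in>X. 0)" if "f \<in> S" for f
    by (rule bexI[OF _ A.uminus[OF e[OF that]]]) (auto simp: fun_eq_iff)
  show "cring (fun_alg X S)"
  proof (intro cringI abelian_groupI comm_monoidI)
    fix f assume "f \<in> carrier (fun_alg X S)"
    thus "\<one>\<^bsub>fun_alg X S\<^esub> \<otimes>\<^bsub>fun_alg X S\<^esub> f = f" "\<zero>\<^bsub>fun_alg X S\<^esub> \<oplus>\<^bsub>fun_alg X S\<^esub> f = f"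
      by (auto simp: fun_alg_def intro!: trans[OF restrict_ext ext])
    show "\<exists>g\<in>carrier (fun_alg X S). g \<oplus>\<^bsub>fun_alg X S\<^esub> f = \<zero>\<^bsub>fun_alg X S\<^esub>"
      using inv \<open>f \<in> carrier (fun_alg X S)\<close> by (simp add: fun_alg_def)
  qed (use A.add[OF e e] A.mult[OF e e] A.const in
      \<open>auto simp: fun_alg_def fun_eq_iff restrict_def algebra_simps\<close>)
qed

lemma cring_O_Cot:
  shows "cring (O_Cot n)" "\<forall>c. \<forall>f\<in>carrier (O_Cot n). c \<odot>\<^bsub>O_Cot n\<^esub> f \<in> carrier (O_Cot n)"
proof -
  obtain S where S: "O_Cot n = fun_alg (Cot n) S" by (simp add: O_Cot_def)
  have "fun_algebra (Cot n) (\<lambda>f. restrict f (Cot n) \<in> S)"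
    using fun_algebra_reg_Cot[of n] unfolding reg_Cot_def[abs_def] S by (simp add: fun_alg_def)
  moreover have "S \<subseteq> extensional (Cot n)" using O_Cot_reg_Cot[of _ n] unfolding S by (auto simp: fun_alg_def)
  ultimately show "cring (O_Cot n)" "\<forall>c. \<forall>f\<in>carrier (O_Cot n). c \<odot>\<^bsub>O_Cot n\<^esub> f \<in> carrier (O_Cot n)"
    unfolding S by (rule cring_fun_alg)+
qed

lemma phi_pullback_hom:
  "phi_pullback n (F \<otimes>\<^bsub>O_Cot n\<^esub> G) = phi_pullback n F \<otimes>\<^bsub>A_tau n\<^esub> phi_pullback n G"
  "phi_pullback n (F \<oplus>\<^bsub>O_Cot n\<^esub> G) = phi_pullback n F \<oplus>\<^bsub>A_tau n\<^esub> phi_pullback n G"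
  "phi_pullback n (c \<odot>\<^bsub>O_Cot n\<^esub> F) = c \<odot>\<^bsub>A_tau n\<^esub> phi_pullback n F"
  "phi_pullback n \<one>\<^bsub>O_Cot n\<^esub> = \<one>\<^bsub>A_tau n\<^esub>" "phi_pullback n \<zero>\<^bsub>O_Cot n\<^esub> = \<zero>\<^bsub>A_tau n\<^esub>"
  using phi_Cot by (auto simp: phi_pullback_def O_Cot_def A_tau_def fun_alg_def fun_eq_iff restrict_def)

lemma phi_pullback_bij:
  assumes n: "n > 0" shows "bij_betw (phi_pullback n) (carrier (O_Cot n)) (carrier (A_tau n))"
  unfolding bij_betw_def
proof (intro conjI equalityI subsetI)
  fix f assume "f \<in> carrier (A_tau n)"
  thus "f \<in> phi_pullback n ` carrier (O_Cot n)" using A_tau_surj[OF n] unfolding phi_pullback_def by blast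
qed (use phi_pullback_inj[OF n] phi_pullback_A_tau[OF n] in auto)

lemma phi_pullback_alg_iso:
  assumes n: "n > 0" shows "phi_pullback n \<in> alg_iso (O_Cot n) (A_tau n)"
  using phi_pullback_bij[OF n] phi_pullback_A_tau[OF n]
  unfolding alg_iso_def ring_iso_def by (auto intro!: ring_hom_memI simp: phi_pullback_hom)

lemma cring_A_tau:
  assumes n: "n > 0" shows "cring (A_tau n)"
proof -
  have iso: "phi_pullback n \<in> ring_iso (O_Cot n) (A_tau n)" using phi_pullback_alg_iso[OF n] by (simp add: alg_iso_def)
  have "cring ((A_tau n) \<lparr>zero := phi_pullback n \<zero>\<^bsub>O_Cot n\<^esub>\<rparr>)"
    by (rule cring.ring_iso_imp_img_cring[OF cring_O_Cot(1) iso])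
  thus ?thesis by (simp add: phi_pullback_hom)
qed

text \<open>
  Every element of \<open>\<A>\<^sub>\<tau>\<close> is a pullback along \<open>phi\<close>, so an operator on \<open>\<A>\<^sub>\<tau>\<close> that corresponds to an endomorphism of the
  coordinate ring of the cotangent bundle is itself an endomorphism.  This applies to \<open>tau_pullback\<close>, which is only
  defined by a description.
\<close>

lemma transported_hom:
  assumes n: "n > 0" and \<beta>: "\<beta> \<in> Ring.ring_hom (O_Cot n) (O_Cot n)"
    and \<alpha>: "\<And>F. F \<in> carrier (O_Cot n) \<Longrightarrow> \<alpha> (phi_pullback n F) = phi_pullback n (\<beta> F)"
  shows "\<alpha> \<in> Ring.ring_hom (A_tau n) (A_tau n)"
proof -
  interpret O: cring "O_Cot n" by (rule cring_O_Cot)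
  have c: "\<beta> F \<in> carrier (O_Cot n)" if "F \<in> carrier (O_Cot n)" for F using \<beta> that by (rule ring_hom_closed)
  have ex: "\<exists>F\<in>carrier (O_Cot n). f = phi_pullback n F" if "f \<in> carrier (A_tau n)" for f
    using phi_pullback_bij[OF n] that by (auto simp: bij_betw_def)
  show ?thesis
  proof (rule ring_hom_memI)
    fix f g assume f: "f \<in> carrier (A_tau n)" and g: "g \<in> carrier (A_tau n)"
    obtain F where F: "F \<in> carrier (O_Cot n)" "f = phi_pullback n F" using ex[OF f] by blast
    obtain G where G: "G \<in> carrier (O_Cot n)" "g = phi_pullback n G" using ex[OF g] by blast
    show "\<alpha> f \<in> carrier (A_tau n)" unfolding F(2) \<alpha>[OF F(1)] by (rule phi_pullback_A_tau[OF n c[OF F(1)]])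
    show "\<alpha> (f \<otimes>\<^bsub>A_tau n\<^esub> g) = \<alpha> f \<otimes>\<^bsub>A_tau n\<^esub> \<alpha> g"
      using F(1) G(1) by (simp add: F(2) G(2) \<alpha> ring_hom_mult[OF \<beta>] flip: phi_pullback_hom(1))
    show "\<alpha> (f \<oplus>\<^bsub>A_tau n\<^esub> g) = \<alpha> f \<oplus>\<^bsub>A_tau n\<^esub> \<alpha> g"
      using F(1) G(1) by (simp add: F(2) G(2) \<alpha> ring_hom_add[OF \<beta>] flip: phi_pullback_hom(2))
  next
    show "\<alpha> \<one>\<^bsub>A_tau n\<^esub> = \<one>\<^bsub>A_tau n\<^esub>"
      by (simp add: \<alpha> ring_hom_one[OF \<beta>] flip: phi_pullback_hom(4))
  qed
qed

lemma pullback_hom: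
  assumes "\<And>z. z \<in> Cot n \<Longrightarrow> \<pi> z \<in> Cot n" "\<And>F. reg_Cot n F \<Longrightarrow> reg_Cot n (\<lambda>z. F (\<pi> z))"
  shows "pullback (Cot n) \<pi> \<in> Ring.ring_hom (O_Cot n) (O_Cot n)"
proof (rule ring_hom_memI)
  fix F assume "F \<in> carrier (O_Cot n)"
  hence "reg_Cot n F" by (simp add: O_Cot_reg_Cot)
  from assms(2)[OF this] show "pullback (Cot n) \<pi> F \<in> carrier (O_Cot n)" by (simp add: pullback_def reg_Cot_def)
qed (use assms(1) in \<open>auto simp: pullback_def O_Cot_def fun_alg_def fun_eq_iff\<close>)

theorem corollary5p2:
  fixes n :: nat
  assumes "n > 0"
  shows "\<exists>\<Phi>. aff_iso (A_tau n) (O_Cot n) \<Phi> \<and>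
    (\<forall>\<gamma>\<in>GL n \<times> GL n.
       intertwines (A_tau n) (O_Cot n) \<Phi>
         (Spec_mor (A_tau n) (A_tau n) (pullback (Wh n) (Wh_act \<gamma>)))
         (Spec_mor (O_Cot n) (O_Cot n) (pullback (Cot n) (Cot_act n \<gamma>)))) \<and>
    intertwines (A_tau n) (O_Cot n) \<Phi>
      (Spec_mor (A_tau n) (A_tau n) (tau_pullback n))
      (Spec_mor (O_Cot n) (O_Cot n) (pullback (Cot n) (Cot_inv n)))"
proof (intro exI conjI ballI)
  let ?\<Phi> = "Spec_mor (O_Cot n) (A_tau n) (phi_pullback n)"
  note O = cring_O_Cot(1)[of n] and A = cring_A_tau[OF assms]
  note iso = phi_pullback_alg_iso[OF assms]
  have hom: "phi_pullback n \<in> Ring.ring_hom (O_Cot n) (A_tau n)" using iso by (simp add: alg_iso_def ring_iso_def)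
  show "aff_iso (A_tau n) (O_Cot n) ?\<Phi>" by (rule aff_iso_Spec_mor[OF O A iso cring_O_Cot(2)])
  show "intertwines (A_tau n) (O_Cot n) ?\<Phi>
      (Spec_mor (A_tau n) (A_tau n) (pullback (Wh n) (Wh_act \<gamma>)))
      (Spec_mor (O_Cot n) (O_Cot n) (pullback (Cot n) (Cot_act n \<gamma>)))" if \<gamma>: "\<gamma> \<in> GL n \<times> GL n" for \<gamma>
  proof -
    have \<beta>: "pullback (Cot n) (Cot_act n \<gamma>) \<in> Ring.ring_hom (O_Cot n) (O_Cot n)"
      using \<gamma> reg_Cot_Cot_act by (cases \<gamma>) (auto intro!: pullback_hom)
    have \<alpha>: "pullback (Wh n) (Wh_act \<gamma>) (phi_pullback n F) = phi_pullback n (pullback (Cot n) (Cot_act n \<gamma>) F)" for F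
      using phi_act[OF \<gamma>] Wh_act_Wh[OF \<gamma>] phi_Cot by (auto simp: pullback_def phi_pullback_def fun_eq_iff)
    have "pullback (Wh n) (Wh_act \<gamma>) \<in> Ring.ring_hom (A_tau n) (A_tau n)"
      by (rule transported_hom[OF assms \<beta>]) (rule \<alpha>)
    thus ?thesis by (rule intertwines_Spec_mor[OF O A hom _ \<beta>]) (rule \<alpha>)
  qed
  have \<beta>: "pullback (Cot n) (Cot_inv n) \<in> Ring.ring_hom (O_Cot n) (O_Cot n)"
    by (rule pullback_hom, erule Cot_inv_Cot, erule reg_Cot_Cot_inv)
  have \<alpha>: "tau_pullback n (phi_pullback n F) = phi_pullback n (pullback (Cot n) (Cot_inv n) F)"
    if "F \<in> carrier (O_Cot n)" for F
  proof -
    have "reg_Cot n F" using that by (simp add: O_Cot_reg_Cot)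
    from tau_pullback_eq[OF assms is_tau_pullback_phi[OF assms this]] show ?thesis
      using phi_Cot by (auto simp: phi_pullback_def pullback_def fun_eq_iff)
  qed
  have "tau_pullback n \<in> Ring.ring_hom (A_tau n) (A_tau n)"
    by (rule transported_hom[OF assms \<beta>]) (rule \<alpha>)
  thus "intertwines (A_tau n) (O_Cot n) ?\<Phi> (Spec_mor (A_tau n) (A_tau n) (tau_pullback n))
      (Spec_mor (O_Cot n) (O_Cot n) (pullback (Cot n) (Cot_inv n)))"
    by (rule intertwines_Spec_mor[OF O A hom _ \<beta>]) (rule \<alpha>)
qed

end
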